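(* Assume the following. (i) $E_{P_0}[Y|X,W]=X\beta_0+\eta_0(W)$ and $\mathrm{Var}_{P_0}[Y|X,W]=\sigma_{01}^2$ for some $(\beta_0,\eta_0,\sigma_{01}^2)\in\mathcal B\times\mathcal H\times(0,\infty)$, with $\mathcal B\subseteq\mathbb R$ and $\mathcal H\subseteq L^2(\mathcal W)$. (ii) There are constants $0<\underline c<\overline c<\infty$ with $E_{P_0}[(X-m_{02}(W))^2]\in[\underline c,\overline c]$. (iii) The conditional distribution of $(Y,X)'$ given $W$ has a density $p_{0,YX|W}$ with respect to Lebesgue measure and $E_{P_0}|\log p_{0,YX|W}(Y,X|W)|\in(0,\infty)$. (iv) $E_{P_0}[(Y-m_{01}(W))^2]\in(0,\infty)$ and $E_{P_0}[(X-m_{02}(W))^4]\in(0,\infty)$. (v) $P_0^\infty\left(\int_{\mathcal B\times\mathcal M}L_n(\beta,m)\,d\Pi(\beta,m)\in(0,\infty)\right)=1$. (vi) $\Pi_{\mathcal B}$ has a Lebesgue density $\pi_{\mathcal B}$ that is continuous and positive over a neighborhood of $\beta_0$. (vii) There exist a sequence $\{\delta_n\}_{n\ge1}$ with $\delta_n=o(n^{-1/4})$ and a (large) constant $D>0$ such that, for $P_{0,W}^\infty$-almost every realization $\{w_i\}_{i\ge1}$ of $\{W_i\}_{i\ge1}$, $\Pi(m\in B_{n,\mathcal M}(m_0,D\delta_n)\,|\,\{(Y_i,X_i,w_i')'\}_{i=1}^n)\to1$ in $P_{0,YX|W}^{(n)}$-probability as $n\to\infty$. (viii) There are sets $\{\mathcal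 M_n\}_{n\ge1}$, $\mathcal M_n\subseteq\mathcal M$, such that, for $P_{0,W}^\infty$-almost every realization $\{w_i\}_{i\ge1}$ of $\{W_i\}_{i\ge1}$, the following hold in $P_{0,YX|W}^{(n)}$-probability as $n\to\infty$: $\Pi(m\in\mathcal M_n\,|\,\{(Y_i,X_i,w_i')'\}_{i=1}^n)\to1$ and, for $k\in\{1,2\}$, $\sup_{m\in\mathcal M_n\cap B_{n,\mathcal M}(m_0,D\delta_n)}|G_n^{(k)}(m)|\to0$, where $$G_n^{(1)}(m)=\frac1{\sqrt n}\sum_{i=1}^n\varepsilon_{i2}(m_1(w_i)-m_{01}(w_i)),\qquad G_n^{(2)}(m)=\frac1{\sqrt n}\sum_{i=1}^n(U_i-\beta_0\varepsilon_{i2})(m_2(w_i)-m_{02}(w_i)),$$ $\varepsilon_{i2}=X_i-m_{02}(w_i)$ and $U_i=Y_i-m_{01}(w_i)-(X_i-m_{02}(w_i))\beta_0$. (ix) $\beta_0\in\mathrm{int}(\mathcal B)$. Let $$\tilde I_n(m_0)=\frac1n\sum_{i=1}^n\left(\frac{X_i-m_{02}(w_i)}{\sigma_{01}}\right)^2,\qquad \tilde\ell_n(\beta_0,m_0)=\frac1{\sigma_{01}^2}\sum_{i=1}^n(Y_i-m_{01}(w_i)-(X_i-m_{02}(w_i))\beta_0)(X_i-m_{02}(w_i)),$$ $$\tilde\Delta_{n,0}=\tilde I_n(m_0)^{-1}\frac1{\sqrt n}\tilde\ell_n(\beta_0,m_0).$$ Then, for $P_{0,W}^\infty$-almost every fixed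 realization $\{w_i\}_{i\ge1}$ of $\{W_i\}_{i\ge1}$, as $n\to\infty$, $$\left\|\Pi(\beta\in\cdot\,|\,\{(Y_i,X_i,w_i')'\}_{i=1}^n)-\mathcal N\left(\beta_0+\frac{\tilde\Delta_{n,0}}{\sqrt n},\frac1n\tilde I_n(m_0)^{-1}\right)\right\|_{TV}\to0\quad\text{in }P_{0,YX|W}^{(n)}\text{-probability}.$$
   Context: Data. $(Y,X,W')'$ is a random vector with law $P_0$, $Y\in\mathcal Y\subseteq\mathbb R$, $X\in\mathcal X\subseteq\mathbb R$, $W\in\mathcal W\subseteq\mathbb R^{d_w}$, $d_w<\infty$. The sequence $\{(Y_i,X_i,W_i')'\}_{i\ge1}$ is i.i.d. from $P_0$, with joint law $P_0^\infty$; $P_{0,W}^\infty$ is the law of $\{W_i\}_{i\ge1}$. $L^2(\mathcal W)$ is the set of $f$ with $E_{P_0}[f^2(W)]<\infty$. Put $m_{01}(W)=E_{P_0}[Y|W]$, $m_{02}(W)=E_{P_0}[X|W]$, $m_0=(m_{01},m_{02})$. For a fixed realization $\{w_i\}_{i\ge1}$ of $\{W_i\}_{i\ge1}$, $P_{0,YX|W}^{(n)}=\bigotimes_{i=1}^nP_{0,YX|w_i}$, where $P_{0,YX|w}$ is the conditional law of $(Y,X)'$ given $W=w$; i.e. the $(Y_i,X_i)$ are independent with $(Y_i,X_i)\sim P_{0,YX|w_i}$. Model. The variances $\sigma_{01}^2,\sigma_{02}^2\in(0,\infty)$ are known, with $\sigma_{01}^2=\mathrm{Var}_{P_0}[Y|X,W]$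 and $\sigma_{02}^2$ an arbitrary fixed positive number. Parameters: $\beta\in\mathcal B\subseteq\mathbb R$ and $m=(m_1,m_2)\in\mathcal M=\mathcal M_1\times\mathcal M_2$ with $\mathcal M_j\subseteq L^2(\mathcal W)$. The (quasi-)likelihood is $L_n(\beta,m)=\prod_{i=1}^np_{\beta,m}(Y_i,X_i|W_i)$, where $p_{\beta,m}(\cdot|w)$ is the density of the bivariate normal distribution with mean $(m_1(w),m_2(w))'$ and covariance $$V(\beta)=\begin{pmatrix}\sigma_{01}^2+\sigma_{02}^2\beta^2&\beta\sigma_{02}^2\\\beta\sigma_{02}^2&\sigma_{02}^2\end{pmatrix}.$$ The model need not be correctly specified. The prior is $\Pi=\Pi_{\mathcal B}\otimes\Pi_{\mathcal M}$, with $\Pi_{\mathcal B},\Pi_{\mathcal M}$ probability measures on $\mathcal B,\mathcal M$. The posterior is $$\Pi((\beta,m)\in A\,|\,\text{data})=\frac{\int_AL_n(\beta,m)\,d\Pi(\beta,m)}{\int_{\mathcal B\times\mathcal M}L_n(\beta,m)\,d\Pi(\beta,m)},$$ and $\Pi(\beta\in\cdot|\text{data})$, $\Pi(m\in\cdot|\text{data})$ are its marginals. Norms. $\|f\|_{n,2}=(n^{-1}\sum_{i=1}^nf(w_i)^2)^{1/2}$; $B_{n,\mathcal M}(m_0,\delta)$ is the set of $m\in\mathcal M$ with $\max\{\|m_1-m_{01}\|_{n,2},\|m_2-m_{02}\|_{n,2}\}<\delta$. Total variation: $\|P-Q\|_{TV}=\sup_A|P(A)-Q(A)|$. *)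

theory Defs
  imports "HOL-Probability.Probability"
begin

text \<open>
  An observation is a triple \<open>(Y, X, W)\<close>. Sequences of observations are indexed from \<open>0\<close>, so the
  first \<open>n\<close> of them carry the indices \<open>i < n\<close>.
\<close>

type_synonym 'd obs = "real \<times> real \<times> (real ^ 'd)"
type_synonym 'd fn_pair = "((real ^ 'd) \<Rightarrow> real) \<times> ((real ^ 'd) \<Rightarrow> real)"

definition obs_Y :: "'d::finite obs \<Rightarrow> real" where "obs_Y \<omega> = fst \<omega>"
definition obs_X :: "'d::finite obs \<Rightarrow> real" where "obs_X \<omega> = fst (snd \<omega>)"
definition obs_W :: "'d::finite obs \<Rightarrow> real ^ 'd" where "obs_W \<omega> = snd (snd \<omega>)"

definition sigma_of :: "'a measure \<Rightarrow> ('a \<Rightarrow> 'b::topological_space) \<Rightarrow> 'a measure" where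
  "sigma_of P V = vimage_algebra (space P) V borel"

definition cond_var :: "'a measure \<Rightarrow> 'a measure \<Rightarrow> ('a \<Rightarrow> real) \<Rightarrow> 'a \<Rightarrow> real" where
  "cond_var P F Y = real_cond_exp P F (\<lambda>\<omega>. (Y \<omega> - real_cond_exp P F Y \<omega>)\<^sup>2)"

definition law_W :: "'d::finite obs measure \<Rightarrow> (real ^ 'd) set \<Rightarrow> (real ^ 'd) measure" where
  "law_W P0 WW = distr P0 (restrict_space borel WW) obs_W"

definition L2_W :: "'d::finite obs measure \<Rightarrow> (real ^ 'd) set \<Rightarrow> ((real ^ 'd) \<Rightarrow> real) set" where
  "L2_W P0 WW = {f. f \<in> borel_measurable (restrict_space borel WW) \<and>
                    integrable P0 (\<lambda>\<omega>. (f (obs_W \<omega>))\<^sup>2)}"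

text \<open>\<open>f\<close> is a version of \<open>w \<mapsto> E[V | W = w]\<close>.\<close>

definition is_regression ::
  "'d::finite obs measure \<Rightarrow> (real ^ 'd) set \<Rightarrow> ('d obs \<Rightarrow> real) \<Rightarrow> ((real ^ 'd) \<Rightarrow> real) \<Rightarrow> bool" where
  "is_regression P0 WW V f \<longleftrightarrow>
     integrable P0 V \<and> f \<in> borel_measurable (restrict_space borel WW) \<and>
     (AE \<omega> in P0. f (obs_W \<omega>) = real_cond_exp P0 (sigma_of P0 obs_W) V \<omega>)"

definition is_cond_law_YX ::
  "'d::finite obs measure \<Rightarrow> (real ^ 'd) set \<Rightarrow> ((real ^ 'd) \<Rightarrow> (real \<times> real) measure) \<Rightarrow> bool" where
  "is_cond_law_YX P0 WW K \<longleftrightarrow>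
     K \<in> measurable (restrict_space borel WW) (prob_algebra borel) \<and>
     (\<forall>A \<in> sets borel. \<forall>B \<in> sets (restrict_space borel WW).
        emeasure P0 {\<omega> \<in> space P0. (obs_Y \<omega>, obs_X \<omega>) \<in> A \<and> obs_W \<omega> \<in> B} =
        (\<integral>\<^sup>+ w \<in> B. emeasure (K w) A \<partial>law_W P0 WW))"

definition cond_data_law ::
  "((real ^ 'd) \<Rightarrow> (real \<times> real) measure) \<Rightarrow> (nat \<Rightarrow> real ^ 'd) \<Rightarrow> nat \<Rightarrow>
   (nat \<Rightarrow> real \<times> real) measure" where
  "cond_data_law K w n = Pi\<^sub>M {..<n} (\<lambda>i. K (w i))"

definition mvnormal_density :: "real ^ 'k \<Rightarrow> real ^ 'k ^ 'k \<Rightarrow> real ^ 'k \<Rightarrow> real" where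
  "mvnormal_density \<mu> V z =
     exp (- ((z - \<mu>) \<bullet> (matrix_inv V *v (z - \<mu>))) / 2) / sqrt ((2 * pi) ^ CARD('k) * det V)"

definition V_mat :: "real \<Rightarrow> real \<Rightarrow> real \<Rightarrow> real ^ 2 ^ 2" where
  "V_mat \<sigma>1 \<sigma>2 \<beta> = vector [vector [\<sigma>1\<^sup>2 + \<sigma>2\<^sup>2 * \<beta>\<^sup>2, \<beta> * \<sigma>2\<^sup>2], vector [\<beta> * \<sigma>2\<^sup>2, \<sigma>2\<^sup>2]]"

definition lik ::
  "real \<Rightarrow> real \<Rightarrow> nat \<Rightarrow> (nat \<Rightarrow> real \<times> real) \<Rightarrow> (nat \<Rightarrow> real ^ 'd::finite) \<Rightarrow> real \<times> 'd fn_pair \<Rightarrow> real" where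
  "lik \<sigma>1 \<sigma>2 n yx w = (\<lambda>(\<beta>, m1, m2).
     \<Prod>i<n. mvnormal_density (vector [m1 (w i), m2 (w i)]) (V_mat \<sigma>1 \<sigma>2 \<beta>)
              (vector [fst (yx i), snd (yx i)]))"

definition evidence ::
  "real \<Rightarrow> real \<Rightarrow> real measure \<Rightarrow> 'd::finite fn_pair measure \<Rightarrow> nat \<Rightarrow> (nat \<Rightarrow> real \<times> real) \<Rightarrow>
   (nat \<Rightarrow> real ^ 'd) \<Rightarrow> ennreal" where
  "evidence \<sigma>1 \<sigma>2 \<Pi>B \<Pi>M n yx w = (\<integral>\<^sup>+ \<theta>. ennreal (lik \<sigma>1 \<sigma>2 n yx w \<theta>) \<partial>(\<Pi>B \<Otimes>\<^sub>M \<Pi>M))"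

definition posterior ::
  "real \<Rightarrow> real \<Rightarrow> real measure \<Rightarrow> 'd::finite fn_pair measure \<Rightarrow> nat \<Rightarrow> (nat \<Rightarrow> real \<times> real) \<Rightarrow>
   (nat \<Rightarrow> real ^ 'd) \<Rightarrow> (real \<times> 'd fn_pair) measure" where
  "posterior \<sigma>1 \<sigma>2 \<Pi>B \<Pi>M n yx w =
     density (\<Pi>B \<Otimes>\<^sub>M \<Pi>M)
       (\<lambda>\<theta>. ennreal (lik \<sigma>1 \<sigma>2 n yx w \<theta>) / evidence \<sigma>1 \<sigma>2 \<Pi>B \<Pi>M n yx w)"

definition posterior_beta ::
  "real \<Rightarrow> real \<Rightarrow> real measure \<Rightarrow> 'd::finite fn_pair measure \<Rightarrow> nat \<Rightarrow> (nat \<Rightarrow> real \<times> real) \<Rightarrow>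
   (nat \<Rightarrow> real ^ 'd) \<Rightarrow> real measure" where
  "posterior_beta \<sigma>1 \<sigma>2 \<Pi>B \<Pi>M n yx w = distr (posterior \<sigma>1 \<sigma>2 \<Pi>B \<Pi>M n yx w) borel fst"

definition posterior_m ::
  "real \<Rightarrow> real \<Rightarrow> real measure \<Rightarrow> 'd::finite fn_pair measure \<Rightarrow> nat \<Rightarrow> (nat \<Rightarrow> real \<times> real) \<Rightarrow>
   (nat \<Rightarrow> real ^ 'd) \<Rightarrow> 'd fn_pair measure" where
  "posterior_m \<sigma>1 \<sigma>2 \<Pi>B \<Pi>M n yx w = distr (posterior \<sigma>1 \<sigma>2 \<Pi>B \<Pi>M n yx w) \<Pi>M snd"

definition emp_norm :: "nat \<Rightarrow> (nat \<Rightarrow> 'a) \<Rightarrow> ('a \<Rightarrow> real) \<Rightarrow> real" where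
  "emp_norm n w f = sqrt ((\<Sum>i<n. (f (w i))\<^sup>2) / real n)"

definition B_nbhd ::
  "nat \<Rightarrow> (nat \<Rightarrow> real ^ 'd::finite) \<Rightarrow> 'd fn_pair set \<Rightarrow> 'd fn_pair \<Rightarrow> real \<Rightarrow> 'd fn_pair set" where
  "B_nbhd n w MM m0 \<delta> =
     {m \<in> MM. max (emp_norm n w (\<lambda>v. fst m v - fst m0 v)) (emp_norm n w (\<lambda>v. snd m v - snd m0 v)) < \<delta>}"

definition eps2 ::
  "'d::finite fn_pair \<Rightarrow> (nat \<Rightarrow> real \<times> real) \<Rightarrow> (nat \<Rightarrow> real ^ 'd) \<Rightarrow> nat \<Rightarrow> real" where
  "eps2 m0 yx w i = snd (yx i) - snd m0 (w i)"

definition U_res ::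
  "real \<Rightarrow> 'd::finite fn_pair \<Rightarrow> (nat \<Rightarrow> real \<times> real) \<Rightarrow> (nat \<Rightarrow> real ^ 'd) \<Rightarrow> nat \<Rightarrow> real" where
  "U_res \<beta>0 m0 yx w i = fst (yx i) - fst m0 (w i) - (snd (yx i) - snd m0 (w i)) * \<beta>0"

definition G1 ::
  "'d::finite fn_pair \<Rightarrow> nat \<Rightarrow> (nat \<Rightarrow> real \<times> real) \<Rightarrow> (nat \<Rightarrow> real ^ 'd) \<Rightarrow> 'd fn_pair \<Rightarrow> real" where
  "G1 m0 n yx w m = 1 / sqrt (real n) * (\<Sum>i<n. eps2 m0 yx w i * (fst m (w i) - fst m0 (w i)))"

definition G2 ::
  "real \<Rightarrow> 'd::finite fn_pair \<Rightarrow> nat \<Rightarrow> (nat \<Rightarrow> real \<times> real) \<Rightarrow> (nat \<Rightarrow> real ^ 'd) \<Rightarrow> 'd fn_pair \<Rightarrow> real" where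
  "G2 \<beta>0 m0 n yx w m =
     1 / sqrt (real n) *
     (\<Sum>i<n. (U_res \<beta>0 m0 yx w i - \<beta>0 * eps2 m0 yx w i) * (snd m (w i) - snd m0 (w i)))"

definition I_tilde ::
  "real \<Rightarrow> 'd::finite fn_pair \<Rightarrow> nat \<Rightarrow> (nat \<Rightarrow> real \<times> real) \<Rightarrow> (nat \<Rightarrow> real ^ 'd) \<Rightarrow> real" where
  "I_tilde \<sigma>1 m0 n yx w = 1 / real n * (\<Sum>i<n. ((snd (yx i) - snd m0 (w i)) / \<sigma>1)\<^sup>2)"

definition score_tilde ::
  "real \<Rightarrow> real \<Rightarrow> 'd::finite fn_pair \<Rightarrow> nat \<Rightarrow> (nat \<Rightarrow> real \<times> real) \<Rightarrow> (nat \<Rightarrow> real ^ 'd) \<Rightarrow> real" where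
  "score_tilde \<sigma>1 \<beta>0 m0 n yx w =
     1 / \<sigma>1\<^sup>2 * (\<Sum>i<n. (fst (yx i) - fst m0 (w i) - (snd (yx i) - snd m0 (w i)) * \<beta>0)
                        * (snd (yx i) - snd m0 (w i)))"

definition Delta_tilde ::
  "real \<Rightarrow> real \<Rightarrow> 'd::finite fn_pair \<Rightarrow> nat \<Rightarrow> (nat \<Rightarrow> real \<times> real) \<Rightarrow> (nat \<Rightarrow> real ^ 'd) \<Rightarrow> real" where
  "Delta_tilde \<sigma>1 \<beta>0 m0 n yx w =
     inverse (I_tilde \<sigma>1 m0 n yx w) * (1 / sqrt (real n)) * score_tilde \<sigma>1 \<beta>0 m0 n yx w"

text \<open>The normal law parametrised by mean and variance; the library's
  \<^const>\<open>normal_density\<close> takes the standard deviation.\<close>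

definition normal_law :: "real \<Rightarrow> real \<Rightarrow> real measure" where
  "normal_law \<mu> v = density lborel (\<lambda>x. ennreal (normal_density \<mu> (sqrt v) x))"

definition tv_dist :: "real measure \<Rightarrow> real measure \<Rightarrow> ennreal" where
  "tv_dist P Q = (SUP A \<in> sets borel. ennreal \<bar>measure P A - measure Q A\<bar>)"

text \<open>
  \<open>Z n\<close> tends to \<open>0\<close> in \<open>P n\<close>-probability. The quantities are \<^typ>\<open>ennreal\<close>-valued so that
  suprema over empty or unbounded families have their usual values \<open>0\<close> and \<open>\<infinity>\<close>. The outer measure
  agrees with \<open>P n\<close> on measurable events; it is used because \<^const>\<open>measure\<close> is \<open>0\<close> on
  non-measurable sets, which would make the condition hold vacuously there.
\<close>

definition tendsto_zero_in_prob :: "(nat \<Rightarrow> 'a measure) \<Rightarrow> (nat \<Rightarrow> 'a \<Rightarrow> ennreal) \<Rightarrow> bool" where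
  "tendsto_zero_in_prob P Z \<longleftrightarrow>
     (\<forall>e::real. e > 0 \<longrightarrow>
        (\<lambda>n. outer_measure_of (P n) {\<omega> \<in> space (P n). Z n \<omega> > ennreal e}) \<longlonglongrightarrow> 0)"

end

theory Submission
  imports Defs "HOL-Library.Discrete_Functions"
begin

text \<open>
  For fixed \<open>m\<close> the log-likelihood is exactly quadratic in \<open>\<beta>\<close>, with linear coefficient the score and
  curvature \<open>n\<close> times the information at \<open>m\<close>. On the sieve intersected with the shrinking
  neighbourhood of \<open>m0\<close>, the rescaled score differs from the one at \<open>m0\<close> by \<open>G1\<close>, \<open>G2\<close> and a term of
  order \<open>\<surd>n \<delta>\<^sub>n\<^sup>2\<close>, which all vanish, and the information differs by \<open>O(\<delta>\<^sub>n)\<close>. Since the prior density is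
  nearly constant near \<open>\<beta>0\<close>, the conditional posterior of \<open>\<beta>\<close> given \<open>m\<close> is then close to one and the same
  normal law, uniformly in such \<open>m\<close>, and so is the mixture over \<open>m\<close>. It remains to see that, given a typical
  realisation of the covariates, the information at \<open>m0\<close> stabilises at a positive number and the rescaled
  score is tight. Both follow from Chebyshev's inequality under the conditional law, whose variances are
  controlled by a law of large numbers for the conditional moments of \<open>X - m02(W)\<close>.
\<close>

subsection \<open>Gaussian tilting of a prior density\<close>

text \<open>Comparisons are kept free of division: for each \<open>m\<close> the unnormalised mass
  of a set \<open>B\<close> is bounded by its normal mass plus an epsilon, times the total
  unnormalised mass. Such bounds can be integrated over \<open>m\<close> without any control of the
  conditional normalising constants. The total mass is itself of order 1 / sqrt N, so an L1 error
  must be small against that order: near \<beta>0 the error has the width of the Gaussian times a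
  small factor, and away from \<beta>0 it is of order 1 / N. Given the covariates, the observations
  are independent but not identically distributed, and their laws \<open>K (w i)\<close> are tied to
  \<open>P0\<close> only for almost every covariate value. Randomness is therefore handled by second
  moments alone. Homoscedasticity given X and W reduces the variance of the score to second moments
  of the X error. The variance of the information involves conditional fourth moments, which are
  merely integrable in \<open>w\<close>; this suffices because they enter divided by the square of
  n. Outside finitely many bad events the argument is deterministic, and the sizes of these events
  add up by subadditivity of the outer measure.\<close>

lemma exp_quadratic_bound:
  fixes c L h s I :: real
  assumes c: "0 < c" and s: "\<bar>s\<bar> \<le> L" and I: "c \<le> I"
  shows "exp (h * s - h\<^sup>2 * I / 2) \<le> exp (L\<^sup>2 / c) * exp (- (c / 4) * h\<^sup>2)"
proof -
  \<comment> \<open>Young's inequality, balanced so that the linear term uses up exactly half of the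
    quadratic decay \<open>c / 2\<close>, at the price of the constant
    \<open>L\<^sup>2 / c\<close>.\<close>
  have "0 \<le> (c / 2 * \<bar>h\<bar> - L)\<^sup>2" by simp
  then have "\<bar>h\<bar> * L * c \<le> c\<^sup>2 / 4 * h\<^sup>2 + L\<^sup>2"
    by (simp add: power2_eq_square algebra_simps)
  then have "\<bar>h\<bar> * L \<le> (c\<^sup>2 / 4 * h\<^sup>2 + L\<^sup>2) / c"
    using c by (simp add: field_simps)
  also have "\<dots> = c / 4 * h\<^sup>2 + L\<^sup>2 / c"
    using c by (simp add: field_simps power2_eq_square)
  finally have 1: "\<bar>h\<bar> * L \<le> c / 4 * h\<^sup>2 + L\<^sup>2 / c" .
  have "h * s \<le> \<bar>h\<bar> * \<bar>s\<bar>" by (metis abs_ge_self abs_mult)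
  also have "\<dots> \<le> \<bar>h\<bar> * L" using s by (intro mult_left_mono) auto
  finally have 2: "h * s \<le> c / 4 * h\<^sup>2 + L\<^sup>2 / c" using 1 by linarith
  have 3: "h\<^sup>2 * c \<le> h\<^sup>2 * I" using I by (intro mult_left_mono) auto
  have "h * s - h\<^sup>2 * I / 2 \<le> L\<^sup>2 / c + - (c / 4) * h\<^sup>2" using 2 3 by (simp add: algebra_simps)
  then show ?thesis by (simp add: exp_add[symmetric])
qed

text \<open>By convexity a difference of exponentials is at most the difference of the exponents
  times the larger exponential. The exponents differ by at most
  \<open>\<eta> * (1 + h\<^sup>2)\<close>, and this polynomial factor is paid for with half of the
  decay left by \<open>exp_quadratic_bound\<close>; hence \<open>c / 8\<close> and
  \<open>1 + 8 / c\<close>.\<close>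

lemma exp_quadratic_diff_bound:
  fixes c L h s s0 I I0 \<eta> :: real
  assumes c: "0 < c" and s: "\<bar>s\<bar> \<le> L" "\<bar>s0\<bar> \<le> L" and I: "c \<le> I" "c \<le> I0"
    and d: "\<bar>s - s0\<bar> \<le> \<eta>" "\<bar>I - I0\<bar> \<le> \<eta>"
  shows "\<bar>exp (h * s - h\<^sup>2 * I / 2) - exp (h * s0 - h\<^sup>2 * I0 / 2)\<bar>
           \<le> \<eta> * (exp (L\<^sup>2 / c) * (1 + 8 / c)) * exp (- (c / 8) * h\<^sup>2)"
proof -
  define a where "a = h * s - h\<^sup>2 * I / 2"
  define b where "b = h * s0 - h\<^sup>2 * I0 / 2"
  define M where "M = exp (L\<^sup>2 / c) * exp (- (c / 4) * h\<^sup>2)"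
  have \<eta>: "0 \<le> \<eta>" using d by linarith
  have ab: "exp a \<le> M" "exp b \<le> M"
    unfolding a_def b_def M_def using assms by (intro exp_quadratic_bound; simp)+
  have *: "\<bar>exp x - exp y\<bar> \<le> \<bar>x - y\<bar> * M" if "exp x \<le> M" "exp y \<le> M" "x \<le> y" for x y
  proof -
    have "exp y * (1 + (x - y)) \<le> exp y * exp (x - y)"
      by (intro mult_left_mono exp_ge_add_one_self) auto
    also have "\<dots> = exp x" by (simp add: exp_diff)
    finally have "exp y - exp x \<le> exp y * (y - x)" by (simp add: algebra_simps)
    also have "\<dots> \<le> M * (y - x)" using that by (intro mult_right_mono) auto
    finally show ?thesis using that by (simp add: mult.commute)
  qed
  have "\<bar>exp a - exp b\<bar> \<le> \<bar>a - b\<bar> * M"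
    using *[of a b] *[of b a] ab by (cases "a \<le> b") (auto simp: abs_minus_commute)
  also have "\<bar>a - b\<bar> \<le> \<eta> * (1 + h\<^sup>2)"
  proof -
    have "a - b = h * (s - s0) - h\<^sup>2 / 2 * (I - I0)"
      unfolding a_def b_def by (simp add: field_simps)
    then have "\<bar>a - b\<bar> \<le> \<bar>h * (s - s0)\<bar> + \<bar>h\<^sup>2 / 2 * (I - I0)\<bar>" by linarith
    then have "\<bar>a - b\<bar> \<le> \<bar>h\<bar> * \<bar>s - s0\<bar> + h\<^sup>2 / 2 * \<bar>I - I0\<bar>"
      unfolding abs_mult by simp
    also have "\<dots> \<le> \<bar>h\<bar> * \<eta> + h\<^sup>2 / 2 * \<eta>"
      using d by (intro add_mono mult_left_mono) auto
    also have "\<bar>h\<bar> * \<eta> \<le> ((1 + h\<^sup>2) / 2) * \<eta>"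
    proof (intro mult_right_mono \<eta>)
      have "0 \<le> (\<bar>h\<bar> - 1)\<^sup>2" by simp
      then show "\<bar>h\<bar> \<le> (1 + h\<^sup>2) / 2" by (simp add: power2_eq_square algebra_simps)
    qed
    finally show ?thesis using \<eta> by (simp add: field_simps)
  qed
  then have "\<bar>a - b\<bar> * M \<le> \<eta> * (1 + h\<^sup>2) * M"
    by (intro mult_right_mono) (auto simp: M_def)
  also have "\<dots> = \<eta> * exp (L\<^sup>2 / c) * (exp (- (c / 8) * h\<^sup>2) * ((1 + h\<^sup>2) * exp (- (c / 8) * h\<^sup>2)))"
    unfolding M_def by (simp add: exp_add[symmetric] algebra_simps)
  also have "\<dots> \<le> \<eta> * exp (L\<^sup>2 / c) * (exp (- (c / 8) * h\<^sup>2) * (1 + 8 / c))"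
  proof (intro mult_left_mono)
    have "1 + c / 8 * h\<^sup>2 \<le> exp (c / 8 * h\<^sup>2)" by (rule exp_ge_add_one_self)
    moreover have "1 + h\<^sup>2 \<le> (1 + 8 / c) * (1 + c / 8 * h\<^sup>2)"
      using c by (simp add: field_simps)
    ultimately have "1 + h\<^sup>2 \<le> (1 + 8 / c) * exp (c / 8 * h\<^sup>2)"
      using c by (elim order_trans) (intro mult_left_mono, auto)
    then have "(1 + h\<^sup>2) * exp (- (c / 8) * h\<^sup>2) \<le> (1 + 8 / c) * exp (c / 8 * h\<^sup>2) * exp (- (c / 8) * h\<^sup>2)"
      by (intro mult_right_mono) auto
    then show "(1 + h\<^sup>2) * exp (- (c / 8) * h\<^sup>2) \<le> 1 + 8 / c"
      by (simp add: exp_add[symmetric] mult.assoc)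
  qed (use \<eta> in auto)
  finally show ?thesis by (simp add: a_def b_def algebra_simps)
qed

text \<open>The numerator gains at most \<open>d * c\<close> and the denominator loses at most
  \<open>d * c\<close>, so with \<open>b\<close> the \<open>q\<close>-mass of \<open>B\<close> the
  normalised mass is at most \<open>(b + d) / (1 - d)\<close>. The conclusion is multiplied out so
  that it can be integrated over \<open>m\<close>.\<close>

lemma normalised_density_close:
  fixes p q :: "real \<Rightarrow> real"
  assumes q: "integrable lborel q" "\<And>x. 0 \<le> q x" "(\<integral>x. q x \<partial>lborel) = 1"
    and p: "integrable lborel p" "\<And>x. 0 \<le> p x"
    and c: "0 < c" and d: "(\<integral>x. \<bar>p x - c * q x\<bar> \<partial>lborel) \<le> d * c"
    and \<epsilon>: "0 < \<epsilon>" "(2 + \<epsilon>) * d \<le> \<epsilon>" and B: "B \<in> sets borel"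
  shows "(\<integral>\<^sup>+x\<in>B. ennreal (p x) \<partial>lborel)
           \<le> ennreal (measure (density lborel (\<lambda>x. ennreal (q x))) B + \<epsilon>) * (\<integral>\<^sup>+x. ennreal (p x) \<partial>lborel)"
proof -
  have [measurable]: "p \<in> borel_measurable borel" "q \<in> borel_measurable borel" "B \<in> sets borel"
    using p q B by (auto dest: borel_measurable_integrable)
  have iB: "integrable lborel (\<lambda>x. indicator B x * p x)" "integrable lborel (\<lambda>x. indicator B x * q x)"
    using integrable_mult_indicator[of B lborel p] integrable_mult_indicator[of B lborel q] p q B by auto
  have id: "integrable lborel (\<lambda>x. \<bar>p x - c * q x\<bar>)"
    using p q by auto
  have PB: "(\<integral>\<^sup>+x\<in>B. ennreal (p x) \<partial>lborel) = ennreal (\<integral>x. indicator B x * p x \<partial>lborel)"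
    by (subst nn_integral_eq_integral[symmetric, OF iB(1)])
       (auto intro!: nn_integral_cong simp: p(2) indicator_def)
  have P: "(\<integral>\<^sup>+x. ennreal (p x) \<partial>lborel) = ennreal (\<integral>x. p x \<partial>lborel)"
    by (subst nn_integral_eq_integral[OF p(1)]) (auto simp: p(2))
  have QB: "measure (density lborel (\<lambda>x. ennreal (q x))) B = (\<integral>x. indicator B x * q x \<partial>lborel)"
  proof -
    have "emeasure (density lborel (\<lambda>x. ennreal (q x))) B = (\<integral>\<^sup>+x. ennreal (indicator B x * q x) \<partial>lborel)"
      by (subst emeasure_density) (auto intro!: nn_integral_cong simp: indicator_def)
    also have "\<dots> = ennreal (\<integral>x. indicator B x * q x \<partial>lborel)"
      by (rule nn_integral_eq_integral[OF iB(2)]) (auto simp: q(2))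
    finally show ?thesis
      by (simp add: measure_def q(2) enn2real_ennreal integral_nonneg_AE)
  qed
  define b where "b = (\<integral>x. indicator B x * q x \<partial>lborel)"
  have "b \<le> (\<integral>x. q x \<partial>lborel)"
    unfolding b_def using iB(2) q(1) by (rule integral_mono) (auto simp: q(2) indicator_def)
  then have b: "0 \<le> b" "b \<le> 1"
    unfolding b_def using q by (auto intro!: integral_nonneg_AE)
  have d0: "0 \<le> d"
  proof -
    have "0 \<le> (\<integral>x. \<bar>p x - c * q x\<bar> \<partial>lborel)" by simp
    then have "0 \<le> d * c" using d by linarith
    then show ?thesis using c by (simp add: zero_le_mult_iff)
  qed
  have 1: "(\<integral>x. indicator B x * p x \<partial>lborel) \<le> c * b + d * c"
  proof -
    have "(\<integral>x. indicator B x * p x \<partial>lborel) \<le> (\<integral>x. c * (indicator B x * q x) + \<bar>p x - c * q x\<bar> \<partial>lborel)"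
      using iB id by (intro integral_mono) (auto simp: indicator_def)
    also have "\<dots> = c * b + (\<integral>x. \<bar>p x - c * q x\<bar> \<partial>lborel)"
      using iB id unfolding b_def by (subst Bochner_Integration.integral_add) auto
    finally show ?thesis using d by linarith
  qed
  have 2: "c \<le> (\<integral>x. p x \<partial>lborel) + d * c"
  proof -
    have "c = (\<integral>x. c * q x \<partial>lborel)" using q by simp
    also have "\<dots> \<le> (\<integral>x. p x + \<bar>p x - c * q x\<bar> \<partial>lborel)"
      using q p id by (intro integral_mono) auto
    also have "\<dots> = (\<integral>x. p x \<partial>lborel) + (\<integral>x. \<bar>p x - c * q x\<bar> \<partial>lborel)"
      using p id by (subst Bochner_Integration.integral_add) auto
    finally show ?thesis using d by linarith
  qed
  \<comment> \<open>Since \<open>b \<le> 1\<close>, the inequality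
    \<open>b + d \<le> (b + \<epsilon>) * (1 - d)\<close> follows from
    \<open>(2 + \<epsilon>) * d \<le> \<epsilon>\<close>; this is the origin of that
    hypothesis.\<close>
  have "c * b + d * c \<le> (b + \<epsilon>) * (c - d * c)"
  proof -
    have "b * d \<le> d" using b d0 by (simp add: mult_left_le_one_le)
    then have "b + d \<le> (b + \<epsilon>) * (1 - d)" using \<epsilon> by (simp add: algebra_simps)
    then have "(b + d) * c \<le> (b + \<epsilon>) * (1 - d) * c" using c by (intro mult_right_mono) auto
    then show ?thesis by (simp add: algebra_simps)
  qed
  also have "\<dots> \<le> (b + \<epsilon>) * (\<integral>x. p x \<partial>lborel)"
    using 2 b \<epsilon> by (intro mult_left_mono) auto
  finally have "(\<integral>x. indicator B x * p x \<partial>lborel) \<le> (b + \<epsilon>) * (\<integral>x. p x \<partial>lborel)" using 1 by linarith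
  then show ?thesis
    unfolding PB P QB b_def[symmetric]
    by (subst ennreal_mult[symmetric]) (use b \<epsilon> p in \<open>auto intro!: ennreal_leI\<close>)
qed

section \<open>Gaussian integrals and completion of the square\<close>

lemma integral_gaussian:
  fixes k a :: real
  assumes k: "0 < k"
  shows "integrable lborel (\<lambda>x. exp (- k * (x - a)\<^sup>2))"
    and "(\<integral>x. exp (- k * (x - a)\<^sup>2) \<partial>lborel) = sqrt (pi / k)"
proof -
  define \<sigma> where "\<sigma> = sqrt (1 / (2 * k))"
  have \<sigma>: "\<sigma> > 0" "\<sigma>\<^sup>2 = 1 / (2 * k)" using k unfolding \<sigma>_def by auto
  have *: "exp (- k * (x - a)\<^sup>2) = sqrt (pi / k) * normal_density a \<sigma> x" for x
    unfolding normal_density_def \<sigma>(2) using k by (simp add: real_sqrt_divide field_simps)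
  show "integrable lborel (\<lambda>x. exp (- k * (x - a)\<^sup>2))"
    unfolding * using integrable_normal_density[OF \<sigma>(1)] by auto
  show "(\<integral>x. exp (- k * (x - a)\<^sup>2) \<partial>lborel) = sqrt (pi / k)"
    unfolding * using integral_normal_density[OF \<sigma>(1)] by simp
qed

text \<open>Completing the square in \<open>h\<close>: the exponent is
  \<open>s\<^sup>2 / (2 * I)\<close> minus \<open>I * (h - s / I)\<^sup>2 / 2\<close>. With the
  rescaled score for \<open>s\<close> and the information for \<open>I\<close>, centre and variance
  are those of the limiting normal law.\<close>

lemma exp_quadratic_eq_normal_density:
  fixes s I N \<beta>0 \<beta> :: real
  assumes I: "0 < I" and N: "0 < N"
  defines "h \<equiv> sqrt N * (\<beta> - \<beta>0)"
  shows "exp (h * s - h\<^sup>2 * I / 2) =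
     exp (s\<^sup>2 / (2 * I)) * sqrt (2 * pi / (N * I)) * normal_density (\<beta>0 + s / (I * sqrt N)) (sqrt (1 / (N * I))) \<beta>"
proof -
  have sd: "(sqrt (1 / (N * I)))\<^sup>2 = 1 / (N * I)" using I N by simp
  have 1: "sqrt (2 * pi / (N * I)) * (1 / sqrt (2 * pi * (1 / (N * I)))) = 1"
    using I N by simp
  have "\<beta> - (\<beta>0 + s / (I * sqrt N)) = (h - s / I) / sqrt N"
    using I N unfolding h_def by (simp add: field_simps)
  then have "- (\<beta> - (\<beta>0 + s / (I * sqrt N)))\<^sup>2 / (2 * (1 / (N * I))) = - I * (h - s / I)\<^sup>2 / 2"
    using N by (simp add: power_divide)
  also have "\<dots> = h * s - h\<^sup>2 * I / 2 - s\<^sup>2 / (2 * I)"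
    using I by (simp add: field_simps power2_eq_square)
  finally have 2: "exp (- (\<beta> - (\<beta>0 + s / (I * sqrt N)))\<^sup>2 / (2 * (1 / (N * I)))) =
      exp (h * s - h\<^sup>2 * I / 2) / exp (s\<^sup>2 / (2 * I))"
    by (simp add: exp_diff)
  have "exp (s\<^sup>2 / (2 * I)) * sqrt (2 * pi / (N * I)) * normal_density (\<beta>0 + s / (I * sqrt N)) (sqrt (1 / (N * I))) \<beta>
    = exp (s\<^sup>2 / (2 * I)) * (sqrt (2 * pi / (N * I)) * (1 / sqrt (2 * pi * (1 / (N * I)))))
      * (exp (h * s - h\<^sup>2 * I / 2) / exp (s\<^sup>2 / (2 * I)))"
    unfolding normal_density_def sd 2 by simp
  also have "\<dots> = exp (h * s - h\<^sup>2 * I / 2)" unfolding 1 by simp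
  finally show ?thesis ..
qed

text \<open>Away from \<open>\<beta>0\<close> nothing is known about the prior density beyond its integrability, so there the
  exponential factor is bounded by a constant of order \<open>1 / N\<close> and the prior density is kept.\<close>

lemma tilted_prior_pointwise_bound:
  fixes c L s s0 I I0 \<eta> \<tau> \<rho> N x p p0 :: real
  assumes c: "0 < c" and s: "\<bar>s\<bar> \<le> L" "\<bar>s0\<bar> \<le> L" and I: "c \<le> I" "c \<le> I0"
    and d: "\<bar>s - s0\<bar> \<le> \<eta>" "\<bar>I - I0\<bar> \<le> \<eta>"
    and N: "0 < N" and \<rho>: "0 < \<rho>" and p: "0 \<le> p" "0 \<le> p0" and \<tau>: "0 \<le> \<tau>"
    and near: "\<bar>x\<bar> < \<rho> \<Longrightarrow> \<bar>p - p0\<bar> \<le> \<tau> * p0"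
  defines "h \<equiv> sqrt N * x" and "C \<equiv> exp (L\<^sup>2 / c) * (1 + 8 / c)" and "k \<equiv> c / 8"
  shows "\<bar>p * exp (h * s - h\<^sup>2 * I / 2) - p0 * exp (h * s0 - h\<^sup>2 * I0 / 2)\<bar>
     \<le> p0 * C * (\<tau> + \<eta> + 2 / (k * N * \<rho>\<^sup>2)) * exp (- (k / 2 * N) * x\<^sup>2) + C / (k * N * \<rho>\<^sup>2) * p"
proof -
  define e where "e = exp (h * s - h\<^sup>2 * I / 2)"
  define e0 where "e0 = exp (h * s0 - h\<^sup>2 * I0 / 2)"
  define G where "G = exp (- k * h\<^sup>2)"
  define G2 where "G2 = exp (- (k / 2 * N) * x\<^sup>2)"
  have k: "0 < k" and C: "0 < C" and \<eta>: "0 \<le> \<eta>" using c d unfolding k_def C_def by (auto intro!: mult_pos_pos add_pos_pos)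
  have h2: "h\<^sup>2 = N * x\<^sup>2" using N unfolding h_def by (simp add: power_mult_distrib)
  have bnd: "exp (h * s' - h\<^sup>2 * I' / 2) \<le> C * G" if "\<bar>s'\<bar> \<le> L" "c \<le> I'" for s' I'
  proof -
    have "exp (h * s' - h\<^sup>2 * I' / 2) \<le> exp (L\<^sup>2 / c) * exp (- (c / 4) * h\<^sup>2)"
      using exp_quadratic_bound[OF c that] .
    also have "\<dots> \<le> C * G"
      unfolding C_def G_def k_def using c by (intro mult_mono) (auto simp: mult_right_mono)
    finally show ?thesis .
  qed
  have e: "0 \<le> e" "e \<le> C * G" and e0: "0 \<le> e0" "e0 \<le> C * G"
    unfolding e_def e0_def using bnd s I by auto
  have de: "\<bar>e - e0\<bar> \<le> \<eta> * C * G"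
    using exp_quadratic_diff_bound[OF c s I d, of h] unfolding e_def e0_def C_def G_def k_def by simp
  \<comment> \<open>The decay is split evenly. For the \<open>p0\<close> part away from \<beta>0 one
    copy of \<open>G2\<close> is traded for a small constant, and the other keeps the bound
    integrable.\<close>
  have G2: "0 < G2" "G = G2 * G2" "G2 \<le> 1"
    unfolding G2_def G_def h2 using k N by (auto simp: exp_add[symmetric] algebra_simps)
  have GG2: "G \<le> G2" using G2 by (simp add: mult_left_le)
  define R where "R = k * N * \<rho>\<^sup>2"
  have R: "0 < R" unfolding R_def using k N \<rho> by auto
  have "\<bar>p * e - p0 * e0\<bar> \<le> p0 * C * (\<tau> + \<eta> + 2 / R) * G2 + C / R * p"
  proof (cases "\<bar>x\<bar> < \<rho>")
    case True
    have "p * e - p0 * e0 = (p - p0) * e + p0 * (e - e0)" by (simp add: algebra_simps)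
    then have "\<bar>p * e - p0 * e0\<bar> \<le> \<bar>(p - p0) * e\<bar> + \<bar>p0 * (e - e0)\<bar>" by linarith
    also have "\<dots> = \<bar>p - p0\<bar> * e + p0 * \<bar>e - e0\<bar>" using e p by (simp add: abs_mult)
    also have "\<dots> \<le> (\<tau> * p0) * (C * G) + p0 * (\<eta> * C * G)"
      using near[OF True] e de p \<tau> by (intro add_mono mult_mono) auto
    also have "\<dots> = p0 * C * (\<tau> + \<eta>) * G" by (simp add: algebra_simps)
    also have "\<dots> \<le> p0 * C * (\<tau> + \<eta> + 2 / R) * G2"
      using p C \<tau> \<eta> GG2 R G2 by (intro mult_mono mult_nonneg_nonneg) auto
    also have "\<dots> \<le> p0 * C * (\<tau> + \<eta> + 2 / R) * G2 + C / R * p" using C R p by simp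
    finally show ?thesis .
  next
    case False
    have "\<rho>\<^sup>2 \<le> x\<^sup>2" using False \<rho> by (simp add: abs_le_square_iff[symmetric])
    then have Rx: "R \<le> k * N * x\<^sup>2" unfolding R_def using k N by (intro mult_left_mono) auto
    have inv: "exp (- t) \<le> 1 / u" if "0 < u" "u \<le> t" for t u :: real
    proof -
      have "u \<le> exp t" using exp_ge_add_one_self[of t] that by linarith
      then show ?thesis using that by (simp add: exp_minus field_simps)
    qed
    \<comment> \<open>For the \<open>p\<close> part the whole Gaussian factor is spent, because
      \<open>p\<close> stands for the prior density and supplies integrability itself.\<close>
    have "G \<le> 1 / R" unfolding G_def h2 using inv[OF R Rx] by (simp add: mult.assoc)
    then have 1: "C * G \<le> C / R" using mult_left_mono[of G "1 / R" C] C by simp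
    have "G2 \<le> 1 / (R / 2)" unfolding G2_def using inv[of "R/2" "k * N * x\<^sup>2 / 2"] R Rx by simp
    then have "G \<le> 2 / R * G2" using mult_right_mono[of G2 "2 / R" G2] G2 by simp
    then have 2: "C * G \<le> C * (2 / R) * G2" using mult_left_mono[of G "2 / R * G2" C] C by simp
    have "\<bar>p * e - p0 * e0\<bar> \<le> p * e + p0 * e0" using p e e0 by (simp add: abs_le_iff add_increasing)
    also have "\<dots> \<le> p * (C / R) + p0 * (C * (2 / R) * G2)"
      using p e e0 1 2 by (intro add_mono mult_left_mono) auto
    also have "\<dots> \<le> p * (C / R) + p0 * (C * (\<tau> + \<eta> + 2 / R) * G2)"
      using p C G2 \<tau> \<eta> by (intro add_mono mult_left_mono mult_right_mono) auto
    finally show ?thesis by (simp add: algebra_simps)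
  qed
  then show ?thesis unfolding e_def e0_def G2_def R_def .
qed

text \<open>Integrating the pointwise bound gives \<open>W * (\<tau> + \<eta>) / sqrt N\<close> plus
  terms of order 1 / N or smaller, against a target mass \<open>J\<close> of order 1 / sqrt N. The
  first part is made small by the choice of \<eta>, the rest by large \<open>N\<close>. Since \<eta>
  is fixed before \<open>N\<close>, and \<open>N\<close> before \<open>s\<close>, \<open>s0\<close>,
  \<open>I\<close>, \<open>I0\<close> and \<open>B\<close>, the bound may be applied to values that
  depend on the data and on \<open>m\<close>.\<close>

lemma tilted_prior_close_to_normal:
  fixes \<pi> :: "real \<Rightarrow> real" and \<beta>0 L c1 c2 \<epsilon> :: real
  assumes \<pi>_meas[measurable]: "\<pi> \<in> borel_measurable borel" and \<pi>_nonneg: "\<And>\<beta>. 0 \<le> \<pi> \<beta>"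
    and \<pi>_int: "(\<integral>\<^sup>+\<beta>. ennreal (\<pi> \<beta>) \<partial>lborel) = 1"
    and cont: "isCont \<pi> \<beta>0" and pos: "0 < \<pi> \<beta>0"
    and c: "0 < c1" and L: "0 \<le> L" and \<epsilon>: "0 < \<epsilon>"
  shows "\<exists>\<eta>>0. eventually (\<lambda>N. \<forall>s s0 I I0. \<forall>B\<in>sets borel.
      \<bar>s0\<bar> \<le> L \<longrightarrow> c1 \<le> I0 \<longrightarrow> I0 \<le> c2 \<longrightarrow> \<bar>s - s0\<bar> \<le> \<eta> \<longrightarrow> \<bar>I - I0\<bar> \<le> \<eta> \<longrightarrow>
      (\<integral>\<^sup>+\<beta>\<in>B. ennreal (\<pi> \<beta> * exp (sqrt N * (\<beta> - \<beta>0) * s - (sqrt N * (\<beta> - \<beta>0))\<^sup>2 * I / 2)) \<partial>lborel)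
      \<le> ennreal (measure (normal_law (\<beta>0 + s0 / (I0 * sqrt N)) (1 / (N * I0))) B + \<epsilon>) *
        (\<integral>\<^sup>+\<beta>. ennreal (\<pi> \<beta> * exp (sqrt N * (\<beta> - \<beta>0) * s - (sqrt N * (\<beta> - \<beta>0))\<^sup>2 * I / 2)) \<partial>lborel)) at_top"
proof (cases "c1 \<le> c2")
  case False
  then show ?thesis by (intro exI[of _ 1]) (auto intro!: always_eventually)
next
  case True
  then have c2: "0 < c2" using c by simp
  \<comment> \<open>\<open>L + 1\<close> and \<open>c1 / 2\<close> are bounds that \<open>s\<close>
    and \<open>I\<close> still satisfy when they are within \<eta> of \<open>s0\<close> and
    \<open>I0\<close>.\<close>
  define C where "C = exp ((L + 1)\<^sup>2 / (c1 / 2)) * (1 + 8 / (c1 / 2))"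
  define k where "k = c1 / 2 / 8"
  \<comment> \<open>The largest relative L1 error that \<open>normalised_density_close\<close>
    admits for \<epsilon>.\<close>
  define d where "d = \<epsilon> / (2 + \<epsilon>)"
  define p0 where "p0 = \<pi> \<beta>0"
  have C: "0 < C" unfolding C_def using c by (intro mult_pos_pos add_pos_pos) auto
  have k: "0 < k" and d: "0 < d" and p0: "0 < p0" unfolding k_def d_def p0_def using c \<epsilon> pos by auto
  \<comment> \<open>\<open>T / sqrt N\<close> is a lower bound for \<open>d * J\<close>, the
    admissible error; the bound \<open>I0 \<le> c2\<close> enters here.\<close>
  define T where "T = d * p0 * sqrt (2 * pi / c2)"
  have T: "0 < T" unfolding T_def using d p0 c2 by (intro mult_pos_pos) auto
  \<comment> \<open>\<open>W / sqrt N\<close> is the Lebesgue integral of the Gaussian envelope with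
    prefactor \<open>p0 * C\<close>.\<close>
  define W where "W = p0 * C * sqrt (2 * pi / k)"
  have W: "0 < W" unfolding W_def using C p0 k by (intro mult_pos_pos) auto
  \<comment> \<open>With \<open>\<eta> \<le> \<tau>\<close> this makes
    \<open>W * (\<tau> + \<eta>)\<close> at most \<open>T / 3\<close>, and \<open>T / 2\<close> is
    left for the terms that vanish with \<open>N\<close>.\<close>
  define \<tau> where "\<tau> = T / (6 * W)"
  have \<tau>: "0 < \<tau>" unfolding \<tau>_def using T W by simp
  define \<eta> where "\<eta> = min \<tau> (min 1 (c1 / 2))"
  have \<eta>: "0 < \<eta>" "\<eta> \<le> \<tau>" "\<eta> \<le> 1" "\<eta> \<le> c1 / 2" unfolding \<eta>_def using \<tau> c by auto
  have "0 < \<tau> * p0" using \<tau> p0 by simp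
  then obtain \<rho> where \<rho>: "0 < \<rho>" and near: "\<And>\<beta>. \<bar>\<beta> - \<beta>0\<bar> < \<rho> \<Longrightarrow> \<bar>\<pi> \<beta> - p0\<bar> \<le> \<tau> * p0"
    using cont unfolding continuous_at_eps_delta p0_def by (metis dist_real_def less_imp_le)
  have "((\<lambda>N. W * (2 / (k * \<rho>\<^sup>2)) * inverse N + C / (k * \<rho>\<^sup>2) * inverse (sqrt N)) \<longlongrightarrow> W * (2 / (k * \<rho>\<^sup>2)) * 0 + C / (k * \<rho>\<^sup>2) * 0) at_top"
    by (intro tendsto_intros tendsto_inverse_0_at_top filterlim_ident sqrt_at_top)
  then have "eventually (\<lambda>N. W * (2 / (k * \<rho>\<^sup>2)) * inverse N + C / (k * \<rho>\<^sup>2) * inverse (sqrt N) < T / 2) at_top"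
    using T by (intro order_tendstoD) auto
  then have "eventually (\<lambda>N. \<forall>s s0 I I0. \<forall>B\<in>sets borel.
      \<bar>s0\<bar> \<le> L \<longrightarrow> c1 \<le> I0 \<longrightarrow> I0 \<le> c2 \<longrightarrow> \<bar>s - s0\<bar> \<le> \<eta> \<longrightarrow> \<bar>I - I0\<bar> \<le> \<eta> \<longrightarrow>
      (\<integral>\<^sup>+\<beta>\<in>B. ennreal (\<pi> \<beta> * exp (sqrt N * (\<beta> - \<beta>0) * s - (sqrt N * (\<beta> - \<beta>0))\<^sup>2 * I / 2)) \<partial>lborel)
      \<le> ennreal (measure (normal_law (\<beta>0 + s0 / (I0 * sqrt N)) (1 / (N * I0))) B + \<epsilon>) *
        (\<integral>\<^sup>+\<beta>. ennreal (\<pi> \<beta> * exp (sqrt N * (\<beta> - \<beta>0) * s - (sqrt N * (\<beta> - \<beta>0))\<^sup>2 * I / 2)) \<partial>lborel)) at_top"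
    using eventually_gt_at_top[of 0]
  proof eventually_elim
    case (elim N)
    then have N: "0 < N" by simp
    show ?case
    proof (intro allI ballI impI)
      fix s s0 I I0 :: real and B :: "real set"
      assume B: "B \<in> sets borel" and s0: "\<bar>s0\<bar> \<le> L" and I0: "c1 \<le> I0" "I0 \<le> c2"
        and ds: "\<bar>s - s0\<bar> \<le> \<eta>" and dI: "\<bar>I - I0\<bar> \<le> \<eta>"
      have I0': "0 < I0" using c I0 by simp
      define h where "h \<beta> = sqrt N * (\<beta> - \<beta>0)" for \<beta>
      define p where "p \<beta> = \<pi> \<beta> * exp (h \<beta> * s - (h \<beta>)\<^sup>2 * I / 2)" for \<beta>
      define q where "q = normal_density (\<beta>0 + s0 / (I0 * sqrt N)) (sqrt (1 / (N * I0)))"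
      define J where "J = p0 * (exp (s0\<^sup>2 / (2 * I0)) * sqrt (2 * pi / (N * I0)))"
      have J: "0 < J" unfolding J_def using p0 N I0' by simp
      have sd: "0 < sqrt (1 / (N * I0))" using N I0' by simp
      have q: "integrable lborel q" "\<And>x. 0 \<le> q x" "(\<integral>x. q x \<partial>lborel) = 1"
        unfolding q_def using integrable_normal_density[OF sd] integral_normal_density[OF sd] by auto
      have Jq: "J * q \<beta> = p0 * exp (h \<beta> * s0 - (h \<beta>)\<^sup>2 * I0 / 2)" for \<beta>
        unfolding J_def q_def h_def exp_quadratic_eq_normal_density[OF I0' N] by simp
      have \<pi>_integrable: "integrable lborel \<pi>" and \<pi>1: "(\<integral>\<beta>. \<pi> \<beta> \<partial>lborel) = 1"
        using \<pi>_int \<pi>_nonneg by (auto intro!: integrableI_nonneg simp: integral_eq_nn_integral)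
      define a where "a = p0 * C * (\<tau> + \<eta> + 2 / (k * N * \<rho>\<^sup>2))"
      define b where "b = C / (k * N * \<rho>\<^sup>2)"
      have pw: "\<bar>p \<beta> - J * q \<beta>\<bar> \<le> a * exp (- (k / 2 * N) * (\<beta> - \<beta>0)\<^sup>2) + b * \<pi> \<beta>" for \<beta>
        unfolding Jq p_def h_def a_def b_def C_def k_def
        by (rule tilted_prior_pointwise_bound)
           (use c s0 ds dI \<eta> I0 N \<rho> \<pi>_nonneg p0 \<tau> near[of \<beta>] in auto)
      have kN: "0 < k / 2 * N" using k N by simp
      have ib: "integrable lborel (\<lambda>\<beta>. a * exp (- (k / 2 * N) * (\<beta> - \<beta>0)\<^sup>2) + b * \<pi> \<beta>)"
        using integral_gaussian(1)[OF kN] \<pi>_integrable by auto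
      have [measurable]: "p \<in> borel_measurable borel" unfolding p_def h_def by measurable
      have [measurable]: "q \<in> borel_measurable borel" using q by auto
      have idiff: "integrable lborel (\<lambda>\<beta>. p \<beta> - J * q \<beta>)"
        using pw by (intro Bochner_Integration.integrable_bound[OF ib])
          (auto intro!: AE_I2 order_trans[OF _ abs_ge_self])
      then have ip: "integrable lborel p"
        using Bochner_Integration.integrable_add[OF idiff integrable_mult_right[OF q(1), of J]] by simp
      have "(\<integral>\<beta>. \<bar>p \<beta> - J * q \<beta>\<bar> \<partial>lborel) \<le> (\<integral>\<beta>. a * exp (- (k / 2 * N) * (\<beta> - \<beta>0)\<^sup>2) + b * \<pi> \<beta> \<partial>lborel)"
        using idiff ib pw by (intro integral_mono) auto
      also have "\<dots> = a * sqrt (pi / (k / 2 * N)) + b"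
        using integral_gaussian[OF kN, of \<beta>0] \<pi>_integrable \<pi>1 by (subst Bochner_Integration.integral_add) auto
      also have "\<dots> = (W * (\<tau> + \<eta>) + (W * (2 / (k * \<rho>\<^sup>2)) * inverse N + C / (k * \<rho>\<^sup>2) * inverse (sqrt N))) / sqrt N"
      proof -
        have "sqrt (pi / (k / 2 * N)) = sqrt (2 * pi / k) / sqrt N"
          by (simp add: real_sqrt_divide[symmetric] field_simps)
        then have "a * sqrt (pi / (k / 2 * N)) + b =
            W * (\<tau> + \<eta> + 2 / (k * N * \<rho>\<^sup>2)) / sqrt N + C / (k * N * \<rho>\<^sup>2)"
          unfolding a_def b_def W_def by simp
        \<comment> \<open>In terms of the inverse square root of \<open>N\<close> the identity
          becomes polynomial.\<close>
        define r where "r = inverse (sqrt N)"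
        have iN: "inverse N = r * r"
          unfolding r_def using N by (simp flip: inverse_mult_distrib)
        have "a * sqrt (pi / (k / 2 * N)) + b =
            W * (\<tau> + \<eta> + 2 / (k * N * \<rho>\<^sup>2)) / sqrt N + C / (k * N * \<rho>\<^sup>2)" by fact
        then show ?thesis
          unfolding divide_inverse inverse_mult_distrib iN r_def[symmetric] by algebra
      qed
      also have "\<dots> \<le> (T / 3 + T / 2) / sqrt N"
      proof (intro divide_right_mono add_mono)
        have "W * (\<tau> + \<eta>) \<le> W * (2 * \<tau>)" using \<eta> W by (intro mult_left_mono) auto
        also have "\<dots> = T / 3" unfolding \<tau>_def using W by simp
        finally show "W * (\<tau> + \<eta>) \<le> T / 3" .
      qed (use elim N in auto)
      also have "\<dots> \<le> T / sqrt N" using T N by (intro divide_right_mono) auto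
      also have "\<dots> \<le> d * J"
      proof -
        have "sqrt (2 * pi / c2) / sqrt N = sqrt (2 * pi / (N * c2))"
          by (simp add: real_sqrt_divide[symmetric] field_simps)
        also have "\<dots> \<le> sqrt (2 * pi / (N * I0))"
          using I0 I0' N by (intro real_sqrt_le_mono divide_left_mono mult_left_mono) auto
        also have "\<dots> \<le> exp (s0\<^sup>2 / (2 * I0)) * sqrt (2 * pi / (N * I0))"
          using I0' N mult_right_mono[of 1 "exp (s0\<^sup>2 / (2 * I0))" "sqrt (2 * pi / (N * I0))"]
          by simp
        finally have "p0 * (sqrt (2 * pi / c2) / sqrt N) \<le> J" unfolding J_def using p0 by (intro mult_left_mono) auto
        then have "d * (p0 * (sqrt (2 * pi / c2) / sqrt N)) \<le> d * J" using d by (intro mult_left_mono) auto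
        then show ?thesis unfolding T_def by simp
      qed
      finally have le: "(\<integral>\<beta>. \<bar>p \<beta> - J * q \<beta>\<bar> \<partial>lborel) \<le> d * J" .
      have "(\<integral>\<^sup>+\<beta>\<in>B. ennreal (p \<beta>) \<partial>lborel)
           \<le> ennreal (measure (density lborel (\<lambda>x. ennreal (q x))) B + \<epsilon>) * (\<integral>\<^sup>+\<beta>. ennreal (p \<beta>) \<partial>lborel)"
        by (rule normalised_density_close[OF q ip _ J le \<epsilon> _ B])
           (use \<epsilon> \<pi>_nonneg in \<open>auto simp: p_def d_def\<close>)
      then show "(\<integral>\<^sup>+\<beta>\<in>B. ennreal (\<pi> \<beta> * exp (sqrt N * (\<beta> - \<beta>0) * s - (sqrt N * (\<beta> - \<beta>0))\<^sup>2 * I / 2)) \<partial>lborel)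
      \<le> ennreal (measure (normal_law (\<beta>0 + s0 / (I0 * sqrt N)) (1 / (N * I0))) B + \<epsilon>) *
        (\<integral>\<^sup>+\<beta>. ennreal (\<pi> \<beta> * exp (sqrt N * (\<beta> - \<beta>0) * s - (sqrt N * (\<beta> - \<beta>0))\<^sup>2 * I / 2)) \<partial>lborel)"
        unfolding p_def q_def h_def normal_law_def .
    qed
  qed
  with \<eta>(1) show ?thesis by blast
qed

subsection \<open>The normal likelihood and its posterior\<close>

text \<open>\<open>matrix_inv\<close> is a Hilbert choice; uniqueness of the two-sided inverse pins
  it down.\<close>

lemma matrix_inv_eqI:
  fixes A B :: "'a::semiring_1 ^ 'n ^ 'n"
  assumes "A ** B = mat 1" "B ** A = mat 1"
  shows "matrix_inv A = B"
proof -
  have "A ** matrix_inv A = mat 1 \<and> matrix_inv A ** A = mat 1"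
    unfolding matrix_inv_def by (rule someI[of _ B]) (use assms in auto)
  then show ?thesis by (metis assms(2) matrix_mul_assoc matrix_mul_lid matrix_mul_rid)
qed

text \<open>\<open>V_mat \<sigma>1 \<sigma>2 \<beta>\<close> is the covariance of
  \<open>(\<beta> * E + U, E)\<close> for independent \<open>U\<close>, \<open>E\<close> with
  variances \<open>\<sigma>1\<^sup>2\<close>, \<open>\<sigma>2\<^sup>2\<close>, so the density is
  that of the second coordinate times that of the first given the second. The determinant does not
  involve \<beta>, and \<beta> enters only through one squared regression residual.\<close>

lemma mvnormal_density_V_mat:
  fixes \<sigma>1 \<sigma>2 \<beta> a b x y :: real
  assumes \<sigma>: "0 < \<sigma>1" "0 < \<sigma>2"
  shows "mvnormal_density (vector [a, b]) (V_mat \<sigma>1 \<sigma>2 \<beta>) (vector [y, x]) =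
    exp (- (y - a - \<beta> * (x - b))\<^sup>2 / (2 * \<sigma>1\<^sup>2) - (x - b)\<^sup>2 / (2 * \<sigma>2\<^sup>2)) / (2 * pi * \<sigma>1 * \<sigma>2)"
proof -
  define V where "V = V_mat \<sigma>1 \<sigma>2 \<beta>"
  define R :: "real^2^2" where "R = vector [vector [1 / \<sigma>1\<^sup>2, - \<beta> / \<sigma>1\<^sup>2], vector [- \<beta> / \<sigma>1\<^sup>2, 1 / \<sigma>2\<^sup>2 + \<beta>\<^sup>2 / \<sigma>1\<^sup>2]]"
  have R: "matrix_inv V = R"
    using \<sigma> by (intro matrix_inv_eqI)
      (simp_all add: V_def V_mat_def R_def vec_eq_iff forall_2 matrix_matrix_mult_def sum_2 mat_def field_simps power2_eq_square)
  have det: "det V = (\<sigma>1 * \<sigma>2)\<^sup>2"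
    by (simp add: V_def V_mat_def det_2 power2_eq_square algebra_simps)
  have "sqrt ((2 * pi) ^ CARD(2) * det V) = sqrt ((2 * pi * \<sigma>1 * \<sigma>2)\<^sup>2)"
    unfolding det by (simp add: power_mult_distrib)
  also have "\<dots> = 2 * pi * \<sigma>1 * \<sigma>2" using \<sigma> by (simp add: real_sqrt_abs)
  finally have den: "sqrt ((2 * pi) ^ CARD(2) * det V) = 2 * pi * \<sigma>1 * \<sigma>2" .
  have quad: "(vector [y, x] - vector [a, b]) \<bullet> (R *v (vector [y, x] - vector [a, b]))
      = (y - a - \<beta> * (x - b))\<^sup>2 / \<sigma>1\<^sup>2 + (x - b)\<^sup>2 / \<sigma>2\<^sup>2" (is "?l = ?r")
  proof -
    define r e where "r = y - a" and "e = x - b"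
    have "?l = r * (r / \<sigma>1\<^sup>2 + - \<beta> / \<sigma>1\<^sup>2 * e) + e * (- \<beta> / \<sigma>1\<^sup>2 * r + (1 / \<sigma>2\<^sup>2 + \<beta>\<^sup>2 / \<sigma>1\<^sup>2) * e)"
      by (simp add: R_def inner_vec_def matrix_vector_mult_def sum_2 r_def e_def)
    also have "\<dots> = (r - \<beta> * e)\<^sup>2 / \<sigma>1\<^sup>2 + e\<^sup>2 / \<sigma>2\<^sup>2"
      by (simp add: power2_eq_square ring_distribs diff_divide_distrib add_divide_distrib mult_ac)
    finally show ?thesis by (simp add: r_def e_def)
  qed
  show ?thesis
    unfolding mvnormal_density_def V_def[symmetric] R den quad
    by (simp add: add_divide_distrib)
qed

lemma lik_eq_prod:
  assumes "0 < \<sigma>1" "0 < \<sigma>2"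
  shows "lik \<sigma>1 \<sigma>2 n yx w \<theta> =
    (\<Prod>i<n. exp (- (fst (yx i) - fst (snd \<theta>) (w i) - fst \<theta> * (snd (yx i) - snd (snd \<theta>) (w i)))\<^sup>2 / (2 * \<sigma>1\<^sup>2)
               - (snd (yx i) - snd (snd \<theta>) (w i))\<^sup>2 / (2 * \<sigma>2\<^sup>2)) / (2 * pi * \<sigma>1 * \<sigma>2))"
  unfolding lik_def mvnormal_density_V_mat[OF assms] by (simp add: case_prod_beta)

lemma lik_pos:
  assumes "0 < \<sigma>1" "0 < \<sigma>2"
  shows "0 < lik \<sigma>1 \<sigma>2 n yx w \<theta>"
  unfolding lik_eq_prod[OF assms] using assms by (intro prod_pos) auto

lemma lik_le:
  assumes "0 < \<sigma>1" "0 < \<sigma>2"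
  shows "lik \<sigma>1 \<sigma>2 n yx w \<theta> \<le> (1 / (2 * pi * \<sigma>1 * \<sigma>2)) ^ n"
proof -
  have nonpos: "- a\<^sup>2 / (2 * \<sigma>1\<^sup>2) - b\<^sup>2 / (2 * \<sigma>2\<^sup>2) \<le> 0" for a b :: real
  proof -
    have "0 \<le> a\<^sup>2 / (2 * \<sigma>1\<^sup>2)" "0 \<le> b\<^sup>2 / (2 * \<sigma>2\<^sup>2)" by simp_all
    then show ?thesis by (simp only: minus_divide_left[symmetric])
  qed
  have "lik \<sigma>1 \<sigma>2 n yx w \<theta> \<le> (\<Prod>i<n. 1 / (2 * pi * \<sigma>1 * \<sigma>2))"
    unfolding lik_eq_prod[OF assms] using assms
    by (intro prod_mono conjI divide_right_mono) (auto simp only: exp_le_one_iff nonpos, auto)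
  then show ?thesis by simp
qed

text \<open>Only the squared residuals \<open>(r i - \<beta> * e i)\<^sup>2\<close> depend on
  \<beta>, and their expansion around \<beta>0 is exact. Whatever else depends on \<open>m\<close>
  stays in the factor at \<beta>0, which never has to be evaluated.\<close>

lemma lik_eq_exp_quadratic:
  assumes \<sigma>: "0 < \<sigma>1" "0 < \<sigma>2"
  shows "lik \<sigma>1 \<sigma>2 n yx w (\<beta>, m) = lik \<sigma>1 \<sigma>2 n yx w (\<beta>0, m) *
    exp ((\<beta> - \<beta>0) * score_tilde \<sigma>1 \<beta>0 m n yx w - real n * (\<beta> - \<beta>0)\<^sup>2 * I_tilde \<sigma>1 m n yx w / 2)"
proof (cases "n = 0")
  case True
  then show ?thesis by (simp add: lik_eq_prod[OF \<sigma>] score_tilde_def I_tilde_def)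
next
  case False
  define r where "r i = fst (yx i) - fst m (w i)" for i
  define e where "e i = snd (yx i) - snd m (w i)" for i
  have "(\<beta> - \<beta>0) * score_tilde \<sigma>1 \<beta>0 m n yx w - real n * (\<beta> - \<beta>0)\<^sup>2 * I_tilde \<sigma>1 m n yx w / 2
     = (\<Sum>i<n. (\<beta> - \<beta>0) * ((r i - e i * \<beta>0) * e i) / \<sigma>1\<^sup>2 - (\<beta> - \<beta>0)\<^sup>2 * (e i / \<sigma>1)\<^sup>2 / 2)"
    using False unfolding score_tilde_def I_tilde_def r_def e_def
    by (simp add: sum_subtractf sum_distrib_left sum_divide_distrib)
  then have "exp ((\<beta> - \<beta>0) * score_tilde \<sigma>1 \<beta>0 m n yx w - real n * (\<beta> - \<beta>0)\<^sup>2 * I_tilde \<sigma>1 m n yx w / 2)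
     = (\<Prod>i<n. exp ((\<beta> - \<beta>0) * ((r i - e i * \<beta>0) * e i) / \<sigma>1\<^sup>2 - (\<beta> - \<beta>0)\<^sup>2 * (e i / \<sigma>1)\<^sup>2 / 2))"
    by (simp add: exp_sum)
  moreover have "exp (- (r i - \<beta> * e i)\<^sup>2 / (2 * \<sigma>1\<^sup>2) - (e i)\<^sup>2 / (2 * \<sigma>2\<^sup>2))
     = exp (- (r i - \<beta>0 * e i)\<^sup>2 / (2 * \<sigma>1\<^sup>2) - (e i)\<^sup>2 / (2 * \<sigma>2\<^sup>2))
       * exp ((\<beta> - \<beta>0) * ((r i - e i * \<beta>0) * e i) / \<sigma>1\<^sup>2 - (\<beta> - \<beta>0)\<^sup>2 * (e i / \<sigma>1)\<^sup>2 / 2)" for i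
    unfolding exp_add[symmetric] using \<sigma> by (simp add: power2_eq_square field_simps)
  ultimately show ?thesis
    unfolding lik_eq_prod[OF \<sigma>] prod.distrib[symmetric] fst_conv snd_conv r_def[symmetric] e_def[symmetric]
    by (simp add: prod_dividef prod.distrib)
qed

text \<open>A one-sided bound for all events suffices, by passing to complements.\<close>

lemma tv_dist_le:
  assumes P: "prob_space P" "sets P = sets borel" and Q: "prob_space Q" "sets Q = sets borel"
    and le: "\<And>B. B \<in> sets borel \<Longrightarrow> measure P B \<le> measure Q B + e"
  shows "tv_dist P Q \<le> ennreal e"
  unfolding tv_dist_def
proof (intro SUP_least ennreal_leI)
  fix B :: "real set" assume B: "B \<in> sets borel"
  have sp: "space P = UNIV" "space Q = UNIV" using P Q by (auto dest: sets_eq_imp_space_eq)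
  have "measure P (UNIV - B) = 1 - measure P B" "measure Q (UNIV - B) = 1 - measure Q B"
    using prob_space.prob_compl[OF P(1), of B] prob_space.prob_compl[OF Q(1), of B] B P Q sp by auto
  then show "\<bar>measure P B - measure Q B\<bar> \<le> e"
    using le[OF B] le[of "UNIV - B"] B by (auto simp: Compl_eq_Diff_UNIV[symmetric])
qed

text \<open>Posterior calculus for one fixed covariate sequence. The likelihood sees
  \<open>m\<close> only through its values at the \<open>w i\<close>, so measurability is asked of
  these evaluations.\<close>

locale normal_posterior =
  fixes \<sigma>1 \<sigma>2 :: real and \<Pi>B :: "real measure" and \<Pi>M :: "'d::finite fn_pair measure"
    and w :: "nat \<Rightarrow> real ^ 'd"
  assumes \<sigma>_pos: "0 < \<sigma>1" "0 < \<sigma>2"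
    and prob_B: "prob_space \<Pi>B" and prob_M: "prob_space \<Pi>M"
    and id_meas[measurable]: "(\<lambda>\<beta>. \<beta>) \<in> borel_measurable \<Pi>B"
    and eval_meas[measurable]: "\<And>i. (\<lambda>m. fst m (w i)) \<in> borel_measurable \<Pi>M"
      "\<And>i. (\<lambda>m. snd m (w i)) \<in> borel_measurable \<Pi>M"
begin

abbreviation "post n yx \<equiv> posterior \<sigma>1 \<sigma>2 \<Pi>B \<Pi>M n yx w"
abbreviation "post_beta n yx \<equiv> posterior_beta \<sigma>1 \<sigma>2 \<Pi>B \<Pi>M n yx w"
abbreviation "post_m n yx \<equiv> posterior_m \<sigma>1 \<sigma>2 \<Pi>B \<Pi>M n yx w"
abbreviation "evd n yx \<equiv> evidence \<sigma>1 \<sigma>2 \<Pi>B \<Pi>M n yx w"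

sublocale B: prob_space \<Pi>B by (rule prob_B)
sublocale M: prob_space \<Pi>M by (rule prob_M)
sublocale BM: pair_prob_space \<Pi>B \<Pi>M ..

lemma lik_measurable[measurable]: "lik \<sigma>1 \<sigma>2 n yx w \<in> borel_measurable (\<Pi>B \<Otimes>\<^sub>M \<Pi>M)"
proof -
  have fst_meas[measurable]: "(\<lambda>\<theta>. fst \<theta>) \<in> borel_measurable (\<Pi>B \<Otimes>\<^sub>M \<Pi>M)"
    using measurable_compose[OF measurable_fst id_meas] by simp
  have [measurable]: "(\<lambda>\<theta>. fst (snd \<theta>) (w i)) \<in> borel_measurable (\<Pi>B \<Otimes>\<^sub>M \<Pi>M)"
     "(\<lambda>\<theta>. snd (snd \<theta>) (w i)) \<in> borel_measurable (\<Pi>B \<Otimes>\<^sub>M \<Pi>M)" for i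
    using measurable_compose[OF measurable_snd eval_meas(1)] measurable_compose[OF measurable_snd eval_meas(2)] by auto
  show ?thesis unfolding lik_eq_prod[OF \<sigma>_pos, abs_def] by measurable
qed

lemma fst_measurable[measurable]: "fst \<in> borel_measurable (\<Pi>B \<Otimes>\<^sub>M \<Pi>M)"
  using measurable_compose[OF measurable_fst id_meas] by simp

text \<open>The likelihood is strictly positive and, for given \<open>n\<close>, bounded by a
  constant, while the prior has total mass one. Hence \<open>posterior\<close> is a probability
  measure at every data point.\<close>

lemma evidence_pos_finite: "0 < evd n yx" "evd n yx < \<infinity>"
proof -
  have "evd n yx \<le> (\<integral>\<^sup>+\<theta>. ennreal ((1 / (2 * pi * \<sigma>1 * \<sigma>2)) ^ n) \<partial>(\<Pi>B \<Otimes>\<^sub>M \<Pi>M))"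
    unfolding evidence_def using lik_le[OF \<sigma>_pos] by (intro nn_integral_mono ennreal_leI)
  also have "\<dots> < \<infinity>" by (simp add: BM.P.emeasure_space_1)
  finally show "evd n yx < \<infinity>" .
  have "evd n yx \<noteq> 0"
  proof
    assume "evd n yx = 0"
    then have "AE \<theta> in \<Pi>B \<Otimes>\<^sub>M \<Pi>M. ennreal (lik \<sigma>1 \<sigma>2 n yx w \<theta>) = 0"
      unfolding evidence_def by (subst (asm) nn_integral_0_iff_AE) auto
    then have "AE \<theta> in \<Pi>B \<Otimes>\<^sub>M \<Pi>M. False"
    proof eventually_elim
      case (elim \<theta>)
      then show False using lik_pos[OF \<sigma>_pos, of n yx w \<theta>] by (simp add: ennreal_eq_0_iff)
    qed
    then show False by simp
  qed
  then show "0 < evd n yx" by (simp add: zero_less_iff_neq_zero)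
qed

lemma sets_post[measurable_cong]: "sets (post n yx) = sets (\<Pi>B \<Otimes>\<^sub>M \<Pi>M)"
  unfolding posterior_def by simp

lemma space_post: "space (post n yx) = space \<Pi>B \<times> space \<Pi>M"
  unfolding posterior_def by (simp add: space_pair_measure)

lemma prob_space_post: "prob_space (post n yx)"
proof
  have "emeasure (post n yx) (space (post n yx)) = (\<integral>\<^sup>+\<theta>. ennreal (lik \<sigma>1 \<sigma>2 n yx w \<theta>) / evd n yx \<partial>(\<Pi>B \<Otimes>\<^sub>M \<Pi>M))"
    unfolding posterior_def by (subst emeasure_density) (auto intro!: nn_integral_cong)
  also have "\<dots> = evd n yx / evd n yx"
    unfolding evidence_def by (rule nn_integral_divide) auto
  finally show "emeasure (post n yx) (space (post n yx)) = 1"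
    using evidence_pos_finite[of n yx] by (simp add: ennreal_divide_self)
qed

lemma prob_space_post_beta: "prob_space (post_beta n yx)"
  unfolding posterior_beta_def by (intro prob_space.prob_space_distr prob_space_post) measurable

lemma prob_space_post_m: "prob_space (post_m n yx)"
  unfolding posterior_m_def by (intro prob_space.prob_space_distr prob_space_post) measurable

lemma sets_post_m[simp, measurable_cong]: "sets (post_m n yx) = sets \<Pi>M"
  unfolding posterior_m_def by simp

text \<open>The posterior of \<beta> is a mixture over \<open>m\<close>, with weights involving the
  likelihood at \<beta>0. Both sides of \<open>le\<close> carry the same weight, so the inequality
  survives integration over \<open>A\<close>; posterior mass outside \<open>A\<close> is simply
  added.\<close>

lemma posterior_beta_le:
  assumes A[measurable]: "A \<in> sets \<Pi>M" and B[measurable]: "B \<in> sets borel" and c: "0 \<le> c"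
    and le: "\<And>m. m \<in> A \<Longrightarrow>
      (\<integral>\<^sup>+\<beta>. indicator B \<beta> * ennreal (exp ((\<beta> - \<beta>0) * score_tilde \<sigma>1 \<beta>0 m n yx w - real n * (\<beta> - \<beta>0)\<^sup>2 * I_tilde \<sigma>1 m n yx w / 2)) \<partial>\<Pi>B)
      \<le> ennreal c * (\<integral>\<^sup>+\<beta>. ennreal (exp ((\<beta> - \<beta>0) * score_tilde \<sigma>1 \<beta>0 m n yx w - real n * (\<beta> - \<beta>0)\<^sup>2 * I_tilde \<sigma>1 m n yx w / 2)) \<partial>\<Pi>B)"
  shows "measure (post_beta n yx) B \<le> c + (1 - measure (post_m n yx) A)"
proof -
  interpret P: prob_space "post n yx" by (rule prob_space_post)
  interpret PM: prob_space "post_m n yx" by (rule prob_space_post_m)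
  define l where "l \<theta> = ennreal (lik \<sigma>1 \<sigma>2 n yx w \<theta>) / evd n yx" for \<theta>
  have [measurable]: "l \<in> borel_measurable (\<Pi>B \<Otimes>\<^sub>M \<Pi>M)" unfolding l_def by measurable
  define S where "S = {\<theta> \<in> space (\<Pi>B \<Otimes>\<^sub>M \<Pi>M). fst \<theta> \<in> B}"
  define T where "T = {\<theta> \<in> space (\<Pi>B \<Otimes>\<^sub>M \<Pi>M). snd \<theta> \<in> A}"
  have S[measurable]: "S \<in> sets (\<Pi>B \<Otimes>\<^sub>M \<Pi>M)" and T[measurable]: "T \<in> sets (\<Pi>B \<Otimes>\<^sub>M \<Pi>M)"
    unfolding S_def T_def by measurable
  have mB: "measure (post_beta n yx) B = P.prob S"
    unfolding posterior_beta_def by (subst measure_distr) (auto simp: S_def space_post space_pair_measure intro!: arg_cong[where f = P.prob])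
  have mA: "measure (post_m n yx) A = P.prob T"
    unfolding posterior_m_def by (subst measure_distr) (auto simp: T_def space_post space_pair_measure intro!: arg_cong[where f = P.prob])
  have ind: "indicator (S \<inter> T) (\<beta>, m) = (indicator B \<beta> * indicator A m :: ennreal)" if "\<beta> \<in> space \<Pi>B" "m \<in> space \<Pi>M" for \<beta> m
    using that by (auto simp: S_def T_def space_pair_measure indicator_def)
  have "emeasure (post n yx) (S \<inter> T) = (\<integral>\<^sup>+\<theta>. l \<theta> * indicator (S \<inter> T) \<theta> \<partial>(\<Pi>B \<Otimes>\<^sub>M \<Pi>M))"
    unfolding posterior_def l_def by (subst emeasure_density) auto
  also have "\<dots> = (\<integral>\<^sup>+m. \<integral>\<^sup>+\<beta>. l (\<beta>, m) * indicator (S \<inter> T) (\<beta>, m) \<partial>\<Pi>B \<partial>\<Pi>M)"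
    by (rule BM.nn_integral_snd[symmetric]) measurable
  also have "\<dots> \<le> (\<integral>\<^sup>+m. \<integral>\<^sup>+\<beta>. ennreal c * l (\<beta>, m) \<partial>\<Pi>B \<partial>\<Pi>M)"
  proof (rule nn_integral_mono)
    fix m assume m: "m \<in> space \<Pi>M"
    show "(\<integral>\<^sup>+\<beta>. l (\<beta>, m) * indicator (S \<inter> T) (\<beta>, m) \<partial>\<Pi>B) \<le> (\<integral>\<^sup>+\<beta>. ennreal c * l (\<beta>, m) \<partial>\<Pi>B)"
    proof (cases "m \<in> A")
      case True
      define q where "q \<beta> = exp ((\<beta> - \<beta>0) * score_tilde \<sigma>1 \<beta>0 m n yx w - real n * (\<beta> - \<beta>0)\<^sup>2 * I_tilde \<sigma>1 m n yx w / 2)" for \<beta>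
      have [measurable]: "q \<in> borel_measurable \<Pi>B" unfolding q_def by measurable
      have [measurable]: "(\<lambda>\<beta>. indicator B \<beta> * ennreal (q \<beta>)) \<in> borel_measurable \<Pi>B"
        by (intro borel_measurable_times_ennreal measurable_compose[OF id_meas borel_measurable_indicator[OF B]]
              measurable_compose[OF _ measurable_ennreal] \<open>q \<in> borel_measurable \<Pi>B\<close>)
      \<comment> \<open>The part of the posterior density that does not depend on \<beta>; it
        multiplies both sides of \<open>le\<close>.\<close>
      define g where "g = ennreal (lik \<sigma>1 \<sigma>2 n yx w (\<beta>0, m)) / evd n yx"
      have lq: "l (\<beta>, m) = g * ennreal (q \<beta>)" for \<beta>
        unfolding l_def g_def lik_eq_exp_quadratic[OF \<sigma>_pos, of n yx w \<beta> m \<beta>0] q_def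
        using lik_pos[OF \<sigma>_pos, of n yx w "(\<beta>0, m)"]
        by (simp add: ennreal_mult divide_ennreal_def mult_ac)
      have "(\<integral>\<^sup>+\<beta>. l (\<beta>, m) * indicator (S \<inter> T) (\<beta>, m) \<partial>\<Pi>B) = (\<integral>\<^sup>+\<beta>. g * (indicator B \<beta> * ennreal (q \<beta>)) \<partial>\<Pi>B)"
        using True m by (intro nn_integral_cong) (simp add: ind lq mult_ac)
      also have "\<dots> = g * (\<integral>\<^sup>+\<beta>. indicator B \<beta> * ennreal (q \<beta>) \<partial>\<Pi>B)"
        by (rule nn_integral_cmult) measurable
      also have "\<dots> \<le> g * (ennreal c * (\<integral>\<^sup>+\<beta>. ennreal (q \<beta>) \<partial>\<Pi>B))"
        using le[OF True] unfolding q_def by (intro mult_left_mono) auto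
      also have "\<dots> = (\<integral>\<^sup>+\<beta>. ennreal c * l (\<beta>, m) \<partial>\<Pi>B)"
        unfolding lq by (simp add: nn_integral_cmult mult_ac)
      finally show ?thesis .
    next
      case False
      then have "indicator (S \<inter> T) (\<beta>, m) = (0::ennreal)" if "\<beta> \<in> space \<Pi>B" for \<beta>
        using that m by (simp add: ind)
      then have "(\<integral>\<^sup>+\<beta>. l (\<beta>, m) * indicator (S \<inter> T) (\<beta>, m) \<partial>\<Pi>B) = (\<integral>\<^sup>+\<beta>. 0 \<partial>\<Pi>B)"
        by (intro nn_integral_cong) simp
      then show ?thesis by simp
    qed
  qed
  also have "\<dots> = (\<integral>\<^sup>+\<theta>. ennreal c * l \<theta> \<partial>(\<Pi>B \<Otimes>\<^sub>M \<Pi>M))"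
    by (rule BM.nn_integral_snd) measurable
  also have "\<dots> = ennreal c * (\<integral>\<^sup>+\<theta>. l \<theta> * indicator (space (\<Pi>B \<Otimes>\<^sub>M \<Pi>M)) \<theta> \<partial>(\<Pi>B \<Otimes>\<^sub>M \<Pi>M))"
    by (subst nn_integral_cmult) (auto intro!: nn_integral_cong arg_cong2[where f = "(*)"])
  also have "\<dots> = ennreal c * emeasure (post n yx) (space (post n yx))"
    unfolding posterior_def l_def by (subst emeasure_density) auto
  also have "\<dots> = ennreal c" by (simp add: P.emeasure_space_1)
  finally have 1: "P.prob (S \<inter> T) \<le> c"
    using c by (simp add: P.emeasure_eq_measure)
  have "P.prob S \<le> P.prob ((S \<inter> T) \<union> (space (post n yx) - T))"
    by (rule P.finite_measure_mono) (auto simp: S_def space_post space_pair_measure)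
  also have "\<dots> \<le> P.prob (S \<inter> T) + P.prob (space (post n yx) - T)"
    by (rule measure_Un_le) measurable
  also have "P.prob (space (post n yx) - T) = 1 - P.prob T"
    by (rule P.prob_compl) measurable
  finally show ?thesis using 1 unfolding mA mB by linarith
qed

end

subsection \<open>Moments and averages of independent variables\<close>

text \<open>Each set has a measurable cover of the same outer measure. The bad events to be united
  involve suprema over \<open>m\<close> and total variation distances, and so may fail to be
  measurable.\<close>

lemma outer_measure_of_Un_le:
  assumes "A \<subseteq> space M" "B \<subseteq> space M"
  shows "outer_measure_of M (A \<union> B) \<le> outer_measure_of M A + outer_measure_of M B"
proof -
  obtain E where E: "E \<in> sets M" "A \<subseteq> E" "outer_measure_of M A = emeasure M E"
    using outer_measure_of_attain[OF assms(1)] by blast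
  obtain F where F: "F \<in> sets M" "B \<subseteq> F" "outer_measure_of M B = emeasure M F"
    using outer_measure_of_attain[OF assms(2)] by blast
  have "outer_measure_of M (A \<union> B) \<le> outer_measure_of M (E \<union> F)"
    using E F by (intro outer_measure_of_mono) auto
  also have "\<dots> \<le> emeasure M E + emeasure M F"
    using E F by (simp add: emeasure_subadditive)
  finally show ?thesis using E F by simp
qed

text \<open>Bienayme's identity: the cross terms factor by independence and vanish because the means
  do.\<close>

lemma (in prob_space) second_moment_sum_indep:
  fixes X :: "'i \<Rightarrow> 'a \<Rightarrow> real"
  assumes J: "finite J" and ind: "indep_vars (\<lambda>_. borel) X J"
    and sq: "\<And>i. i \<in> J \<Longrightarrow> integrable M (\<lambda>x. (X i x)\<^sup>2)"
    and mean: "\<And>i. i \<in> J \<Longrightarrow> expectation (X i) = 0"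
  shows "integrable M (\<lambda>x. (\<Sum>i\<in>J. X i x)\<^sup>2)"
    and "expectation (\<lambda>x. (\<Sum>i\<in>J. X i x)\<^sup>2) = (\<Sum>i\<in>J. expectation (\<lambda>x. (X i x)\<^sup>2))"
proof -
  have rv: "random_variable borel (X i)" if "i \<in> J" for i
    using ind that by (auto simp: indep_vars_def)
  have int: "integrable M (X i)" if "i \<in> J" for i
    using square_integrable_imp_integrable[OF rv sq] that by simp
  have cross: "integrable M (\<lambda>x. X i x * X j x) \<and> expectation (\<lambda>x. X i x * X j x) = (if i = j then expectation (\<lambda>x. (X i x)\<^sup>2) else 0)"
    if "i \<in> J" "j \<in> J" for i j
  proof (cases "i = j")
    case True
    then show ?thesis using sq[OF that(1)] by (simp add: power2_eq_square)
  next
    case False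
    have ij: "indep_vars (\<lambda>_. borel) X {i, j}" using that by (intro indep_vars_subset[OF ind]) auto
    have "integrable M (X k)" if "k \<in> {i, j}" for k using that \<open>i \<in> J\<close> \<open>j \<in> J\<close> int by auto
    from indep_vars_lebesgue_integral[OF _ ij this] indep_vars_integrable[OF _ ij this] False mean that
    show ?thesis by simp
  qed
  have eq: "(\<Sum>i\<in>J. X i x)\<^sup>2 = (\<Sum>i\<in>J. \<Sum>j\<in>J. X i x * X j x)" for x
    by (simp add: power2_eq_square sum_product)
  show "integrable M (\<lambda>x. (\<Sum>i\<in>J. X i x)\<^sup>2)"
    unfolding eq using cross by (intro Bochner_Integration.integrable_sum) auto
  have "expectation (\<lambda>x. (\<Sum>i\<in>J. X i x)\<^sup>2) = (\<Sum>i\<in>J. \<Sum>j\<in>J. expectation (\<lambda>x. X i x * X j x))"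
    unfolding eq using cross
    by (subst Bochner_Integration.integral_sum, fastforce intro!: Bochner_Integration.integrable_sum)
       (intro sum.cong refl Bochner_Integration.integral_sum, auto)
  also have "\<dots> = (\<Sum>i\<in>J. \<Sum>j\<in>J. if i = j then expectation (\<lambda>x. (X i x)\<^sup>2) else 0)"
    using cross by (intro sum.cong refl) auto
  also have "\<dots> = (\<Sum>i\<in>J. expectation (\<lambda>x. (X i x)\<^sup>2))" using J by simp
  finally show "expectation (\<lambda>x. (\<Sum>i\<in>J. X i x)\<^sup>2) = (\<Sum>i\<in>J. expectation (\<lambda>x. (X i x)\<^sup>2))" .
qed

text \<open>The joint law of the coordinates under a product measure is that product measure, which
  characterises independence. The characterisation used asks for a nonempty index set, hence the
  case distinction.\<close>

lemma indep_vars_PiM_components: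
  assumes M: "\<And>i. i \<in> I \<Longrightarrow> prob_space (M i)"
    and f: "\<And>i. i \<in> I \<Longrightarrow> f i \<in> measurable (M i) N"
  shows "prob_space.indep_vars (Pi\<^sub>M I M) (\<lambda>_. N) (\<lambda>i x. f i (x i)) I"
proof (cases "I = {}")
  case True
  interpret prob_space "Pi\<^sub>M I M" by (rule prob_space_PiM[OF M])
  show ?thesis unfolding indep_vars_def indep_sets_def using True by simp
next
  case False
  interpret prob_space "Pi\<^sub>M I M" by (rule prob_space_PiM[OF M])
  have "distr (Pi\<^sub>M I M) (Pi\<^sub>M I M) (\<lambda>x. \<lambda>i\<in>I. x i) = distr (Pi\<^sub>M I M) (Pi\<^sub>M I M) (\<lambda>x. x)"
    by (intro distr_cong) (auto simp: space_PiM PiE_def extensional_restrict)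
  also have "\<dots> = Pi\<^sub>M I (\<lambda>i. distr (Pi\<^sub>M I M) (M i) (\<lambda>x. x i))"
    using M by (auto simp: distr_PiM_component distr_id2 intro!: PiM_cong)
  finally have "indep_vars M (\<lambda>i x. x i) I"
    using False by (subst indep_vars_iff_distr_eq_PiM') auto
  then show ?thesis using f by (rule indep_vars_compose2)
qed

lemma integral_PiM_component:
  fixes g :: "'a \<Rightarrow> real"
  assumes M: "\<And>i. i \<in> I \<Longrightarrow> prob_space (M i)" and i: "i \<in> I" and g: "g \<in> borel_measurable (M i)"
  shows "integrable (Pi\<^sub>M I M) (\<lambda>x. g (x i)) = integrable (M i) g"
    and "(\<integral>x. g (x i) \<partial>Pi\<^sub>M I M) = (\<integral>x. g x \<partial>M i)"
proof -
  have d: "distr (Pi\<^sub>M I M) (M i) (\<lambda>x. x i) = M i"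
    using M i by (rule distr_PiM_component)
  have m: "(\<lambda>x. x i) \<in> measurable (Pi\<^sub>M I M) (M i)" using i by measurable
  show "integrable (Pi\<^sub>M I M) (\<lambda>x. g (x i)) = integrable (M i) g"
    using integrable_distr_eq[OF m g] d by simp
  show "(\<integral>x. g (x i) \<partial>Pi\<^sub>M I M) = (\<integral>x. g x \<partial>M i)"
    using integral_distr[OF m g] d by simp
qed

text \<open>The series of the \<open>f k\<close> has a finite integral, so it converges almost
  everywhere and its terms vanish. In the strong laws this takes the role of the Borel-Cantelli
  lemma.\<close>

lemma AE_tendsto_zero_if_summable_integrals:
  fixes f :: "nat \<Rightarrow> 'a \<Rightarrow> real"
  assumes int: "\<And>k. integrable M (f k)" and nn: "\<And>k x. 0 \<le> f k x"
    and sm: "summable (\<lambda>k. \<integral>x. f k x \<partial>M)"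
  shows "AE x in M. (\<lambda>k. f k x) \<longlonglongrightarrow> 0"
proof -
  have [measurable]: "f k \<in> borel_measurable M" for k using int by auto
  have "(\<integral>\<^sup>+x. (\<Sum>k. ennreal (f k x)) \<partial>M) = (\<Sum>k. ennreal (\<integral>x. f k x \<partial>M))"
    using int nn by (subst nn_integral_suminf) (auto simp: nn_integral_eq_integral)
  also have "\<dots> = ennreal (\<Sum>k. \<integral>x. f k x \<partial>M)"
    using nn sm by (intro suminf_ennreal2) auto
  finally have "AE x in M. (\<Sum>k. ennreal (f k x)) \<noteq> \<infinity>"
    by (intro nn_integral_PInf_AE) auto
  then show ?thesis
  proof eventually_elim
    case (elim x)
    have "summable (\<lambda>k. f k x)"
      by (rule summable_suminf_not_top) (use nn elim in auto)
    then show ?case by (rule summable_LIMSEQ_zero)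
  qed
qed

text \<open>With \<open>k = floor_sqrt n\<close>, monotonicity traps \<open>S n / real n ^ p\<close>
  between the values at \<open>k\<^sup>2\<close> and \<open>(Suc k)\<^sup>2\<close>, up to the
  factor \<open>(real (Suc k) / real k) ^ (2 * p)\<close>, which tends to 1. The exponent is 1 for
  averages and 2 for sums divided by the square of \<open>n\<close>.\<close>

lemma LIMSEQ_mono_interpolate_squares:
  fixes S :: "nat \<Rightarrow> real"
  assumes S: "mono S" "\<And>n. 0 \<le> S n" and lim: "(\<lambda>k. S (k\<^sup>2) / real (k\<^sup>2) ^ p) \<longlonglongrightarrow> c"
  shows "(\<lambda>n. S n / real n ^ p) \<longlonglongrightarrow> c"
proof -
  have fs: "filterlim floor_sqrt at_top sequentially"
    unfolding filterlim_at_top eventually_sequentially by (metis le_floor_sqrt_iff)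
  have r: "(\<lambda>k. real (Suc k) / real k) \<longlonglongrightarrow> 1"
    by (rule LIMSEQ_Suc_n_over_n)
  have r1: "(\<lambda>k. (real (Suc k) / real k) ^ (2 * p)) \<longlonglongrightarrow> 1"
    using tendsto_power[OF r] by simp
  have r2: "(\<lambda>k. inverse ((real (Suc k) / real k) ^ (2 * p))) \<longlonglongrightarrow> 1"
    using tendsto_inverse[OF r1] by simp
  have "(\<lambda>k. S (k\<^sup>2) / real (k\<^sup>2) ^ p * inverse ((real (Suc k) / real k) ^ (2 * p))) \<longlonglongrightarrow> c * 1"
    by (intro tendsto_mult lim r2)
  then have lower: "(\<lambda>n. S ((floor_sqrt n)\<^sup>2) / real ((floor_sqrt n)\<^sup>2) ^ p * inverse ((real (Suc (floor_sqrt n)) / real (floor_sqrt n)) ^ (2 * p))) \<longlonglongrightarrow> c"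
    using fs by (auto intro: filterlim_compose)
  have "(\<lambda>k. S ((Suc k)\<^sup>2) / real ((Suc k)\<^sup>2) ^ p * (real (Suc k) / real k) ^ (2 * p)) \<longlonglongrightarrow> c * 1"
    by (intro tendsto_mult LIMSEQ_Suc[OF lim] r1)
  then have upper: "(\<lambda>n. S ((Suc (floor_sqrt n))\<^sup>2) / real ((Suc (floor_sqrt n))\<^sup>2) ^ p * (real (Suc (floor_sqrt n)) / real (floor_sqrt n)) ^ (2 * p)) \<longlonglongrightarrow> c"
    using fs by (auto intro: filterlim_compose)
  show ?thesis
  proof (rule tendsto_sandwich[OF _ _ lower upper])
    show "\<forall>\<^sub>F n in sequentially. S ((floor_sqrt n)\<^sup>2) / real ((floor_sqrt n)\<^sup>2) ^ p * inverse ((real (Suc (floor_sqrt n)) / real (floor_sqrt n)) ^ (2 * p)) \<le> S n / real n ^ p"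
      using eventually_gt_at_top[of 0]
    proof eventually_elim
      case (elim n)
      define k where "k = floor_sqrt n"
      have k: "0 < k" "k\<^sup>2 \<le> n" "n < (Suc k)\<^sup>2" using elim Suc_floor_sqrt_power2_gt[of n] unfolding k_def by auto
      have "(real (Suc k) / real k) ^ (2 * p) = real ((Suc k)\<^sup>2) ^ p / real (k\<^sup>2) ^ p"
        by (simp add: power_mult power_divide del: of_nat_Suc)
      then have "S (k\<^sup>2) / real (k\<^sup>2) ^ p * inverse ((real (Suc k) / real k) ^ (2 * p)) = S (k\<^sup>2) / (real ((Suc k)\<^sup>2)) ^ p"
        using k by (simp del: of_nat_Suc of_nat_power)
      also have "\<dots> \<le> S n / real n ^ p"
        using S k elim by (intro frac_le power_mono monoD[OF S(1)]) (auto simp del: of_nat_Suc of_nat_power)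
      finally show ?case unfolding k_def .
    qed
    show "\<forall>\<^sub>F n in sequentially. S n / real n ^ p \<le> S ((Suc (floor_sqrt n))\<^sup>2) / real ((Suc (floor_sqrt n))\<^sup>2) ^ p * (real (Suc (floor_sqrt n)) / real (floor_sqrt n)) ^ (2 * p)"
      using eventually_gt_at_top[of 0]
    proof eventually_elim
      case (elim n)
      define k where "k = floor_sqrt n"
      have k: "0 < k" "k\<^sup>2 \<le> n" "n < (Suc k)\<^sup>2" using elim Suc_floor_sqrt_power2_gt[of n] unfolding k_def by auto
      have "S n / real n ^ p \<le> S ((Suc k)\<^sup>2) / real (k\<^sup>2) ^ p"
        using S k elim by (intro frac_le power_mono monoD[OF S(1)]) (auto simp del: of_nat_Suc of_nat_power)
      also have "\<dots> = S ((Suc k)\<^sup>2) / real ((Suc k)\<^sup>2) ^ p * (real (Suc k) / real k) ^ (2 * p)"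
        using k by (simp add: power_mult power_divide del: of_nat_Suc)
      finally show ?case unfolding k_def .
    qed
  qed
qed

text \<open>Second moments make the averages along the squares converge almost surely; nonnegativity of \<open>g\<close> makes
  the partial sums monotone and so fills the gaps.\<close>

lemma (in prob_space) AE_PiM_average_tendsto:
  fixes g :: "'a \<Rightarrow> real"
  assumes g[measurable]: "g \<in> borel_measurable M" and nn: "\<And>x. 0 \<le> g x"
    and sq: "integrable M (\<lambda>x. (g x)\<^sup>2)"
  shows "AE x in Pi\<^sub>M UNIV (\<lambda>_::nat. M). (\<lambda>n. (\<Sum>i<n. g (x i)) / real n) \<longlonglongrightarrow> expectation g"
proof -
  interpret P: prob_space "Pi\<^sub>M UNIV (\<lambda>_::nat. M)" by (intro prob_space_PiM prob_space_axioms)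
  define c where "c = expectation g"
  define h where "h x = g x - c" for x
  have int: "integrable M g" by (rule square_integrable_imp_integrable[OF g sq])
  have h[measurable]: "h \<in> borel_measurable M" unfolding h_def by measurable
  have h2: "integrable M (\<lambda>x. (h x)\<^sup>2)" unfolding h_def power2_diff using int sq by auto
  have h0: "expectation h = 0" unfolding h_def c_def using int by (simp add: prob_space)
  have hm: "(\<lambda>x. (h x)\<^sup>2) \<in> borel_measurable M" by measurable
  note comp = integral_PiM_component[of UNIV "\<lambda>_. M", OF prob_space_axioms UNIV_I h] integral_PiM_component[of UNIV "\<lambda>_. M", OF prob_space_axioms UNIV_I hm]
  \<comment> \<open>The mean square of the centred average of \<open>k\<^sup>2\<close> terms is the
    variance over \<open>k\<^sup>2\<close>, which is summable in \<open>k\<close>; along all indices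
    the corresponding series would be harmonic.\<close>
  define f where "f k x = ((\<Sum>i<k\<^sup>2. h (x i)) / real (k\<^sup>2))\<^sup>2" for k :: nat and x :: "nat \<Rightarrow> 'a"
  have ind: "P.indep_vars (\<lambda>_. borel) (\<lambda>i x. h (x i)) {..<n}" for n :: nat
    by (rule P.indep_vars_subset[OF indep_vars_PiM_components]) (auto simp: prob_space_axioms)
  have f_int: "integrable (Pi\<^sub>M UNIV (\<lambda>_. M)) (f k)"
    and f_val: "(\<integral>x. f k x \<partial>Pi\<^sub>M UNIV (\<lambda>_. M)) = expectation (\<lambda>x. (h x)\<^sup>2) / real k ^ 2" for k
  proof -
    note * = P.second_moment_sum_indep[OF _ ind[of "k\<^sup>2"]]
    have **: "integrable (Pi\<^sub>M UNIV (\<lambda>_. M)) (\<lambda>x. (\<Sum>i<k\<^sup>2. h (x i))\<^sup>2)"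
       "(\<integral>x. (\<Sum>i<k\<^sup>2. h (x i))\<^sup>2 \<partial>Pi\<^sub>M UNIV (\<lambda>_. M)) = (\<Sum>i<k\<^sup>2. expectation (\<lambda>x. (h x)\<^sup>2))"
      using * h2 h0 by (simp_all add: comp)
    show "integrable (Pi\<^sub>M UNIV (\<lambda>_. M)) (f k)" unfolding f_def power_divide using ** by auto
    \<comment> \<open>For \<open>k = 0\<close> both sides are 0, by division by zero.\<close>
    show "(\<integral>x. f k x \<partial>Pi\<^sub>M UNIV (\<lambda>_. M)) = expectation (\<lambda>x. (h x)\<^sup>2) / real k ^ 2"
      unfolding f_def power_divide using ** by (cases "k = 0") (auto simp: power2_eq_square)
  qed
  have "summable (\<lambda>k. expectation (\<lambda>x. (h x)\<^sup>2) / real k ^ 2)"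
    using summable_mult[OF inverse_power_summable[of 2, where 'a = real], of "expectation (\<lambda>x. (h x)\<^sup>2)"]
    by (simp add: divide_inverse)
  then have sm: "summable (\<lambda>k. \<integral>x. f k x \<partial>Pi\<^sub>M UNIV (\<lambda>_. M))" unfolding f_val .
  have "AE x in Pi\<^sub>M UNIV (\<lambda>_. M). (\<lambda>k. f k x) \<longlonglongrightarrow> 0"
    by (rule AE_tendsto_zero_if_summable_integrals[OF f_int _ sm]) (auto simp: f_def)
  then show ?thesis
  proof eventually_elim
    case (elim x)
    then have "(\<lambda>k. sqrt (f k x)) \<longlonglongrightarrow> sqrt 0" by (rule tendsto_real_sqrt)
    then have 1: "(\<lambda>k. (\<Sum>i<k\<^sup>2. h (x i)) / real (k\<^sup>2)) \<longlonglongrightarrow> 0"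
      unfolding f_def by (simp only: real_sqrt_abs real_sqrt_zero tendsto_rabs_zero_iff)
    have "\<forall>\<^sub>F k in sequentially. (\<Sum>i<k\<^sup>2. h (x i)) / real (k\<^sup>2) + c = (\<Sum>i<k\<^sup>2. g (x i)) / real (k\<^sup>2) ^ 1"
      using eventually_gt_at_top[of 0]
      by eventually_elim (simp add: h_def sum_subtractf diff_divide_distrib)
    then have "(\<lambda>k. (\<Sum>i<k\<^sup>2. g (x i)) / real (k\<^sup>2) ^ 1) \<longlonglongrightarrow> c"
      using tendsto_add[OF 1 tendsto_const[of c]] by (simp add: filterlim_cong)
    then have "(\<lambda>n. (\<Sum>i<n. g (x i)) / real n ^ 1) \<longlonglongrightarrow> c"
      by (intro LIMSEQ_mono_interpolate_squares) (auto simp: mono_def nn sum_nonneg intro!: sum_mono2)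
    then show ?case unfolding c_def by simp
  qed
qed

text \<open>One moment suffices: along the squares the expectation is that of \<open>q\<close>
  divided by \<open>k\<^sup>2\<close>, again summable. It is meant for conditional fourth moments,
  of which only the mean is known to be finite.\<close>

lemma (in prob_space) AE_PiM_sum_over_square_tendsto_0:
  fixes q :: "'a \<Rightarrow> real"
  assumes q: "integrable M q" and nn: "\<And>x. 0 \<le> q x"
  shows "AE x in Pi\<^sub>M UNIV (\<lambda>_::nat. M). (\<lambda>n. (\<Sum>i<n. q (x i)) / (real n)\<^sup>2) \<longlonglongrightarrow> 0"
proof -
  have qm: "q \<in> borel_measurable M" using q by auto
  note comp = integral_PiM_component[of UNIV "\<lambda>_. M", OF prob_space_axioms UNIV_I qm]
  define f where "f k x = (\<Sum>i<k\<^sup>2. q (x i)) / (real (k\<^sup>2))\<^sup>2" for k :: nat and x :: "nat \<Rightarrow> 'a"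
  have f_int: "integrable (Pi\<^sub>M UNIV (\<lambda>_. M)) (f k)" for k unfolding f_def using q by (auto simp: comp)
  have f_val: "(\<integral>x. f k x \<partial>Pi\<^sub>M UNIV (\<lambda>_. M)) = expectation q / real k ^ 2" for k
  proof -
    have "(\<integral>x. f k x \<partial>Pi\<^sub>M UNIV (\<lambda>_. M)) = (\<Sum>i<k\<^sup>2. expectation q) / (real (k\<^sup>2))\<^sup>2"
      unfolding f_def using q by (subst integral_divide_zero, subst Bochner_Integration.integral_sum) (auto simp: comp)
    then show ?thesis by (cases "k = 0") (auto simp: power2_eq_square)
  qed
  have "summable (\<lambda>k. expectation q / real k ^ 2)"
    using summable_mult[OF inverse_power_summable[of 2, where 'a = real], of "expectation q"]
    by (simp add: divide_inverse)
  then have sm: "summable (\<lambda>k. \<integral>x. f k x \<partial>Pi\<^sub>M UNIV (\<lambda>_. M))" unfolding f_val .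
  have "AE x in Pi\<^sub>M UNIV (\<lambda>_. M). (\<lambda>k. f k x) \<longlonglongrightarrow> 0"
    by (rule AE_tendsto_zero_if_summable_integrals[OF f_int _ sm]) (auto simp: f_def nn sum_nonneg)
  then show ?thesis
    by eventually_elim
       (intro LIMSEQ_mono_interpolate_squares, auto simp: f_def mono_def nn sum_nonneg intro!: sum_mono2)
qed

text \<open>Chebyshev's inequality for independent summands whose laws may differ, as the
  conditional laws do along a covariate sequence.\<close>

lemma PiM_sum_tail_le:
  fixes f :: "'i \<Rightarrow> 'a \<Rightarrow> real"
  assumes I: "finite I" and M: "\<And>i. i \<in> I \<Longrightarrow> prob_space (M i)"
    and f: "\<And>i. i \<in> I \<Longrightarrow> f i \<in> borel_measurable (M i)"
    and sq: "\<And>i. i \<in> I \<Longrightarrow> integrable (M i) (\<lambda>x. (f i x)\<^sup>2)"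
    and mean: "\<And>i. i \<in> I \<Longrightarrow> (\<integral>x. f i x \<partial>M i) = 0" and a: "0 < a"
  shows "emeasure (Pi\<^sub>M I M) {x \<in> space (Pi\<^sub>M I M). a \<le> \<bar>\<Sum>i\<in>I. f i (x i)\<bar>}
           \<le> ennreal ((\<Sum>i\<in>I. \<integral>x. (f i x)\<^sup>2 \<partial>M i) / a\<^sup>2)"
proof -
  interpret P: prob_space "Pi\<^sub>M I M" by (rule prob_space_PiM[OF M])
  have f2: "(\<lambda>x. (f i x)\<^sup>2) \<in> borel_measurable (M i)" if "i \<in> I" for i using f[OF that] by simp
  have c: "integrable (Pi\<^sub>M I M) (\<lambda>x. (f i (x i))\<^sup>2)" "P.expectation (\<lambda>x. f i (x i)) = 0"
    "P.expectation (\<lambda>x. (f i (x i))\<^sup>2) = (\<integral>x. (f i x)\<^sup>2 \<partial>M i)" if i: "i \<in> I" for i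
    using integral_PiM_component[where M = M and I = I, OF M i f[OF i]]
      integral_PiM_component[where M = M and I = I, OF M i f2[OF i]] sq[OF i] mean[OF i] by simp_all
  have *: "integrable (Pi\<^sub>M I M) (\<lambda>x. (\<Sum>i\<in>I. f i (x i))\<^sup>2)"
    "P.expectation (\<lambda>x. (\<Sum>i\<in>I. f i (x i))\<^sup>2) = (\<Sum>i\<in>I. \<integral>x. (f i x)\<^sup>2 \<partial>M i)"
    using P.second_moment_sum_indep[OF I indep_vars_PiM_components[where f = f and N = borel, OF M f] c(1,2)]
      c(3) by simp_all
  have "{x \<in> space (Pi\<^sub>M I M). a \<le> \<bar>\<Sum>i\<in>I. f i (x i)\<bar>} = {x \<in> space (Pi\<^sub>M I M). a\<^sup>2 \<le> (\<Sum>i\<in>I. f i (x i))\<^sup>2}"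
    using a by (auto simp: abs_le_square_iff[symmetric])
  then have "P.prob {x \<in> space (Pi\<^sub>M I M). a \<le> \<bar>\<Sum>i\<in>I. f i (x i)\<bar>} \<le> P.expectation (\<lambda>x. (\<Sum>i\<in>I. f i (x i))\<^sup>2) / a\<^sup>2"
    using integral_Markov_inequality_measure[OF *(1) sets.empty_sets, of "a\<^sup>2"] a by simp
  then show ?thesis unfolding * P.emeasure_eq_measure by (rule ennreal_leI)
qed

subsection \<open>Disintegration along the covariates\<close>

locale cond_law =
  fixes P0 :: "'d::finite obs measure" and YY XX :: "real set" and WW :: "(real ^ 'd) set"
    and K :: "(real ^ 'd) \<Rightarrow> (real \<times> real) measure"
  assumes P0_prob: "prob_space P0"
    and P0_sets: "sets P0 = sets (restrict_space borel (YY \<times> XX \<times> WW))"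
    and K: "is_cond_law_YX P0 WW K"
begin

sublocale P0: prob_space P0 by (rule P0_prob)

abbreviation "SW \<equiv> restrict_space borel WW"
abbreviation "\<nu> \<equiv> law_W P0 WW"

lemma space_P0: "space P0 = YY \<times> XX \<times> WW"
  using sets_eq_imp_space_eq[OF P0_sets] by (simp add: space_restrict_space)

lemma measurable_P0_of_borel:
  assumes "f \<in> measurable borel N"
  shows "f \<in> measurable P0 N"
  unfolding measurable_cong_sets[OF P0_sets refl] using assms by (rule measurable_restrict_space1)

lemma obs_measurable[measurable]:
  "obs_Y \<in> borel_measurable P0" "obs_X \<in> borel_measurable P0" "obs_W \<in> borel_measurable P0"
  unfolding obs_Y_def[abs_def] obs_X_def[abs_def] obs_W_def[abs_def]
  by (intro measurable_P0_of_borel; simp add: borel_prod[symmetric])+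

lemma obs_W_measurable[measurable]: "obs_W \<in> measurable P0 SW"
  by (intro measurable_restrict_space2 obs_measurable) (auto simp: space_P0 obs_W_def)

lemma sets_\<nu>[simp, measurable_cong]: "sets \<nu> = sets SW"
  unfolding law_W_def by simp

lemma space_\<nu>[simp]: "space \<nu> = WW"
  unfolding law_W_def by (simp add: space_restrict_space)

sublocale \<nu>: prob_space \<nu>
  unfolding law_W_def by (rule P0.prob_space_distr) measurable

lemma K_meas[measurable]: "K \<in> measurable SW (prob_algebra borel)"
  using K unfolding is_cond_law_YX_def by simp

lemma K_meas'[measurable]: "K \<in> measurable SW (subprob_algebra borel)"
  by (rule measurable_prob_algebraD[OF K_meas])

lemma K_prob: "w \<in> WW \<Longrightarrow> prob_space (K w)" and K_sets: "w \<in> WW \<Longrightarrow> sets (K w) = sets borel"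
  using measurable_space[OF K_meas, of w] by (auto simp: space_restrict_space space_prob_algebra)

lemma pair_meas[measurable]: "(\<lambda>\<omega>. (obs_W \<omega>, obs_Y \<omega>, obs_X \<omega>)) \<in> measurable P0 (SW \<Otimes>\<^sub>M borel)"
  unfolding borel_prod[symmetric] by measurable

text \<open>The defining property of the kernel is an identity on rectangles. These form an
  intersection-stable generator, so it extends to the joint law, which is the mixture over \<nu> of
  the laws \<open>N w\<close> of \<open>(w, z)\<close> with \<open>z\<close> drawn from
  \<open>K w\<close>.\<close>

lemma nn_integral_disintegrate:
  assumes f[measurable]: "f \<in> borel_measurable (SW \<Otimes>\<^sub>M borel)"
  shows "(\<integral>\<^sup>+\<omega>. f (obs_W \<omega>, obs_Y \<omega>, obs_X \<omega>) \<partial>P0) = (\<integral>\<^sup>+w. \<integral>\<^sup>+z. f (w, z) \<partial>K w \<partial>\<nu>)"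
proof -
  define N where "N w = distr (K w) (SW \<Otimes>\<^sub>M borel) (Pair w)" for w
  have N[measurable]: "N \<in> measurable \<nu> (subprob_algebra (SW \<Otimes>\<^sub>M borel))"
    unfolding N_def[abs_def] by (rule measurable_distr2) measurable
  have nb: "(\<integral>\<^sup>+x. g x \<partial>(\<nu> \<bind> N)) = (\<integral>\<^sup>+w. \<integral>\<^sup>+z. g (w, z) \<partial>K w \<partial>\<nu>)"
    if g[measurable]: "g \<in> borel_measurable (SW \<Otimes>\<^sub>M borel)" for g
  proof -
    have "(\<integral>\<^sup>+x. g x \<partial>(\<nu> \<bind> N)) = (\<integral>\<^sup>+w. \<integral>\<^sup>+x. g x \<partial>N w \<partial>\<nu>)"
      by (rule nn_integral_bind) measurable
    also have "\<dots> = (\<integral>\<^sup>+w. \<integral>\<^sup>+z. g (w, z) \<partial>K w \<partial>\<nu>)"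
    proof (rule nn_integral_cong)
      fix w assume "w \<in> space \<nu>"
      then have w: "w \<in> space SW" "sets (K w) = sets borel" by (auto simp: space_restrict_space K_sets)
      have "Pair w \<in> measurable (K w) (SW \<Otimes>\<^sub>M borel)"
        unfolding measurable_cong_sets[OF w(2) refl] using w(1) by measurable
      then show "(\<integral>\<^sup>+x. g x \<partial>N w) = (\<integral>\<^sup>+z. g (w, z) \<partial>K w)"
        unfolding N_def by (rule nn_integral_distr) (simp add: g)
    qed
    finally show ?thesis .
  qed
  have "distr P0 (SW \<Otimes>\<^sub>M borel) (\<lambda>\<omega>. (obs_W \<omega>, obs_Y \<omega>, obs_X \<omega>)) = \<nu> \<bind> N"
  proof (rule measure_eqI_generator_eq[where A = "\<lambda>_. space SW \<times> UNIV" and \<Omega> = "space SW \<times> UNIV"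
        and E = "{a \<times> b |a b. a \<in> sets SW \<and> b \<in> sets borel}"])
    show "Int_stable {a \<times> b |a b. a \<in> sets SW \<and> b \<in> sets (borel :: (real \<times> real) measure)}"
      by (rule Int_stable_pair_measure_generator)
    show "{a \<times> b |a b. a \<in> sets SW \<and> b \<in> sets (borel :: (real \<times> real) measure)} \<subseteq> Pow (space SW \<times> UNIV)"
      using sets.sets_into_space by fastforce
    show "sets (distr P0 (SW \<Otimes>\<^sub>M borel) (\<lambda>\<omega>. (obs_W \<omega>, obs_Y \<omega>, obs_X \<omega>))) = sigma_sets (space SW \<times> UNIV) {a \<times> b |a b. a \<in> sets SW \<and> b \<in> sets borel}"
      by (simp add: sets_pair_measure)
    have "space \<nu> \<noteq> {}" by (rule \<nu>.not_empty)
    then have sb: "sets (\<nu> \<bind> N) = sets (SW \<Otimes>\<^sub>M borel)"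
      by (intro sets_bind) (auto simp: N_def)
    then show "sets (\<nu> \<bind> N) = sigma_sets (space SW \<times> UNIV) {a \<times> b |a b. a \<in> sets SW \<and> b \<in> sets borel}"
      by (simp add: sets_pair_measure)
    have "space SW \<in> sets SW" "UNIV \<in> sets (borel :: (real \<times> real) measure)" by simp_all
    then show "range (\<lambda>_::nat. space SW \<times> UNIV) \<subseteq> {a \<times> b |a b. a \<in> sets SW \<and> b \<in> sets (borel :: (real \<times> real) measure)}"
      by blast
    show "(\<Union>i::nat. space SW \<times> (UNIV :: (real \<times> real) set)) = space SW \<times> UNIV" by simp
    show "emeasure (distr P0 (SW \<Otimes>\<^sub>M borel) (\<lambda>\<omega>. (obs_W \<omega>, obs_Y \<omega>, obs_X \<omega>))) (space SW \<times> UNIV) \<noteq> \<infinity>"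
      using P0.emeasure_finite by (subst emeasure_distr) auto
    fix Z assume "Z \<in> {a \<times> b |a b. a \<in> sets SW \<and> b \<in> sets (borel :: (real \<times> real) measure)}"
    then obtain a and b :: "(real \<times> real) set" where Z: "Z = a \<times> b" and ab[measurable]: "a \<in> sets SW" "b \<in> sets borel" by auto
    have "emeasure (distr P0 (SW \<Otimes>\<^sub>M borel) (\<lambda>\<omega>. (obs_W \<omega>, obs_Y \<omega>, obs_X \<omega>))) Z
        = emeasure P0 {\<omega> \<in> space P0. (obs_Y \<omega>, obs_X \<omega>) \<in> b \<and> obs_W \<omega> \<in> a}"
      unfolding Z by (subst emeasure_distr) (auto intro!: arg_cong[where f = "emeasure P0"])
    also have "\<dots> = (\<integral>\<^sup>+ w \<in> a. emeasure (K w) b \<partial>\<nu>)"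
      using K ab unfolding is_cond_law_YX_def by blast
    also have "\<dots> = (\<integral>\<^sup>+w. \<integral>\<^sup>+z. indicator Z (w, z) \<partial>K w \<partial>\<nu>)"
    proof (rule nn_integral_cong)
      fix w assume "w \<in> space \<nu>"
      then have w: "sets (K w) = sets borel" by (simp add: K_sets)
      have "(\<integral>\<^sup>+z. indicator Z (w, z) \<partial>K w) = (\<integral>\<^sup>+z. indicator a w * indicator b z \<partial>K w)"
        unfolding Z by (intro nn_integral_cong) (auto simp: indicator_def)
      also have "\<dots> = indicator a w * (\<integral>\<^sup>+z. indicator b z \<partial>K w)"
        using w by (intro nn_integral_cmult borel_measurable_indicator) simp
      also have "\<dots> = emeasure (K w) b * indicator a w"
        using w by (simp add: mult.commute)
      finally show "emeasure (K w) b * indicator a w = (\<integral>\<^sup>+z. indicator Z (w, z) \<partial>K w)" by simp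
    qed
    also have "\<dots> = (\<integral>\<^sup>+x. indicator Z x \<partial>(\<nu> \<bind> N))"
      by (rule nb[symmetric]) (auto simp: Z)
    also have "\<dots> = emeasure (\<nu> \<bind> N) Z"
      using sb by (intro nn_integral_indicator) (auto simp: Z)
    finally show "emeasure (distr P0 (SW \<Otimes>\<^sub>M borel) (\<lambda>\<omega>. (obs_W \<omega>, obs_Y \<omega>, obs_X \<omega>))) Z = emeasure (\<nu> \<bind> N) Z" .
  qed
  then have "(\<integral>\<^sup>+x. f x \<partial>distr P0 (SW \<Otimes>\<^sub>M borel) (\<lambda>\<omega>. (obs_W \<omega>, obs_Y \<omega>, obs_X \<omega>))) = (\<integral>\<^sup>+w. \<integral>\<^sup>+z. f (w, z) \<partial>K w \<partial>\<nu>)"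
    using nb[OF f] by simp
  then show ?thesis by (subst (asm) nn_integral_distr) auto
qed

lemma nn_integral_K_measurable[measurable]:
  assumes f[measurable]: "f \<in> borel_measurable (SW \<Otimes>\<^sub>M borel)"
  shows "(\<lambda>w. \<integral>\<^sup>+z. f (w, z) \<partial>K w) \<in> borel_measurable \<nu>"
  by (rule nn_integral_measurable_subprob_algebra2[where N = borel]) measurable

text \<open>Turns an identity of expectations tested on all events of W into an identity under the
  kernel at almost every \<open>w\<close>: the two inner integrals are densities with respect to
  \<nu> of the same finite measure.\<close>

lemma AE_nn_integral_K_eqI:
  assumes f[measurable]: "f \<in> borel_measurable (SW \<Otimes>\<^sub>M borel)" and g[measurable]: "g \<in> borel_measurable (SW \<Otimes>\<^sub>M borel)"
    and eq: "\<And>B. B \<in> sets SW \<Longrightarrow>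
      (\<integral>\<^sup>+\<omega>. f (obs_W \<omega>, obs_Y \<omega>, obs_X \<omega>) * indicator B (obs_W \<omega>) \<partial>P0) =
      (\<integral>\<^sup>+\<omega>. g (obs_W \<omega>, obs_Y \<omega>, obs_X \<omega>) * indicator B (obs_W \<omega>) \<partial>P0)"
    and fin: "(\<integral>\<^sup>+\<omega>. f (obs_W \<omega>, obs_Y \<omega>, obs_X \<omega>) \<partial>P0) < \<infinity>"
  shows "AE w in \<nu>. (\<integral>\<^sup>+z. f (w, z) \<partial>K w) = (\<integral>\<^sup>+z. g (w, z) \<partial>K w)"
proof (rule finite_density_unique[THEN iffD1])
  have *: "(\<integral>\<^sup>+\<omega>. h (obs_W \<omega>, obs_Y \<omega>, obs_X \<omega>) * indicator B (obs_W \<omega>) \<partial>P0) = (\<integral>\<^sup>+w. (\<integral>\<^sup>+z. h (w, z) \<partial>K w) * indicator B w \<partial>\<nu>)"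
    if h[measurable]: "h \<in> borel_measurable (SW \<Otimes>\<^sub>M borel)" and B[measurable]: "B \<in> sets SW" for h B
  proof -
    have "(\<integral>\<^sup>+\<omega>. h (obs_W \<omega>, obs_Y \<omega>, obs_X \<omega>) * indicator B (obs_W \<omega>) \<partial>P0) = (\<integral>\<^sup>+w. \<integral>\<^sup>+z. h (w, z) * indicator B w \<partial>K w \<partial>\<nu>)"
      using nn_integral_disintegrate[of "\<lambda>x. h x * indicator B (fst x)"] by simp
    also have "\<dots> = (\<integral>\<^sup>+w. (\<integral>\<^sup>+z. h (w, z) \<partial>K w) * indicator B w \<partial>\<nu>)"
    proof (rule nn_integral_cong)
      fix w assume "w \<in> space \<nu>"
      then have w: "w \<in> space SW" "sets (K w) = sets borel" by (auto simp: K_sets space_restrict_space)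
      have "(\<lambda>z. h (w, z)) \<in> borel_measurable (K w)"
        unfolding measurable_cong_sets[OF w(2) refl] using w(1) by measurable
      then show "(\<integral>\<^sup>+z. h (w, z) * indicator B w \<partial>K w) = (\<integral>\<^sup>+z. h (w, z) \<partial>K w) * indicator B w"
        by (rule nn_integral_multc)
    qed
    finally show ?thesis .
  qed
  show "density \<nu> (\<lambda>w. \<integral>\<^sup>+z. f (w, z) \<partial>K w) = density \<nu> (\<lambda>w. \<integral>\<^sup>+z. g (w, z) \<partial>K w)"
  proof (rule measure_eqI)
    fix B assume "B \<in> sets (density \<nu> (\<lambda>w. \<integral>\<^sup>+z. f (w, z) \<partial>K w))"
    then have B: "B \<in> sets SW" by simp
    then show "emeasure (density \<nu> (\<lambda>w. \<integral>\<^sup>+z. f (w, z) \<partial>K w)) B = emeasure (density \<nu> (\<lambda>w. \<integral>\<^sup>+z. g (w, z) \<partial>K w)) B"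
      using eq[OF B] *[OF f B] *[OF g B] by (simp add: emeasure_density)
  qed simp
  show "(\<integral>\<^sup>+w. \<integral>\<^sup>+z. f (w, z) \<partial>K w \<partial>\<nu>) \<noteq> \<infinity>"
    using fin nn_integral_disintegrate[OF f] by simp
qed auto

lemma AE_nn_integral_K_finite:
  assumes f[measurable]: "f \<in> borel_measurable (SW \<Otimes>\<^sub>M borel)"
    and fin: "(\<integral>\<^sup>+\<omega>. f (obs_W \<omega>, obs_Y \<omega>, obs_X \<omega>) \<partial>P0) < \<infinity>"
  shows "AE w in \<nu>. (\<integral>\<^sup>+z. f (w, z) \<partial>K w) < \<infinity>"
proof -
  have "AE w in \<nu>. (\<integral>\<^sup>+z. f (w, z) \<partial>K w) \<noteq> \<infinity>"
    using fin nn_integral_disintegrate[OF f] by (intro nn_integral_PInf_AE) auto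
  then show ?thesis by eventually_elim (simp add: less_top)
qed

end

subsection \<open>Conditional moments in the partially linear model\<close>

lemma subalgebra_sigma_of:
  assumes "V \<in> borel_measurable P"
  shows "subalgebra P (sigma_of P V)"
  unfolding subalgebra_def sigma_of_def using assms by (auto dest: sets_image_in_sets[OF refl])

lemma measurable_sigma_of: "V \<in> borel_measurable (sigma_of P V)"
  unfolding sigma_of_def by (intro measurable_vimage_algebra1) auto

lemma space_sigma_of[simp]: "space (sigma_of P V) = space P"
  unfolding sigma_of_def by simp

locale plm = cond_law P0 YY XX WW K
  for P0 :: "'d::finite obs measure" and YY XX :: "real set" and WW :: "(real ^ 'd) set"
    and K :: "(real ^ 'd) \<Rightarrow> (real \<times> real) measure" +
  fixes m0 :: "'d fn_pair" and \<eta>0 :: "(real ^ 'd) \<Rightarrow> real" and \<beta>0 \<sigma>1 :: real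
  assumes m01: "is_regression P0 WW obs_Y (fst m0)"
    and m02: "is_regression P0 WW obs_X (snd m0)"
    and \<sigma>1_pos: "\<sigma>1 > 0" and \<eta>0: "\<eta>0 \<in> L2_W P0 WW"
    and plm_mean: "AE \<omega> in P0. real_cond_exp P0 (sigma_of P0 (\<lambda>\<omega>. (obs_X \<omega>, obs_W \<omega>))) obs_Y \<omega>
                     = obs_X \<omega> * \<beta>0 + \<eta>0 (obs_W \<omega>)"
    and plm_var: "AE \<omega> in P0. cond_var P0 (sigma_of P0 (\<lambda>\<omega>. (obs_X \<omega>, obs_W \<omega>))) obs_Y \<omega> = \<sigma>1\<^sup>2"
    and Y_mom: "(\<integral>\<^sup>+ \<omega>. ennreal ((obs_Y \<omega> - fst m0 (obs_W \<omega>))\<^sup>2) \<partial>P0) < \<infinity>"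
    and X_mom: "(\<integral>\<^sup>+ \<omega>. ennreal ((obs_X \<omega> - snd m0 (obs_W \<omega>)) ^ 4) \<partial>P0) < \<infinity>"
begin

definition "XW \<omega> = (obs_X \<omega>, obs_W \<omega>)"
abbreviation "FW \<equiv> sigma_of P0 obs_W"
abbreviation "FXW \<equiv> sigma_of P0 XW"

definition eX :: "'d obs \<Rightarrow> real" where "eX \<omega> = obs_X \<omega> - snd m0 (obs_W \<omega>)"
definition eU :: "'d obs \<Rightarrow> real" where "eU \<omega> = obs_Y \<omega> - fst m0 (obs_W \<omega>) - eX \<omega> * \<beta>0"

lemma m0_meas[measurable]: "fst m0 \<in> borel_measurable SW" "snd m0 \<in> borel_measurable SW"
  using m01 m02 unfolding is_regression_def by auto

lemma XW_meas[measurable]: "XW \<in> borel_measurable P0"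
  unfolding XW_def[abs_def] borel_prod[symmetric] by measurable

lemma eX_meas[measurable]: "eX \<in> borel_measurable P0" and eU_meas[measurable]: "eU \<in> borel_measurable P0"
  unfolding eX_def[abs_def] eU_def[abs_def] by measurable

lemma obs_W_FW: "obs_W \<in> measurable FW SW"
  by (intro measurable_restrict_space2 measurable_sigma_of) (auto simp: space_P0 obs_W_def)

lemma XW_FXW: "XW \<in> borel_measurable FXW"
  by (rule measurable_sigma_of)

lemma obs_X_FXW[measurable]: "obs_X \<in> borel_measurable FXW"
  using measurable_compose[OF XW_FXW[unfolded borel_prod[symmetric]] measurable_fst] by (simp add: XW_def)

lemma obs_W_FXW'[measurable]: "obs_W \<in> borel_measurable FXW"
  using measurable_compose[OF XW_FXW[unfolded borel_prod[symmetric]] measurable_snd] by (simp add: XW_def)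

lemma obs_W_FXW[measurable]: "obs_W \<in> measurable FXW SW"
  by (intro measurable_restrict_space2 obs_W_FXW') (auto simp: space_P0 obs_W_def)

lemma eX_FXW[measurable]: "eX \<in> borel_measurable FXW"
  unfolding eX_def[abs_def] by measurable

lemma subalg_FW: "subalgebra P0 FW" and subalg_FXW: "subalgebra P0 FXW"
  by (auto intro: subalgebra_sigma_of)

lemma subalg_FXW_FW: "subalgebra FXW FW"
  unfolding subalgebra_def using sets_image_in_sets[OF _ obs_W_FXW'] by (auto simp: sigma_of_def)

sublocale W: finite_measure_subalgebra P0 FW
  by standard (rule subalg_FW)

sublocale XW: finite_measure_subalgebra P0 FXW
  by standard (rule subalg_FXW)

lemma int_Y: "integrable P0 obs_Y" and int_X: "integrable P0 obs_X"
  using m01 m02 unfolding is_regression_def by auto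

lemma int_\<eta>0: "integrable P0 (\<lambda>\<omega>. \<eta>0 (obs_W \<omega>))"
proof (rule P0.square_integrable_imp_integrable)
  show "(\<lambda>\<omega>. \<eta>0 (obs_W \<omega>)) \<in> borel_measurable P0"
    using \<eta>0 measurable_compose[OF obs_W_measurable, of \<eta>0 borel] unfolding L2_W_def by auto
  show "integrable P0 (\<lambda>\<omega>. (\<eta>0 (obs_W \<omega>))\<^sup>2)" using \<eta>0 unfolding L2_W_def by auto
qed

lemma int_eX4: "integrable P0 (\<lambda>\<omega>. eX \<omega> ^ 4)"
  using X_mom by (intro integrableI_nonneg) (auto simp: eX_def)

lemma int_eX2: "integrable P0 (\<lambda>\<omega>. (eX \<omega>)\<^sup>2)"
  by (rule P0.square_integrable_imp_integrable) (use int_eX4 in \<open>auto simp: power_mult[symmetric]\<close>)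

lemma int_eU2: "integrable P0 (\<lambda>\<omega>. (eU \<omega>)\<^sup>2)"
proof (rule Bochner_Integration.integrable_bound)
  have "integrable P0 (\<lambda>\<omega>. (obs_Y \<omega> - fst m0 (obs_W \<omega>))\<^sup>2)"
    using Y_mom by (intro integrableI_nonneg) auto
  then show "integrable P0 (\<lambda>\<omega>. 2 * (obs_Y \<omega> - fst m0 (obs_W \<omega>))\<^sup>2 + 2 * \<beta>0\<^sup>2 * (eX \<omega>)\<^sup>2)"
    using int_eX2 by auto
  have "(a - b * c)\<^sup>2 \<le> 2 * a\<^sup>2 + 2 * c\<^sup>2 * b\<^sup>2" for a b c :: real
  proof -
    have "0 \<le> (a + b * c)\<^sup>2" by simp
    then show ?thesis by (simp add: power2_eq_square algebra_simps)
  qed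
  then show "AE \<omega> in P0. norm ((eU \<omega>)\<^sup>2) \<le> norm (2 * (obs_Y \<omega> - fst m0 (obs_W \<omega>))\<^sup>2 + 2 * \<beta>0\<^sup>2 * (eX \<omega>)\<^sup>2)"
    by (intro AE_I2) (auto simp: eU_def)
qed measurable

lemma int_eUeX: "integrable P0 (\<lambda>\<omega>. eU \<omega> * eX \<omega>)"
proof (rule Bochner_Integration.integrable_bound)
  show "integrable P0 (\<lambda>\<omega>. (eU \<omega>)\<^sup>2 + (eX \<omega>)\<^sup>2)" using int_eU2 int_eX2 by auto
  have "\<bar>a * b\<bar> \<le> a\<^sup>2 + b\<^sup>2" for a b :: real
  proof -
    have "0 \<le> (\<bar>a\<bar> - \<bar>b\<bar>)\<^sup>2" by simp
    then have "2 * (\<bar>a\<bar> * \<bar>b\<bar>) \<le> a\<^sup>2 + b\<^sup>2" by (simp add: power2_diff)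
    then show ?thesis using abs_mult[of a b] by (smt (verit) mult_nonneg_nonneg abs_ge_zero)
  qed
  then show "AE \<omega> in P0. norm (eU \<omega> * eX \<omega>) \<le> norm ((eU \<omega>)\<^sup>2 + (eX \<omega>)\<^sup>2)"
    by (intro AE_I2) auto
qed measurable

text \<open>Projecting the partially linear mean onto \<open>W\<close> identifies \<open>\<eta>0 = m01 - \<beta>0 m02\<close>.\<close>

lemma cond_exp_Y: "AE \<omega> in P0. real_cond_exp P0 FXW obs_Y \<omega> = fst m0 (obs_W \<omega>) + eX \<omega> * \<beta>0"
proof -
  have mean: "AE \<omega> in P0. real_cond_exp P0 FXW obs_Y \<omega> = \<beta>0 * obs_X \<omega> + \<eta>0 (obs_W \<omega>)"
    using plm_mean unfolding XW_def[abs_def] by (simp add: mult.commute)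
  have \<eta>m: "(\<lambda>\<omega>. \<eta>0 (obs_W \<omega>)) \<in> borel_measurable FW"
    using \<eta>0 measurable_compose[OF obs_W_FW, of \<eta>0 borel] unfolding L2_W_def by auto
  have 1: "AE \<omega> in P0. real_cond_exp P0 FW (real_cond_exp P0 FXW obs_Y) \<omega> = real_cond_exp P0 FW obs_Y \<omega>"
    by (rule W.real_cond_exp_nested_subalg[OF subalg_FXW subalg_FXW_FW int_Y])
  have 2: "AE \<omega> in P0. real_cond_exp P0 FW (real_cond_exp P0 FXW obs_Y) \<omega> = real_cond_exp P0 FW (\<lambda>\<omega>. \<beta>0 * obs_X \<omega> + \<eta>0 (obs_W \<omega>)) \<omega>"
    using int_\<eta>0 by (intro W.real_cond_exp_cong mean) auto
  have 3: "AE \<omega> in P0. real_cond_exp P0 FW (\<lambda>\<omega>. \<beta>0 * obs_X \<omega> + \<eta>0 (obs_W \<omega>)) \<omega>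
      = real_cond_exp P0 FW (\<lambda>\<omega>. \<beta>0 * obs_X \<omega>) \<omega> + real_cond_exp P0 FW (\<lambda>\<omega>. \<eta>0 (obs_W \<omega>)) \<omega>"
    using int_X int_\<eta>0 by (intro W.real_cond_exp_add) auto
  have 4: "AE \<omega> in P0. real_cond_exp P0 FW (\<lambda>\<omega>. \<beta>0 * obs_X \<omega>) \<omega> = \<beta>0 * real_cond_exp P0 FW obs_X \<omega>"
    by (rule W.real_cond_exp_cmult[OF int_X])
  have 5: "AE \<omega> in P0. real_cond_exp P0 FW (\<lambda>\<omega>. \<eta>0 (obs_W \<omega>)) \<omega> = \<eta>0 (obs_W \<omega>)"
    by (rule W.real_cond_exp_F_meas[OF int_\<eta>0 \<eta>m])
  have 6: "AE \<omega> in P0. fst m0 (obs_W \<omega>) = real_cond_exp P0 FW obs_Y \<omega>"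
    and 7: "AE \<omega> in P0. snd m0 (obs_W \<omega>) = real_cond_exp P0 FW obs_X \<omega>"
    using m01 m02 unfolding is_regression_def by auto
  from mean 1 2 3 4 5 6 7 show ?thesis
    by eventually_elim (simp add: eX_def algebra_simps)
qed

text \<open>\<open>real_cond_exp\<close> is built with \<open>enn2real\<close> and forgets infinite
  values, so almost sure finiteness is supplied to recover the extended-valued statement. That
  version can be multiplied by the square of \<open>eX\<close> before the product is known to be
  integrable.\<close>

lemma nn_cond_exp_eU2: "AE \<omega> in P0. nn_cond_exp P0 FXW (\<lambda>\<omega>. ennreal ((eU \<omega>)\<^sup>2)) \<omega> = ennreal (\<sigma>1\<^sup>2)"
proof -
  have 1: "AE \<omega> in P0. real_cond_exp P0 FXW (\<lambda>\<omega>. (obs_Y \<omega> - real_cond_exp P0 FXW obs_Y \<omega>)\<^sup>2) \<omega> = real_cond_exp P0 FXW (\<lambda>\<omega>. (eU \<omega>)\<^sup>2) \<omega>"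
  proof (intro XW.real_cond_exp_cong)
    show "AE \<omega> in P0. (obs_Y \<omega> - real_cond_exp P0 FXW obs_Y \<omega>)\<^sup>2 = (eU \<omega>)\<^sup>2"
      using cond_exp_Y by eventually_elim (simp add: eU_def diff_diff_eq)
  qed measurable
  have 2: "AE \<omega> in P0. real_cond_exp P0 FXW (\<lambda>\<omega>. (obs_Y \<omega> - real_cond_exp P0 FXW obs_Y \<omega>)\<^sup>2) \<omega> = \<sigma>1\<^sup>2"
    using plm_var unfolding cond_var_def XW_def[abs_def] .
  have 3: "AE \<omega> in P0. (\<lambda>_. 0) \<omega> = nn_cond_exp P0 FXW (\<lambda>_. 0) \<omega>"
    by (rule XW.nn_cond_exp_F_meas) simp
  have "(\<integral>\<^sup>+\<omega>. 1 * nn_cond_exp P0 FXW (\<lambda>\<omega>. ennreal ((eU \<omega>)\<^sup>2)) \<omega> \<partial>P0) = (\<integral>\<^sup>+\<omega>. 1 * ennreal ((eU \<omega>)\<^sup>2) \<partial>P0)"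
    by (rule XW.nn_cond_exp_intg) measurable
  also have "\<dots> < \<infinity>" using int_eU2 by (simp add: integrable_iff_bounded)
  finally have 4: "AE \<omega> in P0. nn_cond_exp P0 FXW (\<lambda>\<omega>. ennreal ((eU \<omega>)\<^sup>2)) \<omega> \<noteq> \<infinity>"
    by (intro nn_integral_PInf_AE) (auto simp: less_top)
  have neg: "(\<lambda>\<omega>. ennreal (- ((eU \<omega>)\<^sup>2))) = (\<lambda>_. 0)" by (auto simp: ennreal_neg)
  from 1 2 3 4 show ?thesis
  proof eventually_elim
    case (elim \<omega>)
    then have "enn2real (nn_cond_exp P0 FXW (\<lambda>\<omega>. ennreal ((eU \<omega>)\<^sup>2)) \<omega>) = \<sigma>1\<^sup>2"
      unfolding real_cond_exp_def neg by simp
    moreover have "ennreal (enn2real (nn_cond_exp P0 FXW (\<lambda>\<omega>. ennreal ((eU \<omega>)\<^sup>2)) \<omega>))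
        = nn_cond_exp P0 FXW (\<lambda>\<omega>. ennreal ((eU \<omega>)\<^sup>2)) \<omega>"
      using elim(4) by (intro ennreal_enn2real) (simp add: less_top)
    ultimately show ?case by simp
  qed
qed

text \<open>Given X and W the variance of \<open>eU\<close> is constant and \<open>eX\<close> can be
  taken out. Hence the products \<open>eU \<omega> * eX \<omega>\<close>, the summands of the score
  up to a constant, are square integrable as soon as \<open>eX\<close> is.\<close>

lemma nn_integral_eU2_eX2:
  assumes B[measurable]: "B \<in> sets SW"
  shows "(\<integral>\<^sup>+\<omega>. ennreal ((eU \<omega> * eX \<omega>)\<^sup>2) * indicator B (obs_W \<omega>) \<partial>P0)
       = (\<integral>\<^sup>+\<omega>. ennreal (\<sigma>1\<^sup>2 * (eX \<omega>)\<^sup>2) * indicator B (obs_W \<omega>) \<partial>P0)"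
proof -
  have "(\<integral>\<^sup>+\<omega>. ennreal ((eU \<omega> * eX \<omega>)\<^sup>2) * indicator B (obs_W \<omega>) \<partial>P0)
      = (\<integral>\<^sup>+\<omega>. (ennreal ((eX \<omega>)\<^sup>2) * indicator B (obs_W \<omega>)) * ennreal ((eU \<omega>)\<^sup>2) \<partial>P0)"
    by (intro nn_integral_cong) (simp add: power_mult_distrib ennreal_mult mult_ac)
  also have "\<dots> = (\<integral>\<^sup>+\<omega>. (ennreal ((eX \<omega>)\<^sup>2) * indicator B (obs_W \<omega>)) * nn_cond_exp P0 FXW (\<lambda>\<omega>. ennreal ((eU \<omega>)\<^sup>2)) \<omega> \<partial>P0)"
    by (rule XW.nn_cond_exp_intg[symmetric]) measurable
  also have "\<dots> = (\<integral>\<^sup>+\<omega>. ennreal (\<sigma>1\<^sup>2 * (eX \<omega>)\<^sup>2) * indicator B (obs_W \<omega>) \<partial>P0)"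
    using nn_cond_exp_eU2
    by (intro nn_integral_cong_AE) (auto elim!: eventually_mono simp: ennreal_mult mult_ac)
  finally show ?thesis .
qed

text \<open>Given X and W the error \<open>eU\<close> has mean zero, since \<open>R\<close> is the
  conditional mean of Y and itself a function of X and W. So the score is centred conditionally on
  W.\<close>

lemma integral_eU_eX:
  assumes B[measurable]: "B \<in> sets SW"
  shows "integrable P0 (\<lambda>\<omega>. eU \<omega> * eX \<omega> * indicator B (obs_W \<omega>))"
    and "(\<integral>\<omega>. eU \<omega> * eX \<omega> * indicator B (obs_W \<omega>) \<partial>P0) = 0"
proof -
  show i: "integrable P0 (\<lambda>\<omega>. eU \<omega> * eX \<omega> * indicator B (obs_W \<omega>))"
    by (rule Bochner_Integration.integrable_bound[OF int_eUeX]) (auto intro!: AE_I2 simp: indicator_def)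
  define R where "R \<omega> = fst m0 (obs_W \<omega>) + eX \<omega> * \<beta>0" for \<omega>
  have [measurable]: "R \<in> borel_measurable FXW" unfolding R_def by measurable
  have int_eU: "integrable P0 eU"
    by (rule P0.square_integrable_imp_integrable[OF eU_meas int_eU2])
  have eUR: "eU = (\<lambda>\<omega>. obs_Y \<omega> - R \<omega>)" by (auto simp: eU_def R_def)
  have R: "integrable P0 R"
    using Bochner_Integration.integrable_diff[OF int_Y int_eU] unfolding eUR by simp
  have "AE \<omega> in P0. real_cond_exp P0 FXW eU \<omega> = real_cond_exp P0 FXW obs_Y \<omega> - real_cond_exp P0 FXW R \<omega>"
    unfolding eUR by (rule XW.real_cond_exp_diff[OF int_Y R])
  moreover have "AE \<omega> in P0. real_cond_exp P0 FXW R \<omega> = R \<omega>"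
    by (rule XW.real_cond_exp_F_meas[OF R]) measurable
  ultimately have z: "AE \<omega> in P0. real_cond_exp P0 FXW eU \<omega> = 0"
    using cond_exp_Y by eventually_elim (simp add: R_def)
  have "(\<integral>\<omega>. eU \<omega> * eX \<omega> * indicator B (obs_W \<omega>) \<partial>P0) = (\<integral>\<omega>. (eX \<omega> * indicator B (obs_W \<omega>)) * eU \<omega> \<partial>P0)"
    by (simp add: mult_ac)
  also have "\<dots> = (\<integral>\<omega>. (eX \<omega> * indicator B (obs_W \<omega>)) * real_cond_exp P0 FXW eU \<omega> \<partial>P0)"
    by (rule XW.real_cond_exp_intg(2)[symmetric]) (use i in \<open>auto simp: mult_ac\<close>)
  also have "\<dots> = (\<integral>\<omega>. 0 \<partial>P0)"
    using z by (intro integral_cong_AE) (auto elim!: eventually_mono)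
  finally show "(\<integral>\<omega>. eU \<omega> * eX \<omega> * indicator B (obs_W \<omega>) \<partial>P0) = 0" by simp
qed

end

section \<open>Residual moments under the conditional law at a fixed covariate value\<close>

context plm
begin

definition eK :: "real ^ 'd \<Rightarrow> real \<times> real \<Rightarrow> real" where "eK w z = snd z - snd m0 w"
definition uK :: "real ^ 'd \<Rightarrow> real \<times> real \<Rightarrow> real" where "uK w z = fst z - fst m0 w - eK w z * \<beta>0"
text \<open>For almost every \<open>w\<close> this is the conditional variance of X.
  \<open>enn2real\<close> keeps \<open>vW\<close> and \<open>qW\<close> real-valued everywhere:
  infinite moments, which occur only on a null set, become 0.\<close>

definition vW :: "real ^ 'd \<Rightarrow> real" where "vW w = enn2real (\<integral>\<^sup>+z. ennreal ((eK w z)\<^sup>2) \<partial>K w)"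
definition qW :: "real ^ 'd \<Rightarrow> real" where "qW w = enn2real (\<integral>\<^sup>+z. ennreal (eK w z ^ 4) \<partial>K w)"

lemma eK_pair_meas[measurable]: "(\<lambda>p. eK (fst p) (snd p)) \<in> borel_measurable (SW \<Otimes>\<^sub>M borel)"
  unfolding eK_def borel_prod[symmetric] by measurable

lemma uK_pair_meas[measurable]: "(\<lambda>p. uK (fst p) (snd p)) \<in> borel_measurable (SW \<Otimes>\<^sub>M borel)"
proof -
  have "(\<lambda>p. fst (snd p) - fst m0 (fst p)) \<in> borel_measurable (SW \<Otimes>\<^sub>M borel :: ((real ^ 'd) \<times> real \<times> real) measure)"
    unfolding borel_prod[symmetric] by measurable
  then show ?thesis unfolding uK_def by measurable
qed

lemma eK_meas: "eK w \<in> borel_measurable borel" and uK_meas: "uK w \<in> borel_measurable borel"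
  unfolding eK_def[abs_def] uK_def[abs_def] borel_prod[symmetric] by measurable

lemma eK_obs: "eK (obs_W \<omega>) (obs_Y \<omega>, obs_X \<omega>) = eX \<omega>" and uK_obs: "uK (obs_W \<omega>) (obs_Y \<omega>, obs_X \<omega>) = eU \<omega>"
  by (simp_all add: eK_def uK_def eX_def eU_def)

lemma vW_meas[measurable]: "vW \<in> borel_measurable \<nu>" and qW_meas[measurable]: "qW \<in> borel_measurable \<nu>"
  unfolding vW_def[abs_def] qW_def[abs_def]
  using nn_integral_K_measurable[of "\<lambda>p. ennreal ((eK (fst p) (snd p))\<^sup>2)"]
    nn_integral_K_measurable[of "\<lambda>p. ennreal ((eK (fst p) (snd p)) ^ 4)"] by simp_all

lemma vW_nonneg: "0 \<le> vW w" and qW_nonneg: "0 \<le> qW w"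
  by (simp_all add: vW_def qW_def)

text \<open>A kernel is determined by \<open>P0\<close> only up to a null set of \<open>w\<close>,
  so the conditional moment identities hold only almost everywhere. Bundling them lets a covariate
  sequence be required to satisfy them at every index.\<close>

definition good :: "real ^ 'd \<Rightarrow> bool" where
  "good w \<longleftrightarrow> w \<in> WW \<and> integrable (K w) (\<lambda>z. eK w z ^ 4) \<and> integrable (K w) (\<lambda>z. (eK w z)\<^sup>2) \<and>
     (\<integral>z. (eK w z)\<^sup>2 \<partial>K w) = vW w \<and> (\<integral>z. eK w z ^ 4 \<partial>K w) = qW w \<and>
     integrable (K w) (\<lambda>z. (uK w z * eK w z)\<^sup>2) \<and> (\<integral>z. (uK w z * eK w z)\<^sup>2 \<partial>K w) = \<sigma>1\<^sup>2 * vW w \<and>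
     (\<integral>z. uK w z * eK w z \<partial>K w) = 0"

lemma AE_good: "AE w in \<nu>. good w"
proof -
  have fin: "(\<integral>\<^sup>+\<omega>. ennreal (eX \<omega> ^ 4) \<partial>P0) < \<infinity>" "(\<integral>\<^sup>+\<omega>. ennreal ((eX \<omega>)\<^sup>2) \<partial>P0) < \<infinity>"
    using int_eX4 int_eX2 by (simp_all add: integrable_iff_bounded)
  have sU: "(\<integral>\<^sup>+\<omega>. ennreal ((eU \<omega> * eX \<omega>)\<^sup>2) \<partial>P0) < \<infinity>"
  proof -
    have "(\<integral>\<^sup>+\<omega>. ennreal ((eU \<omega> * eX \<omega>)\<^sup>2) \<partial>P0) = (\<integral>\<^sup>+\<omega>. ennreal ((eU \<omega> * eX \<omega>)\<^sup>2) * indicator (space SW) (obs_W \<omega>) \<partial>P0)"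
      using measurable_space[OF obs_W_measurable] by (intro nn_integral_cong) auto
    also have "\<dots> = (\<integral>\<^sup>+\<omega>. ennreal (\<sigma>1\<^sup>2 * (eX \<omega>)\<^sup>2) * indicator (space SW) (obs_W \<omega>) \<partial>P0)"
      by (rule nn_integral_eU2_eX2) auto
    also have "\<dots> = (\<integral>\<^sup>+\<omega>. ennreal (\<sigma>1\<^sup>2 * (eX \<omega>)\<^sup>2) \<partial>P0)"
      using measurable_space[OF obs_W_measurable] by (intro nn_integral_cong) auto
    also have "\<dots> < \<infinity>"
      by (subst nn_integral_eq_integral) (use integrable_mult_right[OF int_eX2] in auto)
    finally show ?thesis .
  qed
  have 1: "AE w in \<nu>. (\<integral>\<^sup>+z. ennreal (eK w z ^ 4) \<partial>K w) < \<infinity>"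
    using AE_nn_integral_K_finite[of "\<lambda>p. ennreal (eK (fst p) (snd p) ^ 4)"] fin by (simp add: eK_obs)
  have 2: "AE w in \<nu>. (\<integral>\<^sup>+z. ennreal ((eK w z)\<^sup>2) \<partial>K w) < \<infinity>"
    using AE_nn_integral_K_finite[of "\<lambda>p. ennreal ((eK (fst p) (snd p))\<^sup>2)"] fin by (simp add: eK_obs)
  have 3: "AE w in \<nu>. (\<integral>\<^sup>+z. ennreal ((uK w z * eK w z)\<^sup>2) \<partial>K w) = (\<integral>\<^sup>+z. ennreal (\<sigma>1\<^sup>2 * (eK w z)\<^sup>2) \<partial>K w)"
    using AE_nn_integral_K_eqI[of "\<lambda>p. ennreal ((uK (fst p) (snd p) * eK (fst p) (snd p))\<^sup>2)"
        "\<lambda>p. ennreal (\<sigma>1\<^sup>2 * (eK (fst p) (snd p))\<^sup>2)"] nn_integral_eU2_eX2 sU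
    by (simp add: eK_obs uK_obs)
  \<comment> \<open>Kernel identities are available for nonnegative functions only, so the vanishing
    of a signed mean is expressed as equality of positive and negative part; \<open>ennreal\<close>
    truncates negative numbers to 0.\<close>
  have 4: "AE w in \<nu>. (\<integral>\<^sup>+z. ennreal (uK w z * eK w z) \<partial>K w) = (\<integral>\<^sup>+z. ennreal (- (uK w z * eK w z)) \<partial>K w)"
  proof -
    have eq: "(\<integral>\<^sup>+\<omega>. ennreal (eU \<omega> * eX \<omega>) * indicator B (obs_W \<omega>) \<partial>P0) =
       (\<integral>\<^sup>+\<omega>. ennreal (- (eU \<omega> * eX \<omega>)) * indicator B (obs_W \<omega>) \<partial>P0)" if B: "B \<in> sets SW" for B
    proof -
      define g where "g \<omega> = eU \<omega> * eX \<omega> * indicator B (obs_W \<omega>)" for \<omega>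
      have g: "integrable P0 g" "integral\<^sup>L P0 g = 0" unfolding g_def using integral_eU_eX[OF B] by auto
      have f1: "(\<integral>\<^sup>+\<omega>. ennreal (g \<omega>) \<partial>P0) \<noteq> \<infinity>" and f2: "(\<integral>\<^sup>+\<omega>. ennreal (- g \<omega>) \<partial>P0) \<noteq> \<infinity>"
        using g(1) by (auto simp: real_integrable_def)
      have "enn2real (\<integral>\<^sup>+\<omega>. ennreal (g \<omega>) \<partial>P0) = enn2real (\<integral>\<^sup>+\<omega>. ennreal (- g \<omega>) \<partial>P0)"
        using g real_lebesgue_integral_def[OF g(1)] by simp
      moreover have "ennreal (enn2real (\<integral>\<^sup>+\<omega>. ennreal (g \<omega>) \<partial>P0)) = (\<integral>\<^sup>+\<omega>. ennreal (g \<omega>) \<partial>P0)"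
        using f1 by (intro ennreal_enn2real) (simp add: less_top)
      moreover have "ennreal (enn2real (\<integral>\<^sup>+\<omega>. ennreal (- g \<omega>) \<partial>P0)) = (\<integral>\<^sup>+\<omega>. ennreal (- g \<omega>) \<partial>P0)"
        using f2 by (intro ennreal_enn2real) (simp add: less_top)
      ultimately have "(\<integral>\<^sup>+\<omega>. ennreal (g \<omega>) \<partial>P0) = (\<integral>\<^sup>+\<omega>. ennreal (- g \<omega>) \<partial>P0)"
        by metis
      moreover have "ennreal (g \<omega>) = ennreal (eU \<omega> * eX \<omega>) * indicator B (obs_W \<omega>)"
        "ennreal (- g \<omega>) = ennreal (- (eU \<omega> * eX \<omega>)) * indicator B (obs_W \<omega>)" for \<omega>
        by (auto simp: g_def indicator_def)
      ultimately show ?thesis by simp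
    qed
    have "(\<integral>\<^sup>+\<omega>. ennreal (eU \<omega> * eX \<omega>) \<partial>P0) < \<infinity>"
      using int_eUeX by (auto simp: real_integrable_def less_top)
    then show ?thesis
      using AE_nn_integral_K_eqI[of "\<lambda>p. ennreal (uK (fst p) (snd p) * eK (fst p) (snd p))"
        "\<lambda>p. ennreal (- (uK (fst p) (snd p) * eK (fst p) (snd p)))"] eq
      by (simp add: eK_obs uK_obs)
  qed
  from 1 2 3 4 AE_space show ?thesis
  proof eventually_elim
    case (elim w)
    then have w: "w \<in> WW" by simp
    interpret Kw: prob_space "K w" by (rule K_prob[OF w])
    have [measurable]: "eK w \<in> borel_measurable (K w)" "uK w \<in> borel_measurable (K w)"
      using eK_meas uK_meas unfolding measurable_cong_sets[OF K_sets[OF w] refl] by auto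
    have i4: "integrable (K w) (\<lambda>z. eK w z ^ 4)" and i2: "integrable (K w) (\<lambda>z. (eK w z)\<^sup>2)"
      using elim by (auto intro!: integrableI_nonneg)
    have v: "(\<integral>z. (eK w z)\<^sup>2 \<partial>K w) = vW w" and q: "(\<integral>z. eK w z ^ 4 \<partial>K w) = qW w"
      unfolding vW_def qW_def by (auto intro!: integral_eq_nn_integral)
    have s2: "(\<integral>\<^sup>+z. ennreal ((uK w z * eK w z)\<^sup>2) \<partial>K w) = ennreal (\<sigma>1\<^sup>2 * vW w)"
      using elim(3) integrable_mult_right[OF i2, of "\<sigma>1\<^sup>2"] v by (subst (asm) nn_integral_eq_integral) auto
    have iu: "integrable (K w) (\<lambda>z. (uK w z * eK w z)\<^sup>2)"
      using s2 by (intro integrableI_nonneg) auto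
    have su: "(\<integral>z. (uK w z * eK w z)\<^sup>2 \<partial>K w) = \<sigma>1\<^sup>2 * vW w"
      using s2 vW_nonneg[of w] by (subst integral_eq_nn_integral) auto
    have "integrable (K w) (\<lambda>z. uK w z * eK w z)"
      by (rule Kw.square_integrable_imp_integrable[OF _ iu]) measurable
    then have "(\<integral>z. uK w z * eK w z \<partial>K w) = 0"
      using elim(4) by (simp add: real_lebesgue_integral_def)
    then show ?case unfolding good_def using w i4 i2 v q iu su by simp
  qed
qed

text \<open>The conditional variance of the squared residual is nonnegative. This makes
  \<open>vW\<close> square integrable, as the strong law for its averages requires.\<close>

lemma vW_square_le: "good w \<Longrightarrow> (vW w)\<^sup>2 \<le> qW w"
proof -
  assume g: "good w"
  interpret Kw: prob_space "K w" using g by (intro K_prob) (simp add: good_def)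
  have "0 \<le> Kw.variance (\<lambda>z. (eK w z)\<^sup>2)" by (rule Kw.variance_positive)
  also have "\<dots> = qW w - (vW w)\<^sup>2"
    using g unfolding good_def by (subst Kw.variance_eq) (auto simp: power_mult[symmetric])
  finally show ?thesis by simp
qed

lemma integrable_qW: "integrable \<nu> qW"
proof (rule integrableI_nonneg)
  have "(\<integral>\<^sup>+w. ennreal (qW w) \<partial>\<nu>) \<le> (\<integral>\<^sup>+w. \<integral>\<^sup>+z. ennreal (eK w z ^ 4) \<partial>K w \<partial>\<nu>)"
  proof (rule nn_integral_mono)
    have "ennreal (enn2real x) \<le> x" for x by (cases x) auto
    then show "ennreal (qW w) \<le> (\<integral>\<^sup>+z. ennreal (eK w z ^ 4) \<partial>K w)" for w unfolding qW_def .
  qed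
  also have "\<dots> = (\<integral>\<^sup>+\<omega>. ennreal (eX \<omega> ^ 4) \<partial>P0)"
    using nn_integral_disintegrate[of "\<lambda>p. ennreal (eK (fst p) (snd p) ^ 4)"] by (simp add: eK_obs)
  also have "\<dots> < \<infinity>" using int_eX4 by (simp add: integrable_iff_bounded)
  finally show "(\<integral>\<^sup>+w. ennreal (qW w) \<partial>\<nu>) < \<infinity>" .
qed (auto simp: qW_nonneg)

lemma integrable_vW2: "integrable \<nu> (\<lambda>w. (vW w)\<^sup>2)"
proof (rule Bochner_Integration.integrable_bound[OF integrable_qW])
  show "AE w in \<nu>. norm ((vW w)\<^sup>2) \<le> norm (qW w)"
    using AE_good by eventually_elim (simp add: vW_square_le qW_nonneg)
qed measurable

text \<open>Identifies the almost sure limit of the averages of \<open>vW\<close> with the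
  unconditional second moment of the X error.\<close>

lemma integral_vW: "(\<integral>w. vW w \<partial>\<nu>) = (\<integral>\<omega>. (eX \<omega>)\<^sup>2 \<partial>P0)"
proof -
  have fin: "(\<integral>\<^sup>+\<omega>. ennreal ((eX \<omega>)\<^sup>2) \<partial>P0) < \<infinity>"
    using int_eX2 by (simp add: integrable_iff_bounded)
  have "AE w in \<nu>. (\<integral>\<^sup>+z. ennreal ((eK w z)\<^sup>2) \<partial>K w) < \<infinity>"
    using AE_nn_integral_K_finite[of "\<lambda>p. ennreal ((eK (fst p) (snd p))\<^sup>2)"] fin by (simp add: eK_obs)
  then have "(\<integral>\<^sup>+w. ennreal (vW w) \<partial>\<nu>) = (\<integral>\<^sup>+w. \<integral>\<^sup>+z. ennreal ((eK w z)\<^sup>2) \<partial>K w \<partial>\<nu>)"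
    unfolding vW_def by (intro nn_integral_cong_AE) (auto elim!: eventually_mono)
  also have "\<dots> = (\<integral>\<^sup>+\<omega>. ennreal ((eX \<omega>)\<^sup>2) \<partial>P0)"
    using nn_integral_disintegrate[of "\<lambda>p. ennreal ((eK (fst p) (snd p))\<^sup>2)"] by (simp add: eK_obs)
  finally show ?thesis
    by (subst (1 2) integral_eq_nn_integral) (auto simp: vW_nonneg)
qed

text \<open>Up to powers of \<sigma>1, the average of \<open>vW\<close> is both the centre of the
  information and the variance of the rescaled score, while the normalised sum of \<open>qW\<close>
  bounds the variance of the information.\<close>

definition typical :: "(nat \<Rightarrow> real ^ 'd) \<Rightarrow> bool" where
  "typical w \<longleftrightarrow> (\<forall>i. good (w i)) \<and>
     (\<lambda>n. (\<Sum>i<n. vW (w i)) / real n) \<longlonglongrightarrow> (\<integral>\<omega>. (eX \<omega>)\<^sup>2 \<partial>P0) \<and>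
     (\<lambda>n. (\<Sum>i<n. qW (w i)) / (real n)\<^sup>2) \<longlonglongrightarrow> 0"

lemma AE_typical: "AE w in Pi\<^sub>M UNIV (\<lambda>_::nat. \<nu>). typical w"
proof -
  have "AE w in Pi\<^sub>M UNIV (\<lambda>_::nat. \<nu>). \<forall>i. good (w i)"
    unfolding AE_all_countable
    by (intro allI AE_PiM_component[where P = good] AE_good \<nu>.prob_space_axioms) auto
  moreover have "AE w in Pi\<^sub>M UNIV (\<lambda>_::nat. \<nu>). (\<lambda>n. (\<Sum>i<n. vW (w i)) / real n) \<longlonglongrightarrow> (\<integral>w. vW w \<partial>\<nu>)"
    by (rule \<nu>.AE_PiM_average_tendsto[OF vW_meas vW_nonneg integrable_vW2])
  moreover have "AE w in Pi\<^sub>M UNIV (\<lambda>_::nat. \<nu>). (\<lambda>n. (\<Sum>i<n. qW (w i)) / (real n)\<^sup>2) \<longlonglongrightarrow> 0"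
    by (rule \<nu>.AE_PiM_sum_over_square_tendsto_0[OF integrable_qW qW_nonneg])
  ultimately show ?thesis
    unfolding integral_vW by eventually_elim (simp add: typical_def)
qed

end

subsection \<open>Perturbation of score and information\<close>

lemma sum_squares_le_of_emp_norm:
  assumes n: "0 < n" and le: "emp_norm n w f < r"
  shows "(\<Sum>i<n. (f (w i))\<^sup>2) \<le> real n * r\<^sup>2"
proof -
  have "sqrt ((\<Sum>i<n. (f (w i))\<^sup>2) / real n) \<le> r" using le unfolding emp_norm_def by simp
  then have "(\<Sum>i<n. (f (w i))\<^sup>2) / real n \<le> r\<^sup>2" by (rule sqrt_le_D)
  then show ?thesis using n by (simp add: field_simps)
qed

text \<open>Passing from \<open>m0\<close> to \<open>m\<close> shifts the residuals by
  \<open>a\<close> and \<open>b\<close>. In the expanded score the terms linear in the shifts are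
  exactly \<open>G1\<close> and \<open>G2\<close>; the products of two shifts are of order
  \<open>sqrt n * r\<^sup>2\<close>, which is why the radius must be below the order
  \<open>n^(-1/4)\<close>. The linear term of the information carries no factor
  \<open>sqrt n\<close> and is of order \<open>r\<close>.\<close>

lemma score_tilde_I_tilde_perturb:
  assumes n: "0 < n" and \<sigma>1: "0 < \<sigma>1" and m: "m \<in> B_nbhd n w MM m0 r"
  shows "\<bar>score_tilde \<sigma>1 \<beta>0 m n yx w / sqrt n - score_tilde \<sigma>1 \<beta>0 m0 n yx w / sqrt n\<bar>
      \<le> (\<bar>G1 m0 n yx w m\<bar> + \<bar>G2 \<beta>0 m0 n yx w m\<bar> + (1 + \<bar>\<beta>0\<bar>) * (sqrt n * r\<^sup>2)) / \<sigma>1\<^sup>2"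
    and "\<bar>I_tilde \<sigma>1 m n yx w - I_tilde \<sigma>1 m0 n yx w\<bar>
      \<le> r * I_tilde \<sigma>1 m0 n yx w + (r + r\<^sup>2) / \<sigma>1\<^sup>2"
proof -
  define a where "a i = fst m (w i) - fst m0 (w i)" for i
  define b where "b i = snd m (w i) - snd m0 (w i)" for i
  define e where "e i = snd (yx i) - snd m0 (w i)" for i
  define u where "u i = fst (yx i) - fst m0 (w i) - e i * \<beta>0" for i
  have na: "emp_norm n w (\<lambda>v. fst m v - fst m0 v) < r" and nb: "emp_norm n w (\<lambda>v. snd m v - snd m0 v) < r"
    using m by (auto simp: B_nbhd_def)
  have a2: "(\<Sum>i<n. (a i)\<^sup>2) \<le> n * r\<^sup>2" and b2: "(\<Sum>i<n. (b i)\<^sup>2) \<le> n * r\<^sup>2"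
    unfolding a_def b_def using sum_squares_le_of_emp_norm[OF n na] sum_squares_le_of_emp_norm[OF n nb] by auto
  \<comment> \<open>Membership in the neighbourhood forces a positive radius, the norm being
    nonnegative; \<open>r\<close> becomes a divisor in the information bound.\<close>
  have r: "0 < r" using nb by (rule le_less_trans[rotated]) (simp add: emp_norm_def sum_nonneg)
  have s: "0 < sqrt n" using n by simp
  have sn: "real n / sqrt n = sqrt n" by (simp add: real_div_sqrt)
  have ab: "\<bar>\<Sum>i<n. a i * b i\<bar> \<le> n * r\<^sup>2"
  proof -
    have "\<bar>x * y\<bar> \<le> (x\<^sup>2 + y\<^sup>2) / 2" for x y :: real
    proof -
      have "0 \<le> (\<bar>x\<bar> - \<bar>y\<bar>)\<^sup>2" by simp
      then show ?thesis by (simp add: power2_diff abs_mult)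
    qed
    then have "\<bar>\<Sum>i<n. a i * b i\<bar> \<le> (\<Sum>i<n. ((a i)\<^sup>2 + (b i)\<^sup>2) / 2)"
      by (intro order_trans[OF sum_abs] sum_mono)
    also have "\<dots> = ((\<Sum>i<n. (a i)\<^sup>2) + (\<Sum>i<n. (b i)\<^sup>2)) / 2"
      by (simp add: sum.distrib sum_divide_distrib add_divide_distrib)
    also have "\<dots> \<le> n * r\<^sup>2" using a2 b2 by simp
    finally show ?thesis .
  qed
  have score: "score_tilde \<sigma>1 \<beta>0 m n yx w = 1 / \<sigma>1\<^sup>2 * (\<Sum>i<n. (u i - a i + \<beta>0 * b i) * (e i - b i))"
    unfolding score_tilde_def a_def b_def e_def u_def by (intro arg_cong2[where f = "(*)"] sum.cong refl) (auto simp: algebra_simps)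
  have score0: "score_tilde \<sigma>1 \<beta>0 m0 n yx w = 1 / \<sigma>1\<^sup>2 * (\<Sum>i<n. u i * e i)"
    unfolding score_tilde_def e_def u_def by simp
  have "(\<Sum>i<n. (u i - a i + \<beta>0 * b i) * (e i - b i)) =
     (\<Sum>i<n. u i * e i + (- (e i * a i) - (u i - \<beta>0 * e i) * b i + a i * b i - \<beta>0 * (b i)\<^sup>2))"
    by (intro sum.cong refl) (simp add: algebra_simps power2_eq_square)
  also have "\<dots> = (\<Sum>i<n. u i * e i) + (- (\<Sum>i<n. e i * a i) - (\<Sum>i<n. (u i - \<beta>0 * e i) * b i)
      + (\<Sum>i<n. a i * b i) - \<beta>0 * (\<Sum>i<n. (b i)\<^sup>2))"
    by (simp only: sum.distrib sum_subtractf sum_negf sum_distrib_left)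
  finally have dec: "(\<Sum>i<n. (u i - a i + \<beta>0 * b i) * (e i - b i)) = \<dots>" .
  have G1: "(\<Sum>i<n. e i * a i) / sqrt n = G1 m0 n yx w m"
    unfolding G1_def eps2_def e_def a_def by simp
  have G2: "(\<Sum>i<n. (u i - \<beta>0 * e i) * b i) / sqrt n = G2 \<beta>0 m0 n yx w m"
    unfolding G2_def eps2_def U_res_def u_def e_def b_def by simp
  have eq: "score_tilde \<sigma>1 \<beta>0 m n yx w / sqrt n - score_tilde \<sigma>1 \<beta>0 m0 n yx w / sqrt n
      = (- G1 m0 n yx w m - G2 \<beta>0 m0 n yx w m + (\<Sum>i<n. a i * b i) / sqrt n - \<beta>0 * (\<Sum>i<n. (b i)\<^sup>2) / sqrt n) / \<sigma>1\<^sup>2"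
    unfolding score score0 dec G1[symmetric] G2[symmetric] by (simp add: add_divide_distrib diff_divide_distrib mult.commute)
  have p1: "\<bar>(\<Sum>i<n. a i * b i) / sqrt n\<bar> \<le> sqrt n * r\<^sup>2"
  proof -
    have "\<bar>(\<Sum>i<n. a i * b i) / sqrt n\<bar> \<le> real n * r\<^sup>2 / sqrt n"
      using ab s by (simp add: divide_right_mono)
    also have "\<dots> = (real n / sqrt n) * r\<^sup>2" by simp
    finally show ?thesis unfolding sn .
  qed
  have p2: "\<bar>\<beta>0 * (\<Sum>i<n. (b i)\<^sup>2) / sqrt n\<bar> \<le> \<bar>\<beta>0\<bar> * (sqrt n * r\<^sup>2)"
  proof -
    have "\<bar>\<beta>0 * (\<Sum>i<n. (b i)\<^sup>2) / sqrt n\<bar> = \<bar>\<beta>0\<bar> * ((\<Sum>i<n. (b i)\<^sup>2) / sqrt n)"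
      using s by (simp add: abs_mult sum_nonneg)
    also have "\<dots> \<le> \<bar>\<beta>0\<bar> * (real n * r\<^sup>2 / sqrt n)"
      using b2 s by (intro mult_left_mono divide_right_mono) auto
    also have "\<dots> = \<bar>\<beta>0\<bar> * ((real n / sqrt n) * r\<^sup>2)" by simp
    finally show ?thesis unfolding sn .
  qed
  have "(1 + \<bar>\<beta>0\<bar>) * (sqrt n * r\<^sup>2) = sqrt n * r\<^sup>2 + \<bar>\<beta>0\<bar> * (sqrt n * r\<^sup>2)"
    by (simp add: algebra_simps)
  then have "\<bar>- G1 m0 n yx w m - G2 \<beta>0 m0 n yx w m + (\<Sum>i<n. a i * b i) / sqrt n - \<beta>0 * (\<Sum>i<n. (b i)\<^sup>2) / sqrt n\<bar>
      \<le> \<bar>G1 m0 n yx w m\<bar> + \<bar>G2 \<beta>0 m0 n yx w m\<bar> + (1 + \<bar>\<beta>0\<bar>) * (sqrt n * r\<^sup>2)"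
    using p1 p2 by linarith
  then show "\<bar>score_tilde \<sigma>1 \<beta>0 m n yx w / sqrt n - score_tilde \<sigma>1 \<beta>0 m0 n yx w / sqrt n\<bar>
      \<le> (\<bar>G1 m0 n yx w m\<bar> + \<bar>G2 \<beta>0 m0 n yx w m\<bar> + (1 + \<bar>\<beta>0\<bar>) * (sqrt n * r\<^sup>2)) / \<sigma>1\<^sup>2"
    unfolding eq abs_divide abs_power2 by (rule divide_right_mono) simp
  have I: "I_tilde \<sigma>1 m n yx w = (\<Sum>i<n. (e i - b i)\<^sup>2) / (n * \<sigma>1\<^sup>2)"
    unfolding I_tilde_def e_def b_def by (simp add: power_divide sum_divide_distrib[symmetric])
  have I0: "I_tilde \<sigma>1 m0 n yx w = (\<Sum>i<n. (e i)\<^sup>2) / (n * \<sigma>1\<^sup>2)"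
    unfolding I_tilde_def e_def by (simp add: power_divide sum_divide_distrib[symmetric])
  have "\<bar>(\<Sum>i<n. (e i - b i)\<^sup>2) - (\<Sum>i<n. (e i)\<^sup>2)\<bar> \<le> (\<Sum>i<n. \<bar>(e i - b i)\<^sup>2 - (e i)\<^sup>2\<bar>)"
    unfolding sum_subtractf[symmetric] by (rule sum_abs)
  also have "\<dots> \<le> (\<Sum>i<n. r * (e i)\<^sup>2 + (1 / r + 1) * (b i)\<^sup>2)"
  proof (rule sum_mono)
    fix i
    \<comment> \<open>Young's inequality with weight \<open>r\<close>: the squares of the
      \<open>b i\<close> sum to at most \<open>n * r\<^sup>2\<close>, so after division by
      \<open>r\<close> both resulting terms are of order \<open>r\<close> per observation.\<close>
    have "0 \<le> (r * \<bar>e i\<bar> - \<bar>b i\<bar>)\<^sup>2" by simp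
    then have "2 * r * (\<bar>e i\<bar> * \<bar>b i\<bar>) \<le> r * (r * (e i)\<^sup>2) + (b i)\<^sup>2"
      by (simp add: power2_diff power_mult_distrib) (simp add: power2_eq_square)
    then have "2 * (\<bar>e i\<bar> * \<bar>b i\<bar>) \<le> r * (e i)\<^sup>2 + (b i)\<^sup>2 / r"
      using r by (simp add: field_simps)
    then have "\<bar>2 * (e i * b i)\<bar> \<le> r * (e i)\<^sup>2 + (b i)\<^sup>2 / r" by (simp add: abs_mult)
    moreover have "(e i - b i)\<^sup>2 - (e i)\<^sup>2 = (b i)\<^sup>2 - 2 * (e i * b i)" by (simp add: power2_diff)
    ultimately have "\<bar>(e i - b i)\<^sup>2 - (e i)\<^sup>2\<bar> \<le> (b i)\<^sup>2 + (r * (e i)\<^sup>2 + (b i)\<^sup>2 / r)"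
      using abs_triangle_ineq4[of "(b i)\<^sup>2" "2 * (e i * b i)"] by simp
    then show "\<bar>(e i - b i)\<^sup>2 - (e i)\<^sup>2\<bar> \<le> r * (e i)\<^sup>2 + (1 / r + 1) * (b i)\<^sup>2"
      by (simp add: algebra_simps)
  qed
  also have "\<dots> = r * (\<Sum>i<n. (e i)\<^sup>2) + (1 / r + 1) * (\<Sum>i<n. (b i)\<^sup>2)"
    by (simp add: sum.distrib sum_distrib_left)
  also have "\<dots> \<le> r * (\<Sum>i<n. (e i)\<^sup>2) + (1 / r + 1) * (n * r\<^sup>2)"
    using b2 r by (intro add_left_mono mult_left_mono) auto
  also have "\<dots> = r * (\<Sum>i<n. (e i)\<^sup>2) + n * (r + r\<^sup>2)"
    using r by (simp add: field_simps power2_eq_square)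
  finally have "\<bar>(\<Sum>i<n. (e i - b i)\<^sup>2) - (\<Sum>i<n. (e i)\<^sup>2)\<bar> / (n * \<sigma>1\<^sup>2) \<le> (r * (\<Sum>i<n. (e i)\<^sup>2) + n * (r + r\<^sup>2)) / (n * \<sigma>1\<^sup>2)"
    by (rule divide_right_mono) simp
  then show "\<bar>I_tilde \<sigma>1 m n yx w - I_tilde \<sigma>1 m0 n yx w\<bar> \<le> r * I_tilde \<sigma>1 m0 n yx w + (r + r\<^sup>2) / \<sigma>1\<^sup>2"
    unfolding I I0 using n \<sigma>1 by (simp add: diff_divide_distrib[symmetric] add_divide_distrib abs_divide)
qed

text \<open>Translates the tilting bound into posterior terms:
  \<open>sqrt n * (\<beta> - \<beta>0)\<close> and the rescaled score recombine to the exponent of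
  \<open>lik_eq_exp_quadratic\<close>, and the prior is replaced by its Lebesgue density.\<close>

lemma (in normal_posterior) tv_dist_posterior_le:
  assumes dist: "distributed \<Pi>B lborel (\<lambda>\<beta>. \<beta>) (\<lambda>\<beta>. ennreal (\<pi> \<beta>))" and \<pi>_nonneg: "\<And>\<beta>. 0 \<le> \<pi> \<beta>"
    and A: "A \<in> sets \<Pi>M" and n: "0 < n" and v: "0 < v" and \<epsilon>: "0 \<le> \<epsilon>"
    and tilt: "\<And>m B. m \<in> A \<Longrightarrow> B \<in> sets borel \<Longrightarrow>
      (\<integral>\<^sup>+\<beta>\<in>B. ennreal (\<pi> \<beta> * exp (sqrt n * (\<beta> - \<beta>0) * (score_tilde \<sigma>1 \<beta>0 m n yx w / sqrt n) - (sqrt n * (\<beta> - \<beta>0))\<^sup>2 * I_tilde \<sigma>1 m n yx w / 2)) \<partial>lborel)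
      \<le> ennreal (measure (normal_law \<mu> v) B + \<epsilon>) *
        (\<integral>\<^sup>+\<beta>. ennreal (\<pi> \<beta> * exp (sqrt n * (\<beta> - \<beta>0) * (score_tilde \<sigma>1 \<beta>0 m n yx w / sqrt n) - (sqrt n * (\<beta> - \<beta>0))\<^sup>2 * I_tilde \<sigma>1 m n yx w / 2)) \<partial>lborel)"
    and mass: "1 - measure (post_m n yx) A \<le> \<epsilon>'"
  shows "tv_dist (post_beta n yx) (normal_law \<mu> v) \<le> ennreal (\<epsilon> + \<epsilon>')"
proof (rule tv_dist_le)
  show "prob_space (post_beta n yx)" by (rule prob_space_post_beta)
  show "sets (post_beta n yx) = sets borel" by (simp add: posterior_beta_def)
  show "prob_space (normal_law \<mu> v)" unfolding normal_law_def using v by (intro prob_space_normal_density) simp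
  show "sets (normal_law \<mu> v) = sets borel" by (simp add: normal_law_def)
  fix B :: "real set" assume B[measurable]: "B \<in> sets borel"
  have "measure (post_beta n yx) B \<le> (measure (normal_law \<mu> v) B + \<epsilon>) + (1 - measure (post_m n yx) A)"
  proof (rule posterior_beta_le[OF A B])
    fix m assume m: "m \<in> A"
    define g where "g \<beta> = exp ((\<beta> - \<beta>0) * score_tilde \<sigma>1 \<beta>0 m n yx w - real n * (\<beta> - \<beta>0)\<^sup>2 * I_tilde \<sigma>1 m n yx w / 2)" for \<beta>
    have [measurable]: "g \<in> borel_measurable borel" unfolding g_def by measurable
    have g: "exp (sqrt n * (\<beta> - \<beta>0) * (score_tilde \<sigma>1 \<beta>0 m n yx w / sqrt n) - (sqrt n * (\<beta> - \<beta>0))\<^sup>2 * I_tilde \<sigma>1 m n yx w / 2) = g \<beta>" for \<beta>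
      unfolding g_def using n by (simp add: power_mult_distrib)
    have d: "(\<integral>\<^sup>+\<beta>. h \<beta> \<partial>\<Pi>B) = (\<integral>\<^sup>+\<beta>. ennreal (\<pi> \<beta>) * h \<beta> \<partial>lborel)" if "h \<in> borel_measurable borel" for h
      using distributed_nn_integral[OF dist, of h] that by simp
    have 1: "(\<integral>\<^sup>+\<beta>. indicator B \<beta> * ennreal (g \<beta>) \<partial>\<Pi>B) = (\<integral>\<^sup>+\<beta>\<in>B. ennreal (\<pi> \<beta> * g \<beta>) \<partial>lborel)"
      by (subst d) (auto intro!: nn_integral_cong simp: \<pi>_nonneg ennreal_mult mult_ac g_def)
    have 2: "(\<integral>\<^sup>+\<beta>. ennreal (g \<beta>) \<partial>\<Pi>B) = (\<integral>\<^sup>+\<beta>. ennreal (\<pi> \<beta> * g \<beta>) \<partial>lborel)"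
      by (subst d) (auto intro!: nn_integral_cong simp: \<pi>_nonneg ennreal_mult mult_ac g_def)
    have "(\<integral>\<^sup>+\<beta>. indicator B \<beta> * ennreal (g \<beta>) \<partial>\<Pi>B) \<le> ennreal (measure (normal_law \<mu> v) B + \<epsilon>) * (\<integral>\<^sup>+\<beta>. ennreal (g \<beta>) \<partial>\<Pi>B)"
      using tilt[OF m B] unfolding g 1 2 .
    then show "(\<integral>\<^sup>+\<beta>. indicator B \<beta> * ennreal (exp ((\<beta> - \<beta>0) * score_tilde \<sigma>1 \<beta>0 m n yx w - real n * (\<beta> - \<beta>0)\<^sup>2 * I_tilde \<sigma>1 m n yx w / 2)) \<partial>\<Pi>B)
      \<le> ennreal (measure (normal_law \<mu> v) B + \<epsilon>) * (\<integral>\<^sup>+\<beta>. ennreal (exp ((\<beta> - \<beta>0) * score_tilde \<sigma>1 \<beta>0 m n yx w - real n * (\<beta> - \<beta>0)\<^sup>2 * I_tilde \<sigma>1 m n yx w / 2)) \<partial>\<Pi>B)"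
      unfolding g_def .
  qed (use \<epsilon> in simp)
  then show "measure (post_beta n yx) B \<le> measure (normal_law \<mu> v) B + (\<epsilon> + \<epsilon>')" using mass by linarith
qed

subsection \<open>Convergence in probability\<close>

lemma outer_measure_of_Un_le_ennreal:
  assumes "A \<subseteq> space M" "B \<subseteq> space M" "outer_measure_of M A \<le> ennreal a" "outer_measure_of M B \<le> ennreal b"
    and "0 \<le> a" "0 \<le> b"
  shows "outer_measure_of M (A \<union> B) \<le> ennreal (a + b)"
  using order_trans[OF outer_measure_of_Un_le[OF assms(1,2)] add_mono[OF assms(3,4)]] assms(5,6)
  by (simp add: ennreal_plus)

lemma tendsto_zero_in_probD:
  assumes "tendsto_zero_in_prob P Z" "0 < e" "0 < \<zeta>"
  shows "eventually (\<lambda>n. outer_measure_of (P n) {\<omega> \<in> space (P n). Z n \<omega> > ennreal e} \<le> ennreal \<zeta>) sequentially"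
proof -
  have "(\<lambda>n. outer_measure_of (P n) {\<omega> \<in> space (P n). Z n \<omega> > ennreal e}) \<longlonglongrightarrow> 0"
    using assms unfolding tendsto_zero_in_prob_def by blast
  then have "eventually (\<lambda>n. outer_measure_of (P n) {\<omega> \<in> space (P n). Z n \<omega> > ennreal e} < ennreal \<zeta>) sequentially"
    by (rule order_tendstoD) (use assms in simp)
  then show ?thesis by eventually_elim simp
qed

lemma tendsto_zero_in_probI:
  assumes "\<And>e \<zeta>. 0 < e \<Longrightarrow> 0 < \<zeta> \<Longrightarrow>
    eventually (\<lambda>n. outer_measure_of (P n) {\<omega> \<in> space (P n). Z n \<omega> > ennreal e} \<le> ennreal \<zeta>) sequentially"
  shows "tendsto_zero_in_prob P Z"
  unfolding tendsto_zero_in_prob_def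
proof (intro allI impI tendsto_zero_ennreal)
  fix e r :: real assume "0 < e" "0 < r"
  then have "eventually (\<lambda>n. outer_measure_of (P n) {\<omega> \<in> space (P n). Z n \<omega> > ennreal e} \<le> ennreal (r / 2)) sequentially"
    by (intro assms) auto
  then show "eventually (\<lambda>n. outer_measure_of (P n) {\<omega> \<in> space (P n). Z n \<omega> > ennreal e} < ennreal r) sequentially"
  proof eventually_elim
    case (elim n)
    also have "ennreal (r / 2) < ennreal r" using \<open>0 < r\<close> by (simp add: ennreal_less_iff)
    finally show ?case .
  qed
qed

text \<open>Write \<delta> as the rate times a null sequence \<rho>; the square of the rate is 1 /
  sqrt n, so the second sequence is the square of \<rho>. The equalities hold only for positive
  \<open>n\<close>.\<close>

lemma smallo_rate_tendsto:
  fixes \<delta> :: "nat \<Rightarrow> real"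
  assumes "\<delta> \<in> o(\<lambda>n. real n powr (- 1 / 4))"
  shows "\<delta> \<longlonglongrightarrow> 0" and "(\<lambda>n. sqrt (real n) * (\<delta> n)\<^sup>2) \<longlonglongrightarrow> 0"
proof -
  define \<rho> where "\<rho> n = \<delta> n / real n powr (- 1 / 4)" for n
  have \<rho>: "\<rho> \<longlonglongrightarrow> 0" using smalloD_tendsto[OF assms] unfolding \<rho>_def .
  have "(\<lambda>n. real n powr (- (1 / 4))) \<longlonglongrightarrow> 0"
    by (rule tendsto_neg_powr) (auto intro: filterlim_real_sequentially)
  from tendsto_mult[OF \<rho> this] have "(\<lambda>n. \<rho> n * real n powr (- (1 / 4))) \<longlonglongrightarrow> 0" by simp
  then show "\<delta> \<longlonglongrightarrow> 0"
  proof (rule Lim_transform_eventually)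
    show "\<forall>\<^sub>F n in sequentially. \<rho> n * real n powr (- (1 / 4)) = \<delta> n"
      using eventually_gt_at_top[of 0] by eventually_elim (simp add: \<rho>_def)
  qed
  from tendsto_power[OF \<rho>, of 2] have "(\<lambda>n. (\<rho> n)\<^sup>2) \<longlonglongrightarrow> 0" by simp
  then show "(\<lambda>n. sqrt (real n) * (\<delta> n)\<^sup>2) \<longlonglongrightarrow> 0"
  proof (rule Lim_transform_eventually)
    show "\<forall>\<^sub>F n in sequentially. (\<rho> n)\<^sup>2 = sqrt (real n) * (\<delta> n)\<^sup>2"
      using eventually_gt_at_top[of 0]
    proof eventually_elim
      case (elim n)
      have "(real n powr (- 1 / 4))\<^sup>2 = real n powr (- (1 / 2))"
        using elim by (simp add: powr_powr flip: powr_numeral)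
      also have "\<dots> = inverse (sqrt (real n))"
        using elim by (simp add: powr_minus powr_half_sqrt)
      finally have e: "1 / (real n powr (- 1 / 4))\<^sup>2 = sqrt (real n)"
        by (simp only: divide_inverse inverse_inverse_eq mult_1_left)
      have "(\<rho> n)\<^sup>2 = (\<delta> n)\<^sup>2 * (1 / (real n powr (- 1 / 4))\<^sup>2)"
        unfolding \<rho>_def by (simp only: power_divide times_divide_eq_right mult_1_right)
      then show ?case unfolding e by (simp only: mult.commute)
    qed
  qed
qed

section \<open>Localising sets in the space of nuisance functions\<close>

context normal_posterior
begin

text \<open>Membership depends only on finitely many evaluations at the covariates.\<close>

lemma B_nbhd_sets:
  assumes "space \<Pi>M = MM"
  shows "B_nbhd n w MM m0 r \<in> sets \<Pi>M"
proof -
  have "B_nbhd n w MM m0 r = {m \<in> space \<Pi>M. max (sqrt ((\<Sum>i<n. (fst m (w i) - fst m0 (w i))\<^sup>2) / real n))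
      (sqrt ((\<Sum>i<n. (snd m (w i) - snd m0 (w i))\<^sup>2) / real n)) < r}"
    unfolding B_nbhd_def emp_norm_def assms ..
  also have "\<dots> \<in> sets \<Pi>M" by measurable
  finally show ?thesis .
qed

text \<open>Union bound for the complements; the absolute values match the form in which convergence
  of the posterior masses is given.\<close>

lemma posterior_m_Int_ge:
  assumes A: "A \<in> sets \<Pi>M" and B: "B \<in> sets \<Pi>M"
  shows "1 - measure (post_m n yx) (A \<inter> B) \<le>
    \<bar>measure (post_m n yx) A - 1\<bar> + \<bar>measure (post_m n yx) B - 1\<bar>"
proof -
  interpret P: prob_space "post_m n yx" by (rule prob_space_post_m)
  have A': "A \<in> P.events" and B': "B \<in> P.events" using A B by simp_all
  have "P.prob (space (post_m n yx) - A \<inter> B) \<le> P.prob ((space (post_m n yx) - A) \<union> (space (post_m n yx) - B))"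
    using A' B' by (intro P.finite_measure_mono) (auto simp del: sets_post_m)
  also have "\<dots> \<le> P.prob (space (post_m n yx) - A) + P.prob (space (post_m n yx) - B)"
    using A' B' by (intro measure_Un_le) (auto simp del: sets_post_m)
  finally show ?thesis using P.prob_compl[OF A'] P.prob_compl[OF B'] P.prob_compl[OF sets.Int[OF A' B']] by linarith
qed

end

section \<open>Score and information under the conditional law\<close>

context plm
begin

lemma score_tilde_eq: "score_tilde \<sigma>1 \<beta>0 m0 n yx w = (\<Sum>i<n. uK (w i) (yx i) * eK (w i) (yx i)) / \<sigma>1\<^sup>2"
  unfolding score_tilde_def uK_def eK_def by simp

lemma I_tilde_eq: "I_tilde \<sigma>1 m0 n yx w = (\<Sum>i<n. (eK (w i) (yx i))\<^sup>2) / (real n * \<sigma>1\<^sup>2)"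
  unfolding I_tilde_def eK_def by (simp add: power_divide sum_divide_distrib[symmetric])

lemma K_borel_measurable: "w \<in> WW \<Longrightarrow> eK w \<in> borel_measurable (K w)" "w \<in> WW \<Longrightarrow> uK w \<in> borel_measurable (K w)"
  using eK_meas uK_meas by (auto simp: measurable_cong_sets[OF K_sets refl])

text \<open>By \<open>good\<close> each summand is centred with second moment
  \<open>\<sigma>1\<^sup>2 * vW (w i)\<close>, so Chebyshev's inequality applies.\<close>

lemma score_tail:
  assumes w: "\<And>i. good (w i)" and a: "0 < a"
  shows "outer_measure_of (cond_data_law K w n) {yx \<in> space (cond_data_law K w n). a \<le> \<bar>\<Sum>i<n. uK (w i) (yx i) * eK (w i) (yx i)\<bar>}
     \<le> ennreal (\<sigma>1\<^sup>2 * (\<Sum>i<n. vW (w i)) / a\<^sup>2)"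
proof -
  have WW: "w i \<in> WW" for i using w[of i] by (simp add: good_def)
  note [measurable] = K_borel_measurable[OF WW]
  have "emeasure (Pi\<^sub>M {..<n} (\<lambda>i. K (w i))) {yx \<in> space (Pi\<^sub>M {..<n} (\<lambda>i. K (w i))). a \<le> \<bar>\<Sum>i<n. uK (w i) (yx i) * eK (w i) (yx i)\<bar>}
    \<le> ennreal ((\<Sum>i<n. \<integral>z. (uK (w i) z * eK (w i) z)\<^sup>2 \<partial>K (w i)) / a\<^sup>2)"
    using w a by (intro PiM_sum_tail_le[where f = "\<lambda>i z. uK (w i) z * eK (w i) z"] K_prob[OF WW])
      (auto simp: good_def)
  also have "(\<Sum>i<n. \<integral>z. (uK (w i) z * eK (w i) z)\<^sup>2 \<partial>K (w i)) = \<sigma>1\<^sup>2 * (\<Sum>i<n. vW (w i))"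
    using w by (simp add: good_def sum_distrib_left)
  finally show ?thesis unfolding cond_data_law_def
    by (subst outer_measure_of_eq) measurable
qed

text \<open>The conditional variance of a squared residual is its fourth moment minus the squared
  second one, hence at most \<open>qW\<close>.\<close>

lemma info_tail:
  assumes w: "\<And>i. good (w i)" and a: "0 < a"
  shows "outer_measure_of (cond_data_law K w n) {yx \<in> space (cond_data_law K w n). a \<le> \<bar>\<Sum>i<n. (eK (w i) (yx i))\<^sup>2 - vW (w i)\<bar>}
     \<le> ennreal ((\<Sum>i<n. qW (w i)) / a\<^sup>2)"
proof -
  have WW: "w i \<in> WW" for i using w[of i] by (simp add: good_def)
  note [measurable] = K_borel_measurable[OF WW]
  have sq: "integrable (K (w i)) (\<lambda>z. ((eK (w i) z)\<^sup>2 - vW (w i))\<^sup>2)"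
    and sqle: "(\<integral>z. ((eK (w i) z)\<^sup>2 - vW (w i))\<^sup>2 \<partial>K (w i)) \<le> qW (w i)"
    and mean: "(\<integral>z. (eK (w i) z)\<^sup>2 - vW (w i) \<partial>K (w i)) = 0" for i
  proof -
    interpret Kw: prob_space "K (w i)" by (rule K_prob[OF WW])
    have g: "integrable (K (w i)) (\<lambda>z. eK (w i) z ^ 4)" "integrable (K (w i)) (\<lambda>z. (eK (w i) z)\<^sup>2)"
     "(\<integral>z. (eK (w i) z)\<^sup>2 \<partial>K (w i)) = vW (w i)" "(\<integral>z. eK (w i) z ^ 4 \<partial>K (w i)) = qW (w i)"
      using w[of i] by (auto simp: good_def)
    have e: "((eK (w i) z)\<^sup>2 - vW (w i))\<^sup>2 = eK (w i) z ^ 4 - 2 * vW (w i) * (eK (w i) z)\<^sup>2 + (vW (w i))\<^sup>2" for z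
      by (simp add: power2_diff power_mult[symmetric])
    show "integrable (K (w i)) (\<lambda>z. ((eK (w i) z)\<^sup>2 - vW (w i))\<^sup>2)" unfolding e using g by auto
    have "(\<integral>z. ((eK (w i) z)\<^sup>2 - vW (w i))\<^sup>2 \<partial>K (w i)) = qW (w i) - 2 * vW (w i) * vW (w i) + (vW (w i))\<^sup>2"
      unfolding e using g by (simp add: Kw.prob_space)
    then show "(\<integral>z. ((eK (w i) z)\<^sup>2 - vW (w i))\<^sup>2 \<partial>K (w i)) \<le> qW (w i)"
      by (simp add: power2_eq_square)
    show "(\<integral>z. (eK (w i) z)\<^sup>2 - vW (w i) \<partial>K (w i)) = 0" using g by (simp add: Kw.prob_space)
  qed
  have "emeasure (Pi\<^sub>M {..<n} (\<lambda>i. K (w i))) {yx \<in> space (Pi\<^sub>M {..<n} (\<lambda>i. K (w i))). a \<le> \<bar>\<Sum>i<n. (eK (w i) (yx i))\<^sup>2 - vW (w i)\<bar>}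
    \<le> ennreal ((\<Sum>i<n. \<integral>z. ((eK (w i) z)\<^sup>2 - vW (w i))\<^sup>2 \<partial>K (w i)) / a\<^sup>2)"
    using a sq mean by (intro PiM_sum_tail_le[where f = "\<lambda>i z. (eK (w i) z)\<^sup>2 - vW (w i)"] K_prob[OF WW]) auto
  also have "\<dots> \<le> ennreal ((\<Sum>i<n. qW (w i)) / a\<^sup>2)"
    using sqle by (intro ennreal_leI divide_right_mono sum_mono) auto
  finally show ?thesis unfolding cond_data_law_def
    by (subst outer_measure_of_eq) measurable
qed

end

section \<open>From bad events to total variation\<close>

context plm
begin

text \<open>Six bad events are removed, each of outer measure at most \<open>\<zeta> / 8\<close>:
  two for posterior masses, two for the suprema of \<open>G1\<close> and \<open>G2\<close>, and two
  Chebyshev events for score and information. On all other data the tilting costs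
  \<open>e / 2\<close> and the posterior mass outside \<open>A\<close> another
  \<open>e / 2\<close>.\<close>

lemma posterior_beta_tendsto_normal:
  fixes \<sigma>2 D :: real and \<Pi>B :: "real measure" and \<Pi>M :: "'d fn_pair measure" and w :: "nat \<Rightarrow> real ^ 'd"
    and \<pi>B :: "real \<Rightarrow> real" and \<delta> :: "nat \<Rightarrow> real" and Mn :: "nat \<Rightarrow> 'd fn_pair set"
  assumes NP: "normal_posterior \<sigma>1 \<sigma>2 \<Pi>B \<Pi>M w" and w: "typical w"
    and X_pos: "0 < (\<integral>\<omega>. (eX \<omega>)\<^sup>2 \<partial>P0)"
    and dist: "distributed \<Pi>B lborel (\<lambda>\<beta>. \<beta>) (\<lambda>\<beta>. ennreal (\<pi>B \<beta>))" and \<pi>_nonneg: "\<And>\<beta>. 0 \<le> \<pi>B \<beta>"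
    and cont: "isCont \<pi>B \<beta>0" and pos: "0 < \<pi>B \<beta>0"
    and \<delta>: "\<delta> \<in> o(\<lambda>n. real n powr (- 1 / 4))"
    and space_M: "space \<Pi>M = MM" and Mn: "\<And>n. n \<ge> 1 \<Longrightarrow> Mn n \<in> sets \<Pi>M"
    and rate: "tendsto_zero_in_prob (cond_data_law K w)
             (\<lambda>n yx. ennreal \<bar>measure (posterior_m \<sigma>1 \<sigma>2 \<Pi>B \<Pi>M n yx w) (B_nbhd n w MM m0 (D * \<delta> n)) - 1\<bar>)"
    and sieve: "tendsto_zero_in_prob (cond_data_law K w)
             (\<lambda>n yx. ennreal \<bar>measure (posterior_m \<sigma>1 \<sigma>2 \<Pi>B \<Pi>M n yx w) (Mn n) - 1\<bar>)"
    and G1: "tendsto_zero_in_prob (cond_data_law K w)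
             (\<lambda>n yx. SUP m \<in> Mn n \<inter> B_nbhd n w MM m0 (D * \<delta> n). ennreal \<bar>G1 m0 n yx w m\<bar>)"
    and G2: "tendsto_zero_in_prob (cond_data_law K w)
             (\<lambda>n yx. SUP m \<in> Mn n \<inter> B_nbhd n w MM m0 (D * \<delta> n). ennreal \<bar>G2 \<beta>0 m0 n yx w m\<bar>)"
  shows "tendsto_zero_in_prob (cond_data_law K w)
             (\<lambda>n yx. tv_dist (posterior_beta \<sigma>1 \<sigma>2 \<Pi>B \<Pi>M n yx w)
                       (normal_law (\<beta>0 + Delta_tilde \<sigma>1 \<beta>0 m0 n yx w / sqrt (real n))
                                   (1 / real n * inverse (I_tilde \<sigma>1 m0 n yx w))))"
proof (rule tendsto_zero_in_probI)
  fix e \<zeta> :: real assume e: "0 < e" and \<zeta>: "0 < \<zeta>"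
  interpret normal_posterior \<sigma>1 \<sigma>2 \<Pi>B \<Pi>M w by (rule NP)
  define c where "c = (\<integral>\<omega>. (eX \<omega>)\<^sup>2 \<partial>P0)"
  have c: "0 < c" unfolding c_def by (rule X_pos)
  have good: "good (w i)" for i using w by (simp add: typical_def)
  \<comment> \<open>The information at \<open>m0\<close> settles at
    \<open>c / \<sigma>1\<^sup>2\<close>; a factor 2 on either side leaves room for
    fluctuations.\<close>
  define c1 where "c1 = c / (2 * \<sigma>1\<^sup>2)"
  define c2 where "c2 = 2 * c / \<sigma>1\<^sup>2"
  \<comment> \<open>Chosen so that Chebyshev's bound for the rescaled score equals
    \<open>\<zeta> / 8\<close> when the average of \<open>vW\<close> is
    \<open>2 * c\<close>.\<close>
  define L where "L = sqrt (16 * c / (\<sigma>1\<^sup>2 * \<zeta>))"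
  have c1: "0 < c1" and L: "0 < L" using c \<zeta> \<sigma>1_pos by (simp_all add: c1_def L_def)
  have \<pi>_meas: "\<pi>B \<in> borel_measurable borel"
  proof -
    have "(\<lambda>\<beta>. ennreal (\<pi>B \<beta>)) \<in> borel_measurable borel"
      using distributed_borel_measurable[OF dist] by simp
    then have "(\<lambda>\<beta>. enn2real (ennreal (\<pi>B \<beta>))) \<in> borel_measurable borel" by measurable
    then show ?thesis using \<pi>_nonneg by simp
  qed
  have \<pi>_int: "(\<integral>\<^sup>+\<beta>. ennreal (\<pi>B \<beta>) \<partial>lborel) = 1"
    using distributed_nn_integral[OF dist, of "\<lambda>_. 1"] by (simp add: B.emeasure_space_1)
  obtain \<eta> where \<eta>: "0 < \<eta>" and tilt: "eventually (\<lambda>N. \<forall>s s0 I I0. \<forall>B\<in>sets borel.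
      \<bar>s0\<bar> \<le> L \<longrightarrow> c1 \<le> I0 \<longrightarrow> I0 \<le> c2 \<longrightarrow> \<bar>s - s0\<bar> \<le> \<eta> \<longrightarrow> \<bar>I - I0\<bar> \<le> \<eta> \<longrightarrow>
      (\<integral>\<^sup>+\<beta>\<in>B. ennreal (\<pi>B \<beta> * exp (sqrt N * (\<beta> - \<beta>0) * s - (sqrt N * (\<beta> - \<beta>0))\<^sup>2 * I / 2)) \<partial>lborel)
      \<le> ennreal (measure (normal_law (\<beta>0 + s0 / (I0 * sqrt N)) (1 / (N * I0))) B + e / 2) *
        (\<integral>\<^sup>+\<beta>. ennreal (\<pi>B \<beta> * exp (sqrt N * (\<beta> - \<beta>0) * s - (sqrt N * (\<beta> - \<beta>0))\<^sup>2 * I / 2)) \<partial>lborel)) at_top"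
    using tilted_prior_close_to_normal[OF \<pi>_meas \<pi>_nonneg \<pi>_int cont pos c1, of L "e / 2" c2] L e by auto
  have ev_tilt: "eventually (\<lambda>n. \<forall>s s0 I I0. \<forall>B\<in>sets borel.
      \<bar>s0\<bar> \<le> L \<longrightarrow> c1 \<le> I0 \<longrightarrow> I0 \<le> c2 \<longrightarrow> \<bar>s - s0\<bar> \<le> \<eta> \<longrightarrow> \<bar>I - I0\<bar> \<le> \<eta> \<longrightarrow>
      (\<integral>\<^sup>+\<beta>\<in>B. ennreal (\<pi>B \<beta> * exp (sqrt (real n) * (\<beta> - \<beta>0) * s - (sqrt (real n) * (\<beta> - \<beta>0))\<^sup>2 * I / 2)) \<partial>lborel)
      \<le> ennreal (measure (normal_law (\<beta>0 + s0 / (I0 * sqrt (real n))) (1 / (real n * I0))) B + e / 2) *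
        (\<integral>\<^sup>+\<beta>. ennreal (\<pi>B \<beta> * exp (sqrt (real n) * (\<beta> - \<beta>0) * s - (sqrt (real n) * (\<beta> - \<beta>0))\<^sup>2 * I / 2)) \<partial>lborel)) sequentially"
    using filterlim_real_sequentially tilt by (rule eventually_compose_filterlim[rotated])
  define r where "r n = D * \<delta> n" for n
  have r0: "r \<longlonglongrightarrow> 0"
    unfolding r_def using tendsto_mult_right_zero[OF smallo_rate_tendsto(1)[OF \<delta>]] .
  have "(\<lambda>n. D\<^sup>2 * (sqrt (real n) * (\<delta> n)\<^sup>2)) \<longlonglongrightarrow> 0"
    using tendsto_mult_right_zero[OF smallo_rate_tendsto(2)[OF \<delta>]] .
  then have r2: "(\<lambda>n. sqrt (real n) * (r n)\<^sup>2) \<longlonglongrightarrow> 0"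
    unfolding r_def power_mult_distrib by (simp add: mult_ac)
  have "(\<lambda>n. (1 + \<bar>\<beta>0\<bar>) * (sqrt (real n) * (r n)\<^sup>2)) \<longlonglongrightarrow> 0"
    using tendsto_mult_right_zero[OF r2] .
  \<comment> \<open>The score perturbation has three contributions, \<open>G1\<close>,
    \<open>G2\<close> and the quadratic remainder; each is allotted a third of
    \<open>\<eta> * \<sigma>1\<^sup>2\<close>.\<close>
  then have ev_r1: "eventually (\<lambda>n. (1 + \<bar>\<beta>0\<bar>) * (sqrt (real n) * (r n)\<^sup>2) < \<eta> * \<sigma>1\<^sup>2 / 3) sequentially"
    by (rule order_tendstoD(2)) (use \<eta> \<sigma>1_pos in simp)
  \<comment> \<open>Nothing fixes the sign of \<open>\<delta> n\<close>, hence the absolute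
    value.\<close>
  have "(\<lambda>n. \<bar>r n\<bar> * c2 + (r n + (r n)\<^sup>2) / \<sigma>1\<^sup>2) \<longlonglongrightarrow> \<bar>0\<bar> * c2 + (0 + 0\<^sup>2) / \<sigma>1\<^sup>2"
    using r0 \<sigma>1_pos by (intro tendsto_intros) auto
  then have ev_r2: "eventually (\<lambda>n. \<bar>r n\<bar> * c2 + (r n + (r n)\<^sup>2) / \<sigma>1\<^sup>2 < \<eta>) sequentially"
    by (rule order_tendstoD(2)) (use \<eta> in simp)
  have lim_v: "(\<lambda>n. (\<Sum>i<n. vW (w i)) / real n) \<longlonglongrightarrow> c"
    using w by (simp add: typical_def c_def)
  \<comment> \<open>The average of \<open>vW\<close> stays within \<open>c / 4\<close> of its limit,
    and outside \<open>E6\<close> the mean squared residual stays within \<open>c / 4\<close> of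
    that average; together they confine it between \<open>c / 2\<close> and
    \<open>2 * c\<close>.\<close>
  have ev_v: "eventually (\<lambda>n. (\<Sum>i<n. vW (w i)) / real n < 5 * c / 4) sequentially"
      "eventually (\<lambda>n. 3 * c / 4 < (\<Sum>i<n. vW (w i)) / real n) sequentially"
    by (rule order_tendstoD(2)[OF lim_v] order_tendstoD(1)[OF lim_v], use c in simp)+
  have "(\<lambda>n. (\<Sum>i<n. qW (w i)) / (real n)\<^sup>2) \<longlonglongrightarrow> 0"
    using w by (simp add: typical_def)
  \<comment> \<open>The factor \<open>(c / 4)\<^sup>2\<close> anticipates Chebyshev's inequality at
    the threshold \<open>n * (c / 4)\<close>.\<close>
  then have ev_q: "eventually (\<lambda>n. (\<Sum>i<n. qW (w i)) / (real n)\<^sup>2 < \<zeta> / 8 * (c / 4)\<^sup>2) sequentially"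
    by (rule order_tendstoD(2)) (use c \<zeta> in simp)
  have e4: "0 < e / 4" and \<zeta>8: "0 < \<zeta> / 8" and \<eta>3: "0 < \<eta> * \<sigma>1\<^sup>2 / 3" using e \<zeta> \<eta> \<sigma>1_pos by auto
  show "eventually (\<lambda>n. outer_measure_of (cond_data_law K w n) {yx \<in> space (cond_data_law K w n).
      tv_dist (posterior_beta \<sigma>1 \<sigma>2 \<Pi>B \<Pi>M n yx w)
                       (normal_law (\<beta>0 + Delta_tilde \<sigma>1 \<beta>0 m0 n yx w / sqrt (real n))
                                   (1 / real n * inverse (I_tilde \<sigma>1 m0 n yx w))) > ennreal e} \<le> ennreal \<zeta>) sequentially"
    using ev_tilt ev_r1 ev_r2 ev_v ev_q eventually_gt_at_top[of 0]
      tendsto_zero_in_probD[OF rate e4 \<zeta>8] tendsto_zero_in_probD[OF sieve e4 \<zeta>8]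
      tendsto_zero_in_probD[OF G1 \<eta>3 \<zeta>8] tendsto_zero_in_probD[OF G2 \<eta>3 \<zeta>8]
  proof eventually_elim
    case (elim n)
    note n = elim(7)
    let ?P = "cond_data_law K w n"
    define A where "A = Mn n \<inter> B_nbhd n w MM m0 (D * \<delta> n)"
    have nb: "B_nbhd n w MM m0 (D * \<delta> n) \<in> sets \<Pi>M" by (rule B_nbhd_sets[OF space_M])
    have Mnn: "Mn n \<in> sets \<Pi>M" using n by (intro Mn) simp
    have A: "A \<in> sets \<Pi>M" unfolding A_def using nb Mnn by auto
    define E1 where "E1 = {yx \<in> space ?P. ennreal \<bar>measure (post_m n yx) (B_nbhd n w MM m0 (D * \<delta> n)) - 1\<bar> > ennreal (e / 4)}"
    define E2 where "E2 = {yx \<in> space ?P. ennreal \<bar>measure (post_m n yx) (Mn n) - 1\<bar> > ennreal (e / 4)}"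
    define E3 where "E3 = {yx \<in> space ?P. (SUP m \<in> A. ennreal \<bar>G1 m0 n yx w m\<bar>) > ennreal (\<eta> * \<sigma>1\<^sup>2 / 3)}"
    define E4 where "E4 = {yx \<in> space ?P. (SUP m \<in> A. ennreal \<bar>G2 \<beta>0 m0 n yx w m\<bar>) > ennreal (\<eta> * \<sigma>1\<^sup>2 / 3)}"
    define E5 where "E5 = {yx \<in> space ?P. L * \<sigma>1\<^sup>2 * sqrt n \<le> \<bar>\<Sum>i<n. uK (w i) (yx i) * eK (w i) (yx i)\<bar>}"
    define E6 where "E6 = {yx \<in> space ?P. n * (c / 4) \<le> \<bar>\<Sum>i<n. (eK (w i) (yx i))\<^sup>2 - vW (w i)\<bar>}"
    have o1: "outer_measure_of ?P E1 \<le> ennreal (\<zeta> / 8)" "outer_measure_of ?P E2 \<le> ennreal (\<zeta> / 8)"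
      "outer_measure_of ?P E3 \<le> ennreal (\<zeta> / 8)" "outer_measure_of ?P E4 \<le> ennreal (\<zeta> / 8)"
      unfolding E1_def E2_def E3_def E4_def A_def by (fact elim(8-11))+
    have o5: "outer_measure_of ?P E5 \<le> ennreal (\<zeta> / 8)"
    proof -
      have a: "0 < L * \<sigma>1\<^sup>2 * sqrt n" using L \<sigma>1_pos n by simp
      have "outer_measure_of ?P E5 \<le> ennreal (\<sigma>1\<^sup>2 * (\<Sum>i<n. vW (w i)) / (L * \<sigma>1\<^sup>2 * sqrt n)\<^sup>2)"
        unfolding E5_def by (rule score_tail[OF good a])
      also have "\<dots> \<le> ennreal (\<zeta> / 8)"
      proof (rule ennreal_leI)
        have L2: "L\<^sup>2 = 16 * c / (\<sigma>1\<^sup>2 * \<zeta>)" unfolding L_def using c \<sigma>1_pos \<zeta> by simp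
        have "\<sigma>1\<^sup>2 * (\<Sum>i<n. vW (w i)) / (L * \<sigma>1\<^sup>2 * sqrt n)\<^sup>2 = ((\<Sum>i<n. vW (w i)) / real n) * (1 / (L\<^sup>2 * \<sigma>1\<^sup>2))"
          using \<sigma>1_pos n L by (simp add: power_mult_distrib field_simps)
        also have "1 / (L\<^sup>2 * \<sigma>1\<^sup>2) = \<zeta> / (16 * c)" unfolding L2 using \<sigma>1_pos by simp
        also have "((\<Sum>i<n. vW (w i)) / real n) * (\<zeta> / (16 * c)) \<le> (2 * c) * (\<zeta> / (16 * c))"
          by (rule mult_right_mono) (use elim(4) c \<zeta> in \<open>linarith, simp\<close>)
        also have "\<dots> = \<zeta> / 8" using c by simp
        finally show "\<sigma>1\<^sup>2 * (\<Sum>i<n. vW (w i)) / (L * \<sigma>1\<^sup>2 * sqrt n)\<^sup>2 \<le> \<zeta> / 8" .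
      qed
      finally show ?thesis .
    qed
    have o6: "outer_measure_of ?P E6 \<le> ennreal (\<zeta> / 8)"
    proof -
      have a: "0 < n * (c / 4)" using c n by simp
      have "outer_measure_of ?P E6 \<le> ennreal ((\<Sum>i<n. qW (w i)) / (n * (c / 4))\<^sup>2)"
        unfolding E6_def by (rule info_tail[OF good a])
      also have "\<dots> \<le> ennreal (\<zeta> / 8)"
      proof (rule ennreal_leI)
        have "(\<Sum>i<n. qW (w i)) / (n * (c / 4))\<^sup>2 = ((\<Sum>i<n. qW (w i)) / (real n)\<^sup>2) / (c / 4)\<^sup>2"
          by (simp only: power_mult_distrib divide_divide_eq_left)
        also have "\<dots> \<le> (\<zeta> / 8 * (c / 4)\<^sup>2) / (c / 4)\<^sup>2"
          using elim(6) by (intro divide_right_mono) auto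
        also have "\<dots> = \<zeta> / 8" using c by simp
        finally show "(\<Sum>i<n. qW (w i)) / (n * (c / 4))\<^sup>2 \<le> \<zeta> / 8" .
      qed
      finally show ?thesis .
    qed
    have sub: "E1 \<subseteq> space ?P" "E2 \<subseteq> space ?P" "E3 \<subseteq> space ?P" "E4 \<subseteq> space ?P" "E5 \<subseteq> space ?P" "E6 \<subseteq> space ?P"
      unfolding E1_def E2_def E3_def E4_def E5_def E6_def by auto
    have z0: "0 \<le> \<zeta> / 8" using \<zeta> by simp
    have "outer_measure_of ?P (E1 \<union> (E2 \<union> (E3 \<union> (E4 \<union> (E5 \<union> E6))))) \<le> ennreal (\<zeta> / 8 + (\<zeta> / 8 + (\<zeta> / 8 + (\<zeta> / 8 + (\<zeta> / 8 + \<zeta> / 8)))))"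
      by (intro outer_measure_of_Un_le_ennreal o1 o5 o6 sub Un_least add_nonneg_nonneg z0)
    also have "\<dots> \<le> ennreal \<zeta>" using \<zeta> by (intro ennreal_leI) simp
    finally have bad: "outer_measure_of ?P (E1 \<union> (E2 \<union> (E3 \<union> (E4 \<union> (E5 \<union> E6))))) \<le> ennreal \<zeta>" .
    have "{yx \<in> space ?P. tv_dist (post_beta n yx)
             (normal_law (\<beta>0 + Delta_tilde \<sigma>1 \<beta>0 m0 n yx w / sqrt (real n))
                (1 / real n * inverse (I_tilde \<sigma>1 m0 n yx w))) > ennreal e} \<subseteq> E1 \<union> (E2 \<union> (E3 \<union> (E4 \<union> (E5 \<union> E6))))"
    proof (rule subsetI, rule ccontr)
      fix yx assume "yx \<in> {yx \<in> space ?P. tv_dist (post_beta n yx)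
             (normal_law (\<beta>0 + Delta_tilde \<sigma>1 \<beta>0 m0 n yx w / sqrt (real n))
                (1 / real n * inverse (I_tilde \<sigma>1 m0 n yx w))) > ennreal e}"
      then have yx: "yx \<in> space ?P" and far: "tv_dist (post_beta n yx)
             (normal_law (\<beta>0 + Delta_tilde \<sigma>1 \<beta>0 m0 n yx w / sqrt (real n))
                (1 / real n * inverse (I_tilde \<sigma>1 m0 n yx w))) > ennreal e" by auto
      assume "yx \<notin> E1 \<union> (E2 \<union> (E3 \<union> (E4 \<union> (E5 \<union> E6))))"
      then have ok1: "\<bar>measure (post_m n yx) (B_nbhd n w MM m0 (D * \<delta> n)) - 1\<bar> \<le> e / 4"
        and ok2: "\<bar>measure (post_m n yx) (Mn n) - 1\<bar> \<le> e / 4"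
        and ok3: "(SUP m \<in> A. ennreal \<bar>G1 m0 n yx w m\<bar>) \<le> ennreal (\<eta> * \<sigma>1\<^sup>2 / 3)"
        and ok4: "(SUP m \<in> A. ennreal \<bar>G2 \<beta>0 m0 n yx w m\<bar>) \<le> ennreal (\<eta> * \<sigma>1\<^sup>2 / 3)"
        and ok5: "\<bar>\<Sum>i<n. uK (w i) (yx i) * eK (w i) (yx i)\<bar> \<le> L * \<sigma>1\<^sup>2 * sqrt n"
        and ok6: "\<bar>\<Sum>i<n. (eK (w i) (yx i))\<^sup>2 - vW (w i)\<bar> \<le> n * (c / 4)"
        using yx e4 unfolding E1_def E2_def E3_def E4_def E5_def E6_def
        by (auto simp: not_less ennreal_le_iff)
      define s0 where "s0 = score_tilde \<sigma>1 \<beta>0 m0 n yx w / sqrt n"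
      define I0 where "I0 = I_tilde \<sigma>1 m0 n yx w"
      have s0: "\<bar>s0\<bar> \<le> L"
      proof -
        have "\<bar>s0\<bar> = \<bar>\<Sum>i<n. uK (w i) (yx i) * eK (w i) (yx i)\<bar> / (\<sigma>1\<^sup>2 * sqrt n)"
          unfolding s0_def score_tilde_eq by (simp add: abs_divide)
        also have "\<dots> \<le> (L * \<sigma>1\<^sup>2 * sqrt n) / (\<sigma>1\<^sup>2 * sqrt n)"
          using ok5 by (intro divide_right_mono) auto
        also have "\<dots> = L" using \<sigma>1_pos n by simp
        finally show ?thesis .
      qed
      have I0: "c1 \<le> I0" "I0 \<le> c2"
      proof -
        define S where "S = (\<Sum>i<n. (eK (w i) (yx i))\<^sup>2)"
        define V where "V = (\<Sum>i<n. vW (w i))"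
        define x where "x = real n * c"
        have "0 < x" using n c by (simp add: x_def)
        moreover have "\<bar>S - V\<bar> \<le> x / 4" using ok6 by (simp add: S_def V_def x_def sum_subtractf)
        moreover have "V < 5 * x / 4" "3 * x / 4 < V"
          using elim(4,5) n unfolding V_def x_def by (simp_all add: field_simps)
        ultimately have "S \<le> 2 * x" "x / 2 \<le> S" by linarith+
        then have "S \<le> n * (2 * c)" and S: "n * (c / 2) \<le> S" by (simp_all add: x_def mult_ac)
        then have "S / (n * \<sigma>1\<^sup>2) \<le> n * (2 * c) / (n * \<sigma>1\<^sup>2)"
          by (intro divide_right_mono) auto
        moreover have "n * (c / 2) / (n * \<sigma>1\<^sup>2) \<le> S / (n * \<sigma>1\<^sup>2)"
          using S by (rule divide_right_mono) simp
        ultimately show "c1 \<le> I0" "I0 \<le> c2"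
          unfolding I0_def I_tilde_eq S_def[symmetric] c1_def c2_def using n by simp_all
      qed
      have I0p: "0 < I0" using I0 c1 by simp
      have "tv_dist (post_beta n yx) (normal_law (\<beta>0 + s0 / (I0 * sqrt (real n))) (1 / (real n * I0))) \<le> ennreal (e / 2 + e / 2)"
      proof (rule tv_dist_posterior_le[OF dist \<pi>_nonneg A n])
        show "0 < 1 / (real n * I0)" using n I0p by simp
        show "0 \<le> e / 2" using e by simp
        show "1 - measure (post_m n yx) A \<le> e / 2"
          using posterior_m_Int_ge[OF Mnn nb, of n yx] ok1 ok2 unfolding A_def by linarith
        fix m B assume m: "m \<in> A" and B: "B \<in> sets (borel :: real measure)"
        have mN: "m \<in> B_nbhd n w MM m0 (r n)" using m by (simp add: A_def r_def)
        have g1: "\<bar>G1 m0 n yx w m\<bar> \<le> \<eta> * \<sigma>1\<^sup>2 / 3" and g2: "\<bar>G2 \<beta>0 m0 n yx w m\<bar> \<le> \<eta> * \<sigma>1\<^sup>2 / 3"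
          using order_trans[OF SUP_upper[OF m] ok3] order_trans[OF SUP_upper[OF m] ok4] \<eta>3
          by (simp_all add: ennreal_le_iff)
        have "\<bar>score_tilde \<sigma>1 \<beta>0 m n yx w / sqrt n - s0\<bar> \<le> (\<eta> * \<sigma>1\<^sup>2) / \<sigma>1\<^sup>2"
          unfolding s0_def
          by (rule order_trans[OF score_tilde_I_tilde_perturb(1)[OF n \<sigma>1_pos mN]], rule divide_right_mono)
             (use g1 g2 elim(2) in linarith, simp)
        then have ds: "\<bar>score_tilde \<sigma>1 \<beta>0 m n yx w / sqrt n - s0\<bar> \<le> \<eta>" using \<sigma>1_pos by simp
        have "\<bar>I_tilde \<sigma>1 m n yx w - I0\<bar> \<le> r n * I0 + (r n + (r n)\<^sup>2) / \<sigma>1\<^sup>2"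
          unfolding I0_def by (rule score_tilde_I_tilde_perturb(2)[OF n \<sigma>1_pos mN])
        moreover have "r n * I0 \<le> \<bar>r n\<bar> * c2" using I0 I0p by (intro mult_mono) auto
        ultimately have dI: "\<bar>I_tilde \<sigma>1 m n yx w - I0\<bar> \<le> \<eta>" using elim(3) by linarith
        show "(\<integral>\<^sup>+\<beta>\<in>B. ennreal (\<pi>B \<beta> * exp (sqrt n * (\<beta> - \<beta>0) * (score_tilde \<sigma>1 \<beta>0 m n yx w / sqrt n) - (sqrt n * (\<beta> - \<beta>0))\<^sup>2 * I_tilde \<sigma>1 m n yx w / 2)) \<partial>lborel)
          \<le> ennreal (measure (normal_law (\<beta>0 + s0 / (I0 * sqrt (real n))) (1 / (real n * I0))) B + e / 2) *
            (\<integral>\<^sup>+\<beta>. ennreal (\<pi>B \<beta> * exp (sqrt n * (\<beta> - \<beta>0) * (score_tilde \<sigma>1 \<beta>0 m n yx w / sqrt n) - (sqrt n * (\<beta> - \<beta>0))\<^sup>2 * I_tilde \<sigma>1 m n yx w / 2)) \<partial>lborel)"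
          using elim(1) B s0 I0 ds dI by blast
      qed
      also have "s0 / (I0 * sqrt (real n)) = Delta_tilde \<sigma>1 \<beta>0 m0 n yx w / sqrt (real n)"
        unfolding Delta_tilde_def s0_def I0_def[symmetric] by (simp add: divide_inverse mult_ac)
      also have "1 / (real n * I0) = 1 / real n * inverse (I_tilde \<sigma>1 m0 n yx w)"
        unfolding I0_def by (simp add: divide_inverse)
      finally show False using far by simp
    qed
    then show ?case by (rule order_trans[OF outer_measure_of_mono bad])
  qed
qed

end

theorem theorem1:
  fixes P0 :: "'d::finite obs measure"
    and YY XX :: "real set" and WW :: "(real ^ 'd) set"
    and K :: "(real ^ 'd) \<Rightarrow> (real \<times> real) measure"
    and p0 :: "(real ^ 'd) \<Rightarrow> real \<times> real \<Rightarrow> real"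
    and m0 :: "'d fn_pair" and \<eta>0 :: "(real ^ 'd) \<Rightarrow> real"
    and HH M1 M2 :: "((real ^ 'd) \<Rightarrow> real) set"
    and BB :: "real set"
    and \<beta>0 \<sigma>1 \<sigma>2 c_lo c_hi D :: real
    and \<Pi>B :: "real measure" and \<Pi>M :: "'d fn_pair measure"
    and \<pi>B :: "real \<Rightarrow> real"
    and \<delta> :: "nat \<Rightarrow> real"
    and Mn :: "nat \<Rightarrow> 'd fn_pair set"
  assumes P0_prob: "prob_space P0"
    and P0_sets: "sets P0 = sets (restrict_space borel (YY \<times> XX \<times> WW))"
    and m01: "is_regression P0 WW obs_Y (fst m0)"
    and m02: "is_regression P0 WW obs_X (snd m0)"
    and K: "is_cond_law_YX P0 WW K"
    and \<sigma>1_pos: "\<sigma>1 > 0" and \<sigma>2_pos: "\<sigma>2 > 0"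
    and M1_sub: "M1 \<subseteq> L2_W P0 WW" and M2_sub: "M2 \<subseteq> L2_W P0 WW"
    and \<Pi>B_prob: "prob_space \<Pi>B" and \<Pi>B_sets: "sets \<Pi>B = sets (restrict_space borel BB)"
    and \<Pi>M_prob: "prob_space \<Pi>M" and \<Pi>M_space: "space \<Pi>M = M1 \<times> M2"
    and eval1: "\<And>w. w \<in> WW \<Longrightarrow> (\<lambda>m. fst m w) \<in> borel_measurable \<Pi>M"
    and eval2: "\<And>w. w \<in> WW \<Longrightarrow> (\<lambda>m. snd m w) \<in> borel_measurable \<Pi>M"
    and \<beta>0_in: "\<beta>0 \<in> BB" and HH_sub: "HH \<subseteq> L2_W P0 WW" and \<eta>0_in: "\<eta>0 \<in> HH"
    and plm_mean: "AE \<omega> in P0. real_cond_exp P0 (sigma_of P0 (\<lambda>\<omega>. (obs_X \<omega>, obs_W \<omega>))) obs_Y \<omega>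
                     = obs_X \<omega> * \<beta>0 + \<eta>0 (obs_W \<omega>)"
    and plm_var: "AE \<omega> in P0. cond_var P0 (sigma_of P0 (\<lambda>\<omega>. (obs_X \<omega>, obs_W \<omega>))) obs_Y \<omega> = \<sigma>1\<^sup>2"
    and c_bounds: "0 < c_lo" "c_lo < c_hi"
    and X_var: "(\<integral>\<^sup>+ \<omega>. ennreal ((obs_X \<omega> - snd m0 (obs_W \<omega>))\<^sup>2) \<partial>P0) \<in> {ennreal c_lo .. ennreal c_hi}"
    and p0_meas: "case_prod p0 \<in> borel_measurable (restrict_space borel WW \<Otimes>\<^sub>M borel)"
    and p0_nonneg: "\<And>w z. w \<in> WW \<Longrightarrow> 0 \<le> p0 w z"
    and p0_dens: "AE w in law_W P0 WW. K w = density lborel (\<lambda>z. ennreal (p0 w z))"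
    and p0_log: "(\<integral>\<^sup>+ \<omega>. ennreal \<bar>ln (p0 (obs_W \<omega>) (obs_Y \<omega>, obs_X \<omega>))\<bar> \<partial>P0) \<in> {0<..<\<infinity>}"
    and Y_mom: "(\<integral>\<^sup>+ \<omega>. ennreal ((obs_Y \<omega> - fst m0 (obs_W \<omega>))\<^sup>2) \<partial>P0) \<in> {0<..<\<infinity>}"
    and X_mom: "(\<integral>\<^sup>+ \<omega>. ennreal ((obs_X \<omega> - snd m0 (obs_W \<omega>)) ^ 4) \<partial>P0) \<in> {0<..<\<infinity>}"
    and evid: "\<And>n. n \<ge> 1 \<Longrightarrow> AE \<omega> in Pi\<^sub>M UNIV (\<lambda>_::nat. P0).
                 evidence \<sigma>1 \<sigma>2 \<Pi>B \<Pi>M n (\<lambda>i. (obs_Y (\<omega> i), obs_X (\<omega> i))) (\<lambda>i. obs_W (\<omega> i)) \<in> {0<..<\<infinity>}"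
    and \<Pi>B_dens: "distributed \<Pi>B lborel (\<lambda>\<beta>. \<beta>) (\<lambda>\<beta>. ennreal (\<pi>B \<beta>))"
    and \<pi>B_nonneg: "\<And>\<beta>. 0 \<le> \<pi>B \<beta>"
    and \<pi>B_nbhd: "\<exists>N. open N \<and> \<beta>0 \<in> N \<and> continuous_on N \<pi>B \<and> (\<forall>\<beta> \<in> N. \<pi>B \<beta> > 0)"
    and \<delta>_rate: "\<delta> \<in> o(\<lambda>n. real n powr (- 1 / 4))" and D_pos: "D > 0"
    and post_rate: "AE w in Pi\<^sub>M UNIV (\<lambda>_::nat. law_W P0 WW).
           tendsto_zero_in_prob (cond_data_law K w)
             (\<lambda>n yx. ennreal \<bar>measure (posterior_m \<sigma>1 \<sigma>2 \<Pi>B \<Pi>M n yx w)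
                                (B_nbhd n w (M1 \<times> M2) m0 (D * \<delta> n)) - 1\<bar>)"
    and Mn_sets: "\<And>n. n \<ge> 1 \<Longrightarrow> Mn n \<in> sets \<Pi>M"
    and post_sieve: "AE w in Pi\<^sub>M UNIV (\<lambda>_::nat. law_W P0 WW).
           tendsto_zero_in_prob (cond_data_law K w)
             (\<lambda>n yx. ennreal \<bar>measure (posterior_m \<sigma>1 \<sigma>2 \<Pi>B \<Pi>M n yx w) (Mn n) - 1\<bar>) \<and>
           tendsto_zero_in_prob (cond_data_law K w)
             (\<lambda>n yx. SUP m \<in> Mn n \<inter> B_nbhd n w (M1 \<times> M2) m0 (D * \<delta> n).
                        ennreal \<bar>G1 m0 n yx w m\<bar>) \<and>
           tendsto_zero_in_prob (cond_data_law K w)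
             (\<lambda>n yx. SUP m \<in> Mn n \<inter> B_nbhd n w (M1 \<times> M2) m0 (D * \<delta> n).
                        ennreal \<bar>G2 \<beta>0 m0 n yx w m\<bar>)"
    and \<beta>0_int: "\<beta>0 \<in> interior BB"
  shows "AE w in Pi\<^sub>M UNIV (\<lambda>_::nat. law_W P0 WW).
           tendsto_zero_in_prob (cond_data_law K w)
             (\<lambda>n yx. tv_dist (posterior_beta \<sigma>1 \<sigma>2 \<Pi>B \<Pi>M n yx w)
                       (normal_law (\<beta>0 + Delta_tilde \<sigma>1 \<beta>0 m0 n yx w / sqrt (real n))
                                   (1 / real n * inverse (I_tilde \<sigma>1 m0 n yx w))))"
proof -
  have \<eta>0L: "\<eta>0 \<in> L2_W P0 WW" using \<eta>0_in HH_sub by blast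
  have Y_mom': "(\<integral>\<^sup>+ \<omega>. ennreal ((obs_Y \<omega> - fst m0 (obs_W \<omega>))\<^sup>2) \<partial>P0) < \<infinity>"
    and X_mom': "(\<integral>\<^sup>+ \<omega>. ennreal ((obs_X \<omega> - snd m0 (obs_W \<omega>)) ^ 4) \<partial>P0) < \<infinity>"
    using Y_mom X_mom by simp_all
  interpret plm P0 YY XX WW K m0 \<eta>0 \<beta>0 \<sigma>1
    by (intro plm.intro cond_law.intro plm_axioms.intro)
       (fact P0_prob P0_sets K m01 m02 \<sigma>1_pos \<eta>0L plm_mean plm_var Y_mom' X_mom')+
  \<comment> \<open>The lower bound \<open>c_lo\<close> keeps the limit of the information away from
    0, so that the approximating normal law has variance of exact order 1 / n.\<close>
  have X_pos: "0 < (\<integral>\<omega>. (eX \<omega>)\<^sup>2 \<partial>P0)"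
  proof -
    have "ennreal c_lo \<le> (\<integral>\<^sup>+\<omega>. ennreal ((eX \<omega>)\<^sup>2) \<partial>P0)" using X_var by (simp add: eX_def)
    also have "\<dots> = ennreal (\<integral>\<omega>. (eX \<omega>)\<^sup>2 \<partial>P0)"
      by (rule nn_integral_eq_integral[OF int_eX2]) simp
    finally show ?thesis using c_bounds(1) by (simp add: ennreal_le_iff2)
  qed
  have cont: "isCont \<pi>B \<beta>0" and pos: "0 < \<pi>B \<beta>0"
    using \<pi>B_nbhd by (auto simp: continuous_on_eq_continuous_at)
  have "(\<lambda>\<beta>. \<beta>) \<in> borel_measurable \<Pi>B"
    unfolding measurable_cong_sets[OF \<Pi>B_sets refl] by (rule measurable_restrict_space1) simp
  moreover have "w i \<in> WW" if "typical w" for w i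
    using that by (simp add: typical_def good_def)
  \<comment> \<open>Evaluation at a point is known to be measurable only for points of
    \<open>WW\<close>, and \<open>typical\<close> places every \<open>w i\<close> there.\<close>
  ultimately have NP: "normal_posterior \<sigma>1 \<sigma>2 \<Pi>B \<Pi>M w" if "typical w" for w
    using that \<sigma>1_pos \<sigma>2_pos \<Pi>B_prob \<Pi>M_prob eval1 eval2 by (intro normal_posterior.intro) auto
  from AE_typical post_rate post_sieve show ?thesis
  proof eventually_elim
    case (elim w)
    note s = elim(3)[THEN conjunct1] elim(3)[THEN conjunct2, THEN conjunct1] elim(3)[THEN conjunct2, THEN conjunct2]
    show ?case
      by (rule posterior_beta_tendsto_normal[OF NP[OF elim(1)] elim(1) X_pos \<Pi>B_dens \<pi>B_nonneg cont pos
            \<delta>_rate \<Pi>M_space Mn_sets elim(2) s])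
  qed
qed

end
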